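(* Let $\Gamma$ be a star-shaped tropical curve consisting of a finite number $n\geq 1$ of copies of $[0,\infty]$. (1) If $n\neq 2$, then $\operatorname{Aut}(\Gamma)\cong S_n$ and $\operatorname{Aut}_{\mathrm{semiring}}(\operatorname{Rat}(\Gamma))\cong\operatorname{Aut}(\Gamma)\times\mathbb{R}_{>0}$, where $S_n$ is the symmetric group of degree $n$ and $\mathbb{R}_{>0}$ is regarded as a group under the usual multiplication. (2) Let $n=2$, let $\Gamma$ be identified with $[-\infty,\infty]$, and let $\iota$ be the inversion with respect to $0$. Then $$\operatorname{Aut}(\Gamma)=\langle\{\text{the inversion with respect to }x \mid x\in\Gamma\setminus\Gamma_\infty\}\rangle\cong\mathbb{R}\rtimes\langle\iota\rangle$$ and $$\operatorname{Aut}_{\mathrm{semiring}}(\operatorname{Rat}(\Gamma))\cong\operatorname{Aut}(\Gamma)\rtimes\mathbb{R}_{>0},$$ where $\langle\cdot\rangle$ denotes the group generated by $\cdot$, $\mathbb{R}$ is regarded as a group under the usual addition, and $\mathbb{R}_{>0}$ as a group under the usual multiplication.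
   Context: **Semirings.** A semiring is a commutative semiring with absorbing additive neutral element, multiplicative identity, and these two distinct. A semiring homomorphism preserves addition, multiplication, the additive neutral element and the multiplicative identity. **Tropical curves.** A graph is an unweighted, undirected, finite, connected nonempty multigraph, possibly with loops. A leaf end is a vertex of valence one (loops count twice); a leaf edge is an edge incident to a leaf end. An edge-weighted graph $(G,l)$ is a graph $G$ with a function $l : E(G) \to \mathbb{R}_{>0} \cup \{\infty\}$ that takes the value $\infty$ only on leaf edges. A tropical curve $\Gamma$ is the underlying topological space of some $(G,l)$ together with an identification of each edge $e$ with $[0,l(e)]$, where $[0,\infty]$ is the one-point compactification of $[0,\infty)$; if $l(e)=\infty$, the leaf end of $e$ is identified with $\infty$ (if $E(G)=\{e\}$ and $l(e)=\infty$, either leaf end may be chosen). Points identified with $\infty$ are points at infinity and form the set $\Gamma_\infty$; other points are finite points. $\operatorname{dist}$ is the path-length distance. The star-shaped tropical curve consisting of $n$ copies of $[0,\infty]$ is obtained by gluing the $n$ copies at their points $0$. **Rational functions.** A rational function on $\Gamma$ is either the constant function $-\infty$ or a continuous map $f:\Gamma\to\mathbb{R}\cup\{\pm\infty\}$ that is piecewise affine with integer slopes and finitely many pieces and takes values $\pm\infty$ only at points at infinity. $\operatorname{Rat}(\Gamma)$ is the set of these; with $(f\oplus g)(x)=\max\{f(x),g(x)\}$ and $(f\odot g)(x)=f(x)+g(x)$ at finite points, extended continuously to points at infinity (and $f\oplus(-\infty)=f$, $f\odot(-\infty)=-\infty$), it is a semifield. $\operatorname{Aut}_{\mathrm{semiring}}(\operatorname{Rat}(\Gamma))$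 is the group of bijective semiring homomorphisms $\operatorname{Rat}(\Gamma)\to\operatorname{Rat}(\Gamma)$. **Automorphisms of $\Gamma$.** $\operatorname{Aut}(\Gamma)$ is the group of finite harmonic morphisms of degree one $\Gamma\to\Gamma$; equivalently, the group of continuous maps $\Gamma\to\Gamma$ whose restrictions to $\Gamma\setminus\Gamma_\infty$ are isometries $\Gamma\setminus\Gamma_\infty\to\Gamma\setminus\Gamma_\infty$. **Conventions for (2).** The inversion with respect to a finite point $x$ is $y\mapsto 2x-y$ on $[-\infty,\infty]$ (exchanging $\pm\infty$). In $\mathbb{R}\rtimes\langle\iota\rangle$, $\mathbb{R}$ corresponds to the translations $y\mapsto y+t$ and $\iota$ acts by conjugation, i.e. $t\mapsto -t$. In $\operatorname{Aut}(\Gamma)\rtimes\mathbb{R}_{>0}$, $r\in\mathbb{R}_{>0}$ corresponds to the dilatation $\theta_r:y\mapsto r\cdot y$ of $[-\infty,\infty]$ and acts on $\operatorname{Aut}(\Gamma)$ by conjugation $\alpha\mapsto\theta_r\circ\alpha\circ\theta_r^{-1}$. *)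

theory Defs
  imports "HOL-Analysis.Analysis" "HOL-Algebra.Algebra" "Graph_Theory.Graph_Theory"
begin

text \<open>An undirected multigraph is represented by a digraph in which every edge carries one,
  arbitrarily chosen, orientation. The orientation only serves to identify an edge \<open>e\<close> with
  \<open>[0, len e]\<close>, \<open>tail e\<close> being at \<open>0\<close> and \<open>head e\<close> at \<open>len e\<close>. In particular an edge of infinite
  length is oriented towards its leaf end at infinity.\<close>

record ('v, 'e) weighted_graph = "('v, 'e) pre_digraph" +
  len :: "'e \<Rightarrow> ereal"

abbreviation underlying_graph :: "('v, 'e) weighted_graph \<Rightarrow> ('v, 'e) pre_digraph" where
  "underlying_graph \<Gamma> \<equiv> pre_digraph.truncate \<Gamma>"

definition valence :: "('v, 'e) weighted_graph \<Rightarrow> 'v \<Rightarrow> nat" where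
  "valence \<Gamma> v = in_degree (underlying_graph \<Gamma>) v + out_degree (underlying_graph \<Gamma>) v"

definition edge_weighted_graph :: "('v, 'e) weighted_graph \<Rightarrow> bool" where
  "edge_weighted_graph \<Gamma> \<longleftrightarrow>
     fin_digraph (underlying_graph \<Gamma>) \<and>
     Digraph_Component.connected (underlying_graph \<Gamma>) \<and>
     (\<forall>e \<in> arcs \<Gamma>. 0 < len \<Gamma> e \<and> (len \<Gamma> e = \<infinity> \<longrightarrow> valence \<Gamma> (head \<Gamma> e) = 1))"

text \<open>Points of the curve: vertices, and interior points of edges with their coordinate. The map
  \<open>chart \<Gamma> e\<close> glues \<open>[0, len e]\<close> into the curve.\<close>

datatype ('v, 'e) point = Vertex 'v | Inner 'e ereal

definition chart :: "('v, 'e) weighted_graph \<Rightarrow> 'e \<Rightarrow> ereal \<Rightarrow> ('v, 'e) point" where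
  "chart \<Gamma> e t = (if t = 0 then Vertex (tail \<Gamma> e)
     else if t = len \<Gamma> e then Vertex (head \<Gamma> e) else Inner e t)"

definition points :: "('v, 'e) weighted_graph \<Rightarrow> ('v, 'e) point set" where
  "points \<Gamma> = Vertex ` verts \<Gamma> \<union> {chart \<Gamma> e t | e t. e \<in> arcs \<Gamma> \<and> t \<in> {0..len \<Gamma> e}}"

definition infinite_points :: "('v, 'e) weighted_graph \<Rightarrow> ('v, 'e) point set" where
  "infinite_points \<Gamma> = {chart \<Gamma> e \<infinity> | e. e \<in> arcs \<Gamma> \<and> len \<Gamma> e = \<infinity>}"

definition finite_points :: "('v, 'e) weighted_graph \<Rightarrow> ('v, 'e) point set" where
  "finite_points \<Gamma> = points \<Gamma> - infinite_points \<Gamma>"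

text \<open>The quotient topology. The subspace \<open>{0..\<infinity>}\<close> of \<^typ>\<open>ereal\<close> is the one-point
  compactification of \<open>[0, \<infinity>)\<close>.\<close>

definition curve_topology :: "('v, 'e) weighted_graph \<Rightarrow> ('v, 'e) point topology" where
  "curve_topology \<Gamma> = topology (\<lambda>U. U \<subseteq> points \<Gamma> \<and>
     (\<forall>e \<in> arcs \<Gamma>. openin (top_of_set {0..len \<Gamma> e}) {t \<in> {0..len \<Gamma> e}. chart \<Gamma> e t \<in> U}))"

lemma openin_curve_topology:
  "openin (curve_topology \<Gamma>) U \<longleftrightarrow> U \<subseteq> points \<Gamma> \<and>
     (\<forall>e \<in> arcs \<Gamma>. openin (top_of_set {0..len \<Gamma> e}) {t \<in> {0..len \<Gamma> e}. chart \<Gamma> e t \<in> U})"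
proof -
  have "istopology (\<lambda>U. U \<subseteq> points \<Gamma> \<and>
     (\<forall>e \<in> arcs \<Gamma>. openin (top_of_set {0..len \<Gamma> e}) {t \<in> {0..len \<Gamma> e}. chart \<Gamma> e t \<in> U}))"
    (is "istopology ?Q")
    unfolding istopology_def
  proof (intro conjI[of "\<forall>S T. ?Q S \<longrightarrow> ?Q T \<longrightarrow> ?Q (S \<inter> T)"] allI impI)
    fix S T assume S: "?Q S" and T: "?Q T"
    have "{t \<in> {0..len \<Gamma> e}. chart \<Gamma> e t \<in> S \<inter> T} =
        {t \<in> {0..len \<Gamma> e}. chart \<Gamma> e t \<in> S} \<inter> {t \<in> {0..len \<Gamma> e}. chart \<Gamma> e t \<in> T}" for e
      by auto
    with S T show "?Q (S \<inter> T)" by (auto intro: openin_Int)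
  next
    fix K assume K: "\<forall>S\<in>K. ?Q S"
    have "{t \<in> {0..len \<Gamma> e}. chart \<Gamma> e t \<in> \<Union>K} =
        (\<Union>S\<in>K. {t \<in> {0..len \<Gamma> e}. chart \<Gamma> e t \<in> S})" for e
      by auto
    with K show "?Q (\<Union>K)" by (auto intro!: openin_Union)
  qed
  then show ?thesis by (simp add: curve_topology_def topology_inverse')
qed

text \<open>\<open>route \<Gamma> x y d\<close>: \<open>y\<close> can be reached from \<open>x\<close> through finite points by finitely many segments,
  each inside one edge, of total length \<open>d\<close>. Infima over these piecewise linear paths compute the
  path-length distance.\<close>

inductive route ::
    "('v, 'e) weighted_graph \<Rightarrow> ('v, 'e) point \<Rightarrow> ('v, 'e) point \<Rightarrow> real \<Rightarrow> bool" for \<Gamma> where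
  stay: "x \<in> points \<Gamma> \<Longrightarrow> route \<Gamma> x x 0"
| segment: "\<lbrakk>route \<Gamma> x (chart \<Gamma> e (ereal s)) d; e \<in> arcs \<Gamma>;
     ereal s \<in> {0..len \<Gamma> e}; ereal t \<in> {0..len \<Gamma> e}\<rbrakk>
     \<Longrightarrow> route \<Gamma> x (chart \<Gamma> e (ereal t)) (d + \<bar>s - t\<bar>)"

definition path_dist :: "('v, 'e) weighted_graph \<Rightarrow> ('v, 'e) point \<Rightarrow> ('v, 'e) point \<Rightarrow> real" where
  "path_dist \<Gamma> x y = Inf {d. route \<Gamma> x y d}"

text \<open>\<open>g\<close> is affine with integer slope on each of finitely many intervals subdividing \<open>[0, l]\<close>;
  at \<open>\<infinity>\<close> nothing is required here, since the value there is fixed by continuity.\<close>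

definition piecewise_affine :: "ereal \<Rightarrow> (ereal \<Rightarrow> ereal) \<Rightarrow> bool" where
  "piecewise_affine l g \<longleftrightarrow> (\<exists>(k::nat) b. b 0 = 0 \<and> b k = l \<and>
     (\<forall>j<k. b j < b (Suc j) \<and>
        (\<exists>(m::int) (c::real). \<forall>t::real. b j \<le> ereal t \<and> ereal t \<le> b (Suc j) \<longrightarrow>
           g (ereal t) = ereal (of_int m * t + c))))"

definition Rat_carrier :: "('v, 'e) weighted_graph \<Rightarrow> (('v, 'e) point \<Rightarrow> ereal) set" where
  "Rat_carrier \<Gamma> = insert (\<lambda>x\<in>points \<Gamma>. -\<infinity>)
     {f \<in> extensional (points \<Gamma>).
        continuous_map (curve_topology \<Gamma>) euclidean f \<and>
        (\<forall>x \<in> finite_points \<Gamma>. \<bar>f x\<bar> \<noteq> \<infinity>) \<and>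
        (\<forall>e \<in> arcs \<Gamma>. piecewise_affine (len \<Gamma> e) (\<lambda>t. f (chart \<Gamma> e t)))}"

text \<open>Values at finite points, extended continuously to the points at infinity. The extension is
  unique because the finite points are dense; the constant \<open>-\<infinity>\<close> needs no separate treatment.\<close>

definition extend_continuously ::
    "('v, 'e) weighted_graph \<Rightarrow> (('v, 'e) point \<Rightarrow> ereal) \<Rightarrow> ('v, 'e) point \<Rightarrow> ereal" where
  "extend_continuously \<Gamma> h = (THE k. k \<in> extensional (points \<Gamma>) \<and>
     continuous_map (curve_topology \<Gamma>) euclidean k \<and> (\<forall>x \<in> finite_points \<Gamma>. k x = h x))"

definition Rat :: "('v, 'e) weighted_graph \<Rightarrow> (('v, 'e) point \<Rightarrow> ereal) ring" where
  "Rat \<Gamma> = \<lparr>carrier = Rat_carrier \<Gamma>,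
     mult = (\<lambda>f g. extend_continuously \<Gamma> (\<lambda>x. f x + g x)),
     one = (\<lambda>x\<in>points \<Gamma>. 0),
     ring.zero = (\<lambda>x\<in>points \<Gamma>. -\<infinity>),
     add = (\<lambda>f g. extend_continuously \<Gamma> (\<lambda>x. max (f x) (g x)))\<rparr>"

definition composition_group :: "'a set \<Rightarrow> ('a \<Rightarrow> 'a) set \<Rightarrow> ('a \<Rightarrow> 'a) monoid" where
  "composition_group S A = \<lparr>carrier = A, mult = compose S, one = (\<lambda>x\<in>S. x)\<rparr>"

text \<open>\<^const>\<open>ring_hom\<close> does not mention the additive neutral element, which a semiring homomorphism
  has to preserve.\<close>

definition Aut_semiring :: "('a, 'b) ring_scheme \<Rightarrow> ('a \<Rightarrow> 'a) monoid" where
  "Aut_semiring R = composition_group (carrier R)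
     {h \<in> ring_hom R R. h \<in> extensional (carrier R) \<and> h \<zero>\<^bsub>R\<^esub> = \<zero>\<^bsub>R\<^esub> \<and>
        bij_betw h (carrier R) (carrier R)}"

text \<open>Isometries are understood to be onto: otherwise \<open>[0, \<infinity>]\<close> would have non-invertible
  translations as automorphisms.\<close>

definition Aut_curve :: "('v, 'e) weighted_graph \<Rightarrow> (('v, 'e) point \<Rightarrow> ('v, 'e) point) monoid" where
  "Aut_curve \<Gamma> = composition_group (points \<Gamma>)
     {f \<in> extensional (points \<Gamma>).
        continuous_map (curve_topology \<Gamma>) (curve_topology \<Gamma>) f \<and>
        bij_betw f (finite_points \<Gamma>) (finite_points \<Gamma>) \<and>
        (\<forall>x \<in> finite_points \<Gamma>. \<forall>y \<in> finite_points \<Gamma>.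
           path_dist \<Gamma> (f x) (f y) = path_dist \<Gamma> x y)}"

definition pos_real_group :: "real monoid" where
  "pos_real_group = \<lparr>carrier = {0<..}, mult = (*), one = 1\<rparr>"

definition real_add_group :: "real monoid" where
  "real_add_group = \<lparr>carrier = UNIV, mult = (+), one = 0\<rparr>"

definition semidirect_product ::
    "('a, 'c) monoid_scheme \<Rightarrow> ('b, 'd) monoid_scheme \<Rightarrow> ('b \<Rightarrow> 'a \<Rightarrow> 'a) \<Rightarrow> ('a \<times> 'b) monoid" where
  "semidirect_product N H act = \<lparr>carrier = carrier N \<times> carrier H,
     mult = (\<lambda>(a, h) (b, k). (a \<otimes>\<^bsub>N\<^esub> act h b, h \<otimes>\<^bsub>H\<^esub> k)),
     one = (\<one>\<^bsub>N\<^esub>, \<one>\<^bsub>H\<^esub>)\<rparr>"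

text \<open>The copies of \<open>[0, \<infinity>]\<close> are the edges \<open>1, \<dots>, n\<close>; the vertex \<open>0\<close> is the common point \<open>0\<close> and
  the vertex \<open>i\<close> is the point at infinity of the \<open>i\<close>-th copy.\<close>

definition star :: "nat \<Rightarrow> (nat, nat) weighted_graph" where
  "star n = \<lparr>verts = {0..n}, arcs = {1..n}, tail = (\<lambda>_. 0), head = (\<lambda>i. i), len = (\<lambda>_. \<infinity>)\<rparr>"

lemma edge_weighted_graph_star: "edge_weighted_graph (star n)"
proof -
  let ?G = "underlying_graph (star n)"
  have G: "?G = \<lparr>verts = {0..n}, arcs = {1..n}, tail = (\<lambda>_. 0), head = (\<lambda>i. i)\<rparr>"
    by (simp add: star_def pre_digraph.truncate_def)
  have fin: "fin_digraph ?G"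
    by unfold_locales (auto simp: G)
  have val: "valence (star n) i = 1" if "i \<in> {1..n}" for i
  proof -
    have "in_arcs ?G i = {i}" "out_arcs ?G i = {}"
      using that by (auto simp: G in_arcs_def out_arcs_def)
    then show ?thesis by (simp add: valence_def in_degree_def out_degree_def)
  qed
  have wf: "wf_digraph (with_proj (mk_symmetric ?G))"
    by (rule wf_digraph.intro) (auto simp: G mk_symmetric_def with_proj_def)
  have ends: "arcs_ends (with_proj (mk_symmetric ?G)) =
      (\<Union>i\<in>{1..n}. {(0, i), (i, 0)})"
    by (auto simp: arcs_ends_def arc_to_ends_def mk_symmetric_def with_proj_def G)
  have out: "0 \<rightarrow>\<^sup>*\<^bsub>with_proj (mk_symmetric ?G)\<^esub> v"
    and inw: "v \<rightarrow>\<^sup>*\<^bsub>with_proj (mk_symmetric ?G)\<^esub> 0" if "v \<in> {0..n}" for v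
  proof -
    have V: "verts (with_proj (mk_symmetric ?G)) = {0..n}"
      by (simp add: mk_symmetric_def with_proj_def G)
    have "0 \<rightarrow>\<^sup>*\<^bsub>with_proj (mk_symmetric ?G)\<^esub> v \<and> v \<rightarrow>\<^sup>*\<^bsub>with_proj (mk_symmetric ?G)\<^esub> 0"
    proof (cases "v = 0")
      case True
      then show ?thesis using wf_digraph.reachable_refl[OF wf] V by auto
    next
      case False
      then have "v \<in> {1..n}" using that by auto
      then have "(0, v) \<in> arcs_ends (with_proj (mk_symmetric ?G))"
        and "(v, 0) \<in> arcs_ends (with_proj (mk_symmetric ?G))"
        unfolding ends by auto
      then show ?thesis using wf_digraph.reachable_adjI[OF wf] by blast
    qed
    then show "0 \<rightarrow>\<^sup>*\<^bsub>with_proj (mk_symmetric ?G)\<^esub> v"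
      and "v \<rightarrow>\<^sup>*\<^bsub>with_proj (mk_symmetric ?G)\<^esub> 0" by auto
  qed
  have "u \<rightarrow>\<^sup>*\<^bsub>with_proj (mk_symmetric ?G)\<^esub> v" if "u \<in> {0..n}" "v \<in> {0..n}" for u v
    using wf_digraph.reachable_trans[OF wf inw[OF that(1)] out[OF that(2)]] .
  moreover have "verts (with_proj (mk_symmetric ?G)) = {0..n}"
    by (simp add: mk_symmetric_def with_proj_def G)
  ultimately have con: "Digraph_Component.connected ?G"
    unfolding Digraph_Component.connected_def strongly_connected_def by simp
  have "arcs (star n) = {1..n}" "len (star n) = (\<lambda>_. \<infinity>)" "head (star n) = (\<lambda>i. i)"
    by (simp_all add: star_def)
  with fin val con show ?thesis
    unfolding edge_weighted_graph_def by simp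
qed

text \<open>The identification of \<open>[-\<infinity>, \<infinity>]\<close> with \<open>star 2\<close>: the first copy is \<open>[0, \<infinity>]\<close>, the second
  one is \<open>[-\<infinity>, 0]\<close> with reversed coordinate.\<close>

definition line_point :: "ereal \<Rightarrow> (nat, nat) point" where
  "line_point y = (if 0 \<le> y then chart (star 2) 1 y else chart (star 2) 2 (- y))"

definition line_coord :: "(nat, nat) point \<Rightarrow> ereal" where
  "line_coord = the_inv_into UNIV line_point"

lemma bij_betw_line_point: "bij_betw line_point UNIV (points (star 2))"
proof (rule bij_betw_imageI)
  have lp: "line_point y = (if y = 0 then Vertex 0 else if y = \<infinity> then Vertex 1
      else if y = -\<infinity> then Vertex 2 else if 0 < y then Inner 1 y else Inner 2 (- y))" for y
    by (cases y) (auto simp: line_point_def chart_def star_def)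
  show "inj line_point"
    by (rule injI) (auto simp: lp split: if_splits)
  have star: "verts (star 2) = {0, 1, 2}" "arcs (star 2) = {1, 2}" "len (star 2) = (\<lambda>_. \<infinity>)"
    by (auto simp: star_def)
  have P: "points (star 2) =
      Vertex ` {0, 1, 2} \<union> chart (star 2) 1 ` {0..} \<union> chart (star 2) 2 ` {0..}"
    unfolding points_def star by (auto simp del: One_nat_def)
  have c1: "chart (star 2) 1 t = line_point t" if "0 \<le> t" for t
    using that by (simp add: line_point_def)
  have c2: "chart (star 2) 2 t = line_point (- t)" if "0 \<le> t" for t
    using that by (cases "t = 0") (auto simp: line_point_def chart_def star_def)
  show "range line_point = points (star 2)"
  proof (intro equalityI subsetI)
    fix p assume "p \<in> range line_point"
    then obtain y where p: "p = line_point y" by blast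
    show "p \<in> points (star 2)"
    proof (cases "0 \<le> y")
      case True
      then show ?thesis unfolding p P by (simp add: line_point_def del: One_nat_def)
    next
      case False
      then have "0 \<le> - y" by (cases y) auto
      with False show ?thesis unfolding p P by (simp add: line_point_def del: One_nat_def)
    qed
  next
    fix p assume p: "p \<in> points (star 2)"
    have "Vertex 0 = line_point 0" "Vertex 1 = line_point \<infinity>" "Vertex 2 = line_point (-\<infinity>)"
      by (simp_all add: lp)
    with p c1 c2 show "p \<in> range line_point"
      unfolding P by (auto simp del: One_nat_def)
  qed
qed

definition on_line :: "(ereal \<Rightarrow> ereal) \<Rightarrow> (nat, nat) point \<Rightarrow> (nat, nat) point" where
  "on_line g = (\<lambda>p \<in> points (star 2). line_point (g (line_coord p)))"

definition inversion :: "(nat, nat) point \<Rightarrow> (nat, nat) point \<Rightarrow> (nat, nat) point" where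
  "inversion x = on_line (\<lambda>y. 2 * line_coord x - y)"

definition line_translation :: "real \<Rightarrow> (nat, nat) point \<Rightarrow> (nat, nat) point" where
  "line_translation t = on_line (\<lambda>y. y + ereal t)"

definition dilatation :: "real \<Rightarrow> (nat, nat) point \<Rightarrow> (nat, nat) point" where
  "dilatation r = on_line (\<lambda>y. ereal r * y)"

definition iota :: "(nat, nat) point \<Rightarrow> (nat, nat) point" where
  "iota = inversion (line_point 0)"

definition conj_translation ::
    "((nat, nat) point \<Rightarrow> (nat, nat) point) \<Rightarrow> real \<Rightarrow> real" where
  "conj_translation h t = (THE s. line_translation s =
     h \<otimes>\<^bsub>Aut_curve (star 2)\<^esub> line_translation t \<otimes>\<^bsub>Aut_curve (star 2)\<^esub> inv\<^bsub>Aut_curve (star 2)\<^esub> h)"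

definition conj_dilatation ::
    "real \<Rightarrow> ((nat, nat) point \<Rightarrow> (nat, nat) point) \<Rightarrow> (nat, nat) point \<Rightarrow> (nat, nat) point" where
  "conj_dilatation r \<alpha> = (\<lambda>p \<in> points (star 2).
     dilatation r (\<alpha> (the_inv_into (points (star 2)) (dilatation r) p)))"

end

theory Submission
  imports Defs "HOL-Real_Asymp.Real_Asymp"
begin

text \<open>
  A rational function other than \<open>-\<infinity>\<close> is the same as a real function on the finite points that is
  continuous and piecewise affine with integer slopes and finitely many pieces (\<open>carrier_Rat\<close>): its
  values at the points at infinity are limits. On these functions the semiring operations are the
  pointwise maximum and sum. A similarity of the finite points with factor \<open>r\<close>, composed with
  multiplication of the values by \<open>r\<close>, keeps slopes integral and hence yields a semiring
  automorphism. The main point is that there are no others.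

  Let \<open>\<Phi>\<close> be an automorphism. Because slopes are integers, the infinitely divisible elements are
  exactly the constants; so \<open>\<Phi>\<close> maps constants to constants, additively and monotonically, which means
  by multiplication with some \<open>r > 0\<close>. For a finite point \<open>x\<close>, the map \<open>f \<mapsto> \<Phi> f x / r\<close> preserves sums
  and maxima and fixes constants. Such a map is the evaluation at a point
  (\<open>real_hom_is_evaluation\<close>): it is determined by its values at the coordinates of the \<open>n\<close> copies, at
  most one of which is nonzero because the minimum of two coordinates is \<open>0\<close>. This attaches to \<open>\<Phi>\<close> a
  bijection of the finite points. After a dilatation by \<open>r\<close>, the bijection and its inverse pull
  functions with integer slopes back to such functions. Transported distance functions then have slopes
  at least \<open>1\<close> in absolute value at their only zero, so neither of the two maps increases
  distances (\<open>nonexpanding\<close>), and the bijection is an isometry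
  (\<open>Aut_semiring_similarity\<close>).

  It remains to know the isometries of the finite points. If \<open>n \<noteq> 2\<close>, the centre is the only point
  whose small spheres have \<open>n\<close> elements; it is therefore fixed, and an isometry permutes the copies
  (\<open>fin_isometry_permutation\<close>). If \<open>n = 2\<close>, the finite points form a real line, whose isometries are
  \<open>y \<mapsto> \<plusminus>y + t\<close> (\<open>line_isometry\<close>). In both cases an isometry extends uniquely to an automorphism of the
  curve. So the automorphisms of the semiring correspond to pairs of an automorphism of the curve and a
  factor \<open>r\<close>, and their composition is that of the semidirect product given by conjugation with
  dilatations (\<open>Aut_semiring_semidirect\<close>). Permutations of the copies commute with dilatations, which
  makes the product direct if \<open>n \<noteq> 2\<close>.
\<close>

section \<open>Piecewise affine functions on a half-line\<close>

definition affine_germ :: "real filter \<Rightarrow> (real \<Rightarrow> real) \<Rightarrow> bool" where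
  "affine_germ F h \<longleftrightarrow> (\<exists>(m::int) (c::real). \<forall>\<^sub>F t in F. h t = of_int m * t + c)"

text \<open>A local form of the notion: closure under sums and maxima is then immediate, because no common
  refinement of subdivisions is needed. The passage back to finitely many pieces is compactness, used in
  \<open>pl_interval_induct\<close>.\<close>

definition pl :: "(real \<Rightarrow> real) \<Rightarrow> bool" where
  "pl h \<longleftrightarrow> continuous_on {0..} h \<and> (\<forall>t\<ge>0. affine_germ (at_right t) h) \<and>
     (\<forall>t>0. affine_germ (at_left t) h) \<and> affine_germ at_top h"

lemma affine_germI: "\<forall>\<^sub>F t in F. h t = of_int m * t + c \<Longrightarrow> affine_germ F h"
  by (auto simp: affine_germ_def)

lemma affine_germ_cong:
  assumes "affine_germ F h" "\<forall>\<^sub>F t in F. h t = g t"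
  shows "affine_germ F g"
proof -
  obtain m c where "\<forall>\<^sub>F t in F. h t = of_int m * t + c"
    using assms(1) by (auto simp: affine_germ_def)
  with assms(2) have "\<forall>\<^sub>F t in F. g t = of_int m * t + c" by eventually_elim auto
  then show ?thesis by (rule affine_germI)
qed

lemma affine_germ_const: "affine_germ F (\<lambda>t. c)"
  by (rule affine_germI[of _ 0 c]) auto

lemma affine_germ_ident: "affine_germ F (\<lambda>t. t)"
  by (rule affine_germI[of _ 1 0]) auto

lemma affine_germ_add:
  assumes "affine_germ F h" "affine_germ F g"
  shows "affine_germ F (\<lambda>t. h t + g t)"
proof -
  obtain m c m' c' where "\<forall>\<^sub>F t in F. h t = of_int m * t + c" "\<forall>\<^sub>F t in F. g t = of_int m' * t + c'"
    using assms by (auto simp: affine_germ_def)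
  then have "\<forall>\<^sub>F t in F. h t + g t = of_int (m + m') * t + (c + c')"
    by eventually_elim (simp add: algebra_simps)
  then show ?thesis by (rule affine_germI)
qed

lemma affine_germ_uminus:
  assumes "affine_germ F h"
  shows "affine_germ F (\<lambda>t. - h t)"
proof -
  obtain m c where "\<forall>\<^sub>F t in F. h t = of_int m * t + c"
    using assms by (auto simp: affine_germ_def)
  then have "\<forall>\<^sub>F t in F. - h t = of_int (- m) * t + (- c)"
    by eventually_elim (simp add: algebra_simps)
  then show ?thesis by (rule affine_germI)
qed

text \<open>At a one-sided neighbourhood of a point and near infinity an affine function has a sign, so the
  larger of two germs is one of them.\<close>

definition sign_decisive :: "real filter \<Rightarrow> bool" where
  "sign_decisive F \<longleftrightarrow> (\<forall>m c. (\<forall>\<^sub>F t in F. 0 \<le> m * t + c) \<or> (\<forall>\<^sub>F t in F. m * t + c \<le> 0))"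

lemma affine_germ_max:
  assumes F: "sign_decisive F" and "affine_germ F h" "affine_germ F g"
  shows "affine_germ F (\<lambda>t. max (h t) (g t))"
proof -
  obtain m c m' c' where h: "\<forall>\<^sub>F t in F. h t = of_int m * t + c"
    and g: "\<forall>\<^sub>F t in F. g t = of_int m' * t + c'"
    using assms(2,3) by (auto simp: affine_germ_def)
  consider "\<forall>\<^sub>F t in F. 0 \<le> (of_int m - of_int m') * t + (c - c')"
    | "\<forall>\<^sub>F t in F. (of_int m - of_int m') * t + (c - c') \<le> 0"
    using F unfolding sign_decisive_def by blast
  then show ?thesis
  proof cases
    case 1
    with h g have "\<forall>\<^sub>F t in F. max (h t) (g t) = of_int m * t + c"
      by eventually_elim (simp add: algebra_simps)
    then show ?thesis by (rule affine_germI)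
  next
    case 2
    with h g have "\<forall>\<^sub>F t in F. max (h t) (g t) = of_int m' * t + c'"
      by eventually_elim (simp add: algebra_simps)
    then show ?thesis by (rule affine_germI)
  qed
qed

lemma sign_decisive_at_top: "sign_decisive at_top"
  unfolding sign_decisive_def
proof (intro allI)
  fix m c :: real
  consider "m = 0" | "m > 0" | "m < 0" by linarith
  then show "(\<forall>\<^sub>F t in at_top. 0 \<le> m * t + c) \<or> (\<forall>\<^sub>F t in at_top. m * t + c \<le> 0)"
  proof cases
    case 1 then show ?thesis by (cases "0 \<le> c") auto
  next
    case 2
    then have "\<forall>\<^sub>F t in at_top. 0 \<le> m * t + c"
      unfolding eventually_at_top_linorder by (intro exI[of _ "- c / m"]) (auto simp: field_simps)
    then show ?thesis ..
  next
    case 3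
    then have "\<forall>\<^sub>F t in at_top. m * t + c \<le> 0"
      unfolding eventually_at_top_linorder by (intro exI[of _ "- c / m"]) (auto simp: field_simps)
    then show ?thesis ..
  qed
qed

lemma sign_decisive_at_point:
  assumes "F = at_right a \<or> F = at_left a"
  shows "sign_decisive F"
  unfolding sign_decisive_def
proof (intro allI)
  fix m c :: real
  have sub: "F \<le> at a" using assms by (auto intro: at_le)
  have lim: "filterlim (\<lambda>t. m * t + c) (nhds (m * a + c)) F"
    by (rule tendsto_mono[OF sub]) (intro tendsto_intros)
  consider "m * a + c > 0" | "m * a + c < 0" | "m * a + c = 0" by linarith
  then show "(\<forall>\<^sub>F t in F. 0 \<le> m * t + c) \<or> (\<forall>\<^sub>F t in F. m * t + c \<le> 0)"
  proof cases
    case 1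
    from order_tendstoD(1)[OF lim 1] have "\<forall>\<^sub>F t in F. 0 \<le> m * t + c"
      by (rule eventually_mono) simp
    then show ?thesis ..
  next
    case 2
    from order_tendstoD(2)[OF lim 2] have "\<forall>\<^sub>F t in F. m * t + c \<le> 0"
      by (rule eventually_mono) simp
    then show ?thesis ..
  next
    case 3
    have c: "m * t + c = m * (t - a)" for t using 3 by (simp add: algebra_simps)
    have "(\<forall>\<^sub>F t in F. a < t) \<or> (\<forall>\<^sub>F t in F. t < a)"
      using assms by (auto simp: eventually_at_filter)
    then show ?thesis
    proof
      assume ev: "\<forall>\<^sub>F t in F. a < t"
      show ?thesis
      proof (cases "m \<ge> 0")
        case True
        with ev have "\<forall>\<^sub>F t in F. 0 \<le> m * t + c"
          unfolding c by (auto elim!: eventually_mono)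
        then show ?thesis ..
      next
        case False
        with ev have "\<forall>\<^sub>F t in F. m * t + c \<le> 0"
          unfolding c by (auto elim!: eventually_mono simp: mult_nonpos_nonneg)
        then show ?thesis ..
      qed
    next
      assume ev: "\<forall>\<^sub>F t in F. t < a"
      show ?thesis
      proof (cases "m \<ge> 0")
        case True
        with ev have "\<forall>\<^sub>F t in F. m * t + c \<le> 0"
          unfolding c by (auto elim!: eventually_mono simp: mult_nonneg_nonpos)
        then show ?thesis ..
      next
        case False
        with ev have "\<forall>\<^sub>F t in F. 0 \<le> m * t + c"
          unfolding c by (auto elim!: eventually_mono simp: mult_nonpos_nonpos)
        then show ?thesis ..
      qed
    qed
  qed
qed

lemma pl_continuous: "pl h \<Longrightarrow> continuous_on {0..} h" by (simp add: pl_def)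

lemma pl_const: "pl (\<lambda>t. c)" by (simp add: pl_def affine_germ_const)

lemma pl_ident: "pl (\<lambda>t. t)" by (simp add: pl_def affine_germ_ident continuous_on_id)

lemma pl_add: "pl h \<Longrightarrow> pl g \<Longrightarrow> pl (\<lambda>t. h t + g t)"
  by (simp add: pl_def affine_germ_add continuous_on_add)

lemma pl_uminus: "pl h \<Longrightarrow> pl (\<lambda>t. - h t)"
  by (simp add: pl_def affine_germ_uminus continuous_on_minus)

lemma pl_diff: "pl h \<Longrightarrow> pl g \<Longrightarrow> pl (\<lambda>t. h t - g t)"
  using pl_add[OF _ pl_uminus, of h g] by simp

lemma pl_max: "pl h \<Longrightarrow> pl g \<Longrightarrow> pl (\<lambda>t. max (h t) (g t))"
  by (auto simp: pl_def intro!: affine_germ_max sign_decisive_at_top sign_decisive_at_point continuous_on_max)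

lemma pl_abs: "pl h \<Longrightarrow> pl (\<lambda>t. \<bar>h t\<bar>)"
proof -
  assume "pl h"
  then have "pl (\<lambda>t. max (h t) (- h t))" by (intro pl_max pl_uminus)
  moreover have "max (h t) (- h t) = \<bar>h t\<bar>" for t by simp
  ultimately show ?thesis by simp
qed

lemma eventually_at_right_greater: "(\<And>t. a < t \<Longrightarrow> P t) \<Longrightarrow> eventually P (at_right (a::real))"
  unfolding eventually_at_right_field by (rule exI[of _ "a + 1"]) simp

lemma eventually_at_left_positive:
  "0 < a \<Longrightarrow> (\<And>t. 0 < t \<Longrightarrow> P t) \<Longrightarrow> eventually P (at_left (a::real))"
  unfolding eventually_at_left_field by (rule exI[of _ 0]) simp

lemma pl_cong:
  assumes "pl h" "\<And>t. 0 \<le> t \<Longrightarrow> h t = g t"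
  shows "pl g"
  using assms(1) unfolding pl_def
proof (elim conjE, intro conjI allI impI)
  assume "continuous_on {0..} h"
  then show "continuous_on {0..} g"
    by (rule continuous_on_eq) (simp add: assms(2))
next
  fix t :: real assume "0 \<le> t" "\<forall>t\<ge>0. affine_germ (at_right t) h"
  then have "affine_germ (at_right t) h" by simp
  moreover have "\<forall>\<^sub>F s in at_right t. h s = g s"
    by (rule eventually_at_right_greater) (use \<open>0 \<le> t\<close> assms(2) in simp)
  ultimately show "affine_germ (at_right t) g" by (rule affine_germ_cong)
next
  fix t :: real assume "0 < t" "\<forall>t>0. affine_germ (at_left t) h"
  then have "affine_germ (at_left t) h" by simp
  moreover have "\<forall>\<^sub>F s in at_left t. h s = g s"
    by (rule eventually_at_left_positive) (use \<open>0 < t\<close> assms(2) in simp_all)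
  ultimately show "affine_germ (at_left t) g" by (rule affine_germ_cong)
next
  assume "affine_germ at_top h"
  moreover have "\<forall>\<^sub>F s in at_top. h s = g s"
    using eventually_ge_at_top[of "0::real"] by eventually_elim (rule assms(2))
  ultimately show "affine_germ at_top g" by (rule affine_germ_cong)
qed

lemma affine_germ_rescale:
  assumes r: "0 < r" and h: "affine_germ F h" and lim: "filterlim (\<lambda>t. t / r) F F'"
  shows "affine_germ F' (\<lambda>t. r * h (t / r))"
proof -
  obtain m c where "\<forall>\<^sub>F t in F. h t = of_int m * t + c"
    using h by (auto simp: affine_germ_def)
  then have "\<forall>\<^sub>F t in F'. h (t / r) = of_int m * (t / r) + c"
    using lim by (auto simp: filterlim_iff)
  then have "\<forall>\<^sub>F t in F'. r * h (t / r) = of_int m * t + r * c"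
    by eventually_elim (use r in \<open>simp add: field_simps\<close>)
  then show ?thesis by (rule affine_germI)
qed

text \<open>Stretching the domain and the range by the same factor keeps the slopes.\<close>

lemma pl_rescale:
  assumes "pl h" "0 < r"
  shows "pl (\<lambda>t. r * h (t / r))"
  unfolding pl_def
proof (intro conjI allI impI)
  have "continuous_on {0..} (\<lambda>t. h (t / r))"
    using assms by (intro continuous_on_compose2[OF pl_continuous[OF assms(1)]] continuous_intros) auto
  then show "continuous_on {0..} (\<lambda>t. r * h (t / r))" by (intro continuous_intros)
next
  fix t :: real assume "0 \<le> t"
  then have "affine_germ (at_right (t / r)) h" using assms by (auto simp: pl_def)
  moreover have "filterlim (\<lambda>t. t / r) (at_right (t / r)) (at_right t)"
    unfolding filterlim_at
    using assms by (auto intro!: tendsto_intros eventually_at_right_greater simp: divide_strict_right_mono)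
  ultimately show "affine_germ (at_right t) (\<lambda>t. r * h (t / r))"
    by (rule affine_germ_rescale[OF assms(2)])
next
  fix t :: real assume "0 < t"
  then have "affine_germ (at_left (t / r)) h" using assms by (auto simp: pl_def)
  moreover have "filterlim (\<lambda>t. t / r) (at_left (t / r)) (at_left t)"
    unfolding filterlim_at
    using assms by (auto intro!: tendsto_intros simp: divide_strict_right_mono eventually_at_filter)
  ultimately show "affine_germ (at_left t) (\<lambda>t. r * h (t / r))"
    by (rule affine_germ_rescale[OF assms(2)])
next
  have "affine_germ at_top h" using assms by (auto simp: pl_def)
  moreover have "filterlim (\<lambda>t. t / r) at_top at_top"
    unfolding filterlim_at_top
  proof
    fix Z :: real
    show "\<forall>\<^sub>F t in at_top. Z \<le> t / r"
      using eventually_ge_at_top[of "Z * r"] by eventually_elim (use assms(2) in \<open>simp add: field_simps\<close>)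
  qed
  ultimately show "affine_germ at_top (\<lambda>t. r * h (t / r))"
    by (rule affine_germ_rescale[OF assms(2)])
qed

text \<open>The germs in coordinates: continuity turns the constant term into the value at the point.\<close>

lemma pl_right_slope:
  assumes "pl h" "0 \<le> t"
  obtains m :: int and d where "0 < d" "\<And>s. t \<le> s \<Longrightarrow> s < t + d \<Longrightarrow> h s = h t + of_int m * (s - t)"
proof -
  obtain m c where ev: "\<forall>\<^sub>F s in at_right t. h s = of_int m * s + c"
    using assms by (auto simp: pl_def affine_germ_def)
  have "filterlim h (nhds (h t)) (at t within {0..})"
    using pl_continuous[OF assms(1)] assms(2) by (auto simp: continuous_on_def)
  then have "filterlim h (nhds (h t)) (at_right t)"
    by (rule tendsto_within_subset) (use assms(2) in auto)
  then have "filterlim (\<lambda>s. of_int m * s + c) (nhds (h t)) (at_right t)"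
    using ev by (rule Lim_transform_eventually)
  moreover have "filterlim (\<lambda>s. of_int m * s + c) (nhds (of_int m * t + c)) (at_right t)"
    by (intro tendsto_intros)
  ultimately have "h t = of_int m * t + c"
    using tendsto_unique[OF trivial_limit_at_right_real] by blast
  moreover obtain b where "b > t" "\<And>s. t < s \<Longrightarrow> s < b \<Longrightarrow> h s = of_int m * s + c"
    using ev by (auto simp: eventually_at_right_field)
  ultimately show ?thesis
    by (intro that[of "b - t" m]) (auto simp: algebra_simps le_less)
qed

lemma pl_left_slope:
  assumes "pl h" "0 < t"
  obtains m :: int and d
  where "0 < d" "d \<le> t" "\<And>s. t - d < s \<Longrightarrow> s \<le> t \<Longrightarrow> h s = h t + of_int m * (s - t)"
proof -
  obtain m c where ev: "\<forall>\<^sub>F s in at_left t. h s = of_int m * s + c"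
    using assms by (auto simp: pl_def affine_germ_def)
  have "filterlim h (nhds (h t)) (at t)"
    using continuous_on_interior[OF pl_continuous[OF assms(1)], of t] assms(2)
    by (simp add: isCont_def)
  then have "filterlim h (nhds (h t)) (at_left t)" by (rule tendsto_within_subset) auto
  then have "filterlim (\<lambda>s. of_int m * s + c) (nhds (h t)) (at_left t)"
    using ev by (rule Lim_transform_eventually)
  moreover have "filterlim (\<lambda>s. of_int m * s + c) (nhds (of_int m * t + c)) (at_left t)"
    by (intro tendsto_intros)
  ultimately have "h t = of_int m * t + c"
    using tendsto_unique[OF trivial_limit_at_left_real] by blast
  moreover obtain b where "b < t" "\<And>s. b < s \<Longrightarrow> s < t \<Longrightarrow> h s = of_int m * s + c"
    using ev by (auto simp: eventually_at_left_field)
  ultimately show ?thesis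
    using assms(2) by (intro that[of "min (t - b) t" m]) (auto simp: algebra_simps le_less)
qed

lemma pl_top_slope:
  assumes "pl h"
  obtains m :: int and T where "0 \<le> T" "\<And>s. T \<le> s \<Longrightarrow> h s = h T + of_int m * (s - T)"
proof -
  obtain m c where ev: "\<forall>\<^sub>F s in at_top. h s = of_int m * s + c"
    using assms by (auto simp: pl_def affine_germ_def)
  then obtain T where "\<And>s. T \<le> s \<Longrightarrow> h s = of_int m * s + c"
    by (auto simp: eventually_at_top_linorder)
  then show ?thesis by (intro that[of "max T 0" m]) (auto simp: algebra_simps)
qed

text \<open>The two one-sided germs at an interior point, and the only germ at \<open>0\<close>, cover a neighbourhood
  of the point in the half-line.\<close>

lemma pl_local:
  assumes "pl h" "0 \<le> t"
  obtains m m' :: int and d where "0 < d"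
    "\<And>s. t \<le> s \<Longrightarrow> s < t + d \<Longrightarrow> h s = h t + of_int m * (s - t)"
    "\<And>s. 0 \<le> s \<Longrightarrow> t - d < s \<Longrightarrow> s \<le> t \<Longrightarrow> h s = h t + of_int m' * (s - t)"
proof -
  obtain m :: int and d where r: "0 < d" "\<And>s. t \<le> s \<Longrightarrow> s < t + d \<Longrightarrow> h s = h t + of_int m * (s - t)"
    by (rule pl_right_slope[OF assms]) (rule that)
  show ?thesis
  proof (cases "t = 0")
    case True
    show ?thesis
    proof (rule that[of d m 0])
      fix s assume "0 \<le> s" "t - d < s" "s \<le> t"
      then show "h s = h t + of_int 0 * (s - t)" using True by simp
    qed (use r in blast)+
  next
    case False
    then have "0 < t" using assms(2) by simp
    then obtain m' :: int and d' where l: "0 < d'" "d' \<le> t"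
        "\<And>s. t - d' < s \<Longrightarrow> s \<le> t \<Longrightarrow> h s = h t + of_int m' * (s - t)"
      by (rule pl_left_slope[OF assms(1)]) (rule that)
    show ?thesis
    proof (rule that[of "min d d'" m m'])
      show "0 < min d d'" using r(1) l(1) by simp
    next
      fix s assume "t \<le> s" "s < t + min d d'"
      then show "h s = h t + of_int m * (s - t)" by (intro r(2)) auto
    next
      fix s assume "t - min d d' < s" "s \<le> t"
      then show "h s = h t + of_int m' * (s - t)" by (intro l(3)) auto
    qed
  qed
qed

text \<open>By compactness a bounded interval is a finite concatenation of intervals on which the function is
  affine. The global properties of these functions are derived from their local definition through this
  rule.\<close>

lemma pl_interval_induct:
  assumes h: "pl h" and uv: "0 \<le> u" "u \<le> v"
    and trans: "\<And>a b c. P a b \<Longrightarrow> P b c \<Longrightarrow> 0 \<le> a \<Longrightarrow> a \<le> b \<Longrightarrow> b \<le> c \<Longrightarrow> P a c"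
    and affine: "\<And>a b (m::int). 0 \<le> a \<Longrightarrow> a \<le> b \<Longrightarrow>
      (\<And>s t. s \<in> {a..b} \<Longrightarrow> t \<in> {a..b} \<Longrightarrow> h t - h s = of_int m * (t - s)) \<Longrightarrow> P a b"
  shows "P u v"
proof -
  have "0 \<le> u \<longrightarrow> P u v"
  proof (rule Bolzano[OF uv(2), of "\<lambda>a b. 0 \<le> a \<longrightarrow> P a b"])
    fix a b c assume "0 \<le> a \<longrightarrow> P a b" "0 \<le> b \<longrightarrow> P b c" "a \<le> b" "b \<le> c"
    then show "0 \<le> a \<longrightarrow> P a c" by (auto intro: trans)
  next
    fix x assume "u \<le> x" "x \<le> v"
    then have x: "0 \<le> x" using uv by simp
    obtain m m' :: int and d where d: "0 < d"
        "\<And>s. x \<le> s \<Longrightarrow> s < x + d \<Longrightarrow> h s = h x + of_int m * (s - x)"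
        "\<And>s. 0 \<le> s \<Longrightarrow> x - d < s \<Longrightarrow> s \<le> x \<Longrightarrow> h s = h x + of_int m' * (s - x)"
      by (rule pl_local[OF h x]) (rule that)
    have "P a b" if "0 \<le> a" "a \<le> x" "x \<le> b" "b - a < d" for a b
    proof (rule trans[of a x b])
      show "P a x"
      proof (rule affine[of _ _ m'])
        fix s t assume "s \<in> {a..x}" "t \<in> {a..x}"
        with that have "h s = h x + of_int m' * (s - x)" "h t = h x + of_int m' * (t - x)"
          by (auto intro!: d(3))
        then show "h t - h s = of_int m' * (t - s)" by (simp add: algebra_simps)
      qed (use that in auto)
      show "P x b"
      proof (rule affine[of _ _ m])
        fix s t assume "s \<in> {x..b}" "t \<in> {x..b}"
        with that have "h s = h x + of_int m * (s - x)" "h t = h x + of_int m * (t - x)"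
          by (auto intro!: d(2))
        then show "h t - h s = of_int m * (t - s)" by (simp add: algebra_simps)
      qed (use that x in auto)
    qed (use that in auto)
    with d(1) show "\<exists>d>0. \<forall>a b. a \<le> x \<and> x \<le> b \<and> b - a < d \<longrightarrow> (0 \<le> a \<longrightarrow> P a b)"
      by auto
  qed
  with uv show ?thesis by simp
qed

text \<open>Finitely many slopes occur, so one of them is largest in absolute value.\<close>

lemma pl_lipschitz:
  assumes "pl h"
  obtains N :: nat where "\<And>s t. 0 \<le> s \<Longrightarrow> 0 \<le> t \<Longrightarrow> \<bar>h s - h t\<bar> \<le> real N * \<bar>s - t\<bar>"
proof -
  define L where "L u v N \<longleftrightarrow> (\<forall>s t. u \<le> s \<and> s \<le> t \<and> t \<le> v \<longrightarrow> \<bar>h t - h s\<bar> \<le> real N * (t - s))" for u v N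
  obtain m :: int and T where T: "0 \<le> T" "\<And>s. T \<le> s \<Longrightarrow> h s = h T + of_int m * (s - T)"
    by (rule pl_top_slope[OF assms]) (rule that)
  have mono: "L a b M" if "L a b N" "N \<le> M" for a b N M
    unfolding L_def
  proof (intro allI impI)
    fix s t assume st: "a \<le> s \<and> s \<le> t \<and> t \<le> b"
    have "\<bar>h t - h s\<bar> \<le> real N * (t - s)" using that(1) st by (auto simp: L_def)
    also have "\<dots> \<le> real M * (t - s)" using that(2) st by (intro mult_right_mono) auto
    finally show "\<bar>h t - h s\<bar> \<le> real M * (t - s)" .
  qed
  have join: "L a c (max N M)" if "L a b N" "L b c M" for a b c N M
    unfolding L_def
  proof (intro allI impI, elim conjE)
    fix s t assume st: "a \<le> s" "s \<le> t" "t \<le> c"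
    have ab: "L a b (max N M)" and bc: "L b c (max N M)" using that by (auto intro: mono)
    consider "t \<le> b" | "b \<le> s" | "s \<le> b" "b \<le> t" by linarith
    then show "\<bar>h t - h s\<bar> \<le> real (max N M) * (t - s)"
    proof cases
      case 1
      then show ?thesis using ab st unfolding L_def by blast
    next
      case 2
      then show ?thesis using bc st unfolding L_def by blast
    next
      case 3
      then have "\<bar>h b - h s\<bar> \<le> real (max N M) * (b - s)" "\<bar>h t - h b\<bar> \<le> real (max N M) * (t - b)"
        using ab bc st unfolding L_def by blast+
      then show ?thesis unfolding right_diff_distrib by linarith
    qed
  qed
  have "\<exists>N. L 0 T N"
  proof (rule pl_interval_induct[OF assms order_refl T(1), of "\<lambda>u v. \<exists>N. L u v N"])
    fix a b c assume "\<exists>N. L a b N" "\<exists>N. L b c N"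
    then show "\<exists>N. L a c N" using join by blast
  next
    fix a b and m :: int
    assume "\<And>s t. s \<in> {a..b} \<Longrightarrow> t \<in> {a..b} \<Longrightarrow> h t - h s = of_int m * (t - s)"
    then have "L a b (nat \<bar>m\<bar>)" by (auto simp: L_def abs_mult)
    then show "\<exists>N. L a b N" ..
  qed
  then obtain N where N: "L 0 T N" ..
  have top: "L T v (nat \<bar>m\<bar>)" for v
  proof -
    have "h t - h s = of_int m * (t - s)" if "T \<le> s" "T \<le> t" for s t
      using T(2)[OF that(1)] T(2)[OF that(2)] by (simp add: algebra_simps)
    then show ?thesis by (auto simp: L_def abs_mult)
  qed
  let ?M = "max N (nat \<bar>m\<bar>)"
  have le: "\<bar>h t - h s\<bar> \<le> real ?M * (t - s)" if "0 \<le> s" "s \<le> t" for s t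
    using join[OF N top[of t]] that by (auto simp: L_def)
  show ?thesis
  proof (rule that)
    fix s t :: real assume "0 \<le> s" "0 \<le> t"
    then show "\<bar>h s - h t\<bar> \<le> real ?M * \<bar>s - t\<bar>"
      using le[of s t] le[of t s] by (cases "s \<le> t") (auto simp: abs_minus_commute)
  qed
qed

text \<open>Near an isolated zero a nonnegative function grows with a positive integer slope, hence at least
  as fast as the distance to the zero; away from it, it is bounded below, since it is eventually affine.
  This is where the integrality of the slopes enters the determination of distances.\<close>

lemma pl_lower_bound:
  assumes h: "pl h" and nonneg: "\<And>t. 0 \<le> t \<Longrightarrow> 0 \<le> h t"
    and zero: "\<And>t. 0 \<le> t \<Longrightarrow> h t = 0 \<Longrightarrow> t = a"
  obtains c where "0 < c" "\<And>t. 0 \<le> t \<Longrightarrow> min \<bar>t - a\<bar> c \<le> h t"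
proof -
  define B where "B u v \<longleftrightarrow> (\<exists>c>0. \<forall>t\<in>{u..v}. min \<bar>t - a\<bar> c \<le> h t)" for u v
  obtain m :: int and T0 where T0: "0 \<le> T0" "\<And>s. T0 \<le> s \<Longrightarrow> h s = h T0 + of_int m * (s - T0)"
    by (rule pl_top_slope[OF h]) (rule that)
  define T where "T = max T0 (a + 1)"
  have T: "0 \<le> T" "a < T" "T0 \<le> T" using T0(1) by (auto simp: T_def)
  have hT: "h s = h T + of_int m * (s - T)" if "T \<le> s" for s
    using T0(2)[of s] T0(2)[OF T(3)] that T(3) by (simp add: algebra_simps)
  have "0 < h T" using nonneg[of T] zero[of T] T by force
  \<comment> \<open>A negative slope at infinity contradicts nonnegativity.\<close>
  have "0 \<le> m"
  proof (rule ccontr)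
    assume "\<not> 0 \<le> m"
    then have m: "of_int m \<le> (-1::real)" by linarith
    have "h (T + h T + 1) = h T + of_int m * (h T + 1)" using hT[of "T + h T + 1"] \<open>0 < h T\<close> by simp
    also have "\<dots> \<le> h T + (-1) * (h T + 1)" using m \<open>0 < h T\<close> by (intro add_left_mono mult_right_mono) auto
    finally show False using nonneg[of "T + h T + 1"] T(1) \<open>0 < h T\<close> by simp
  qed
  then have top: "h T \<le> h s" if "T \<le> s" for s using hT[OF that] that by simp
  have "B 0 T"
  proof (rule pl_interval_induct[OF h order_refl T(1)])
    fix u v w assume "B u v" "B v w" "u \<le> v" "v \<le> w"
    then obtain c c' where c: "0 < c" "\<And>t. t\<in>{u..v} \<Longrightarrow> min \<bar>t - a\<bar> c \<le> h t"
        "0 < c'" "\<And>t. t\<in>{v..w} \<Longrightarrow> min \<bar>t - a\<bar> c' \<le> h t"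
      by (auto simp: B_def)
    have "min \<bar>t - a\<bar> (min c c') \<le> h t" if "t \<in> {u..w}" for t
      using c(2)[of t] c(4)[of t] that by (cases "t \<le> v") auto
    then show "B u w" using c unfolding B_def by (intro exI[of _ "min c c'"]) auto
  next
    fix u v and m :: int
    assume u: "0 \<le> u" "u \<le> v"
      and m: "\<And>s t. s \<in> {u..v} \<Longrightarrow> t \<in> {u..v} \<Longrightarrow> h t - h s = of_int m * (t - s)"
    have pos: "0 < h t" if "0 \<le> t" "t \<noteq> a" for t using nonneg[of t] zero[of t] that by force
    have grow: "x \<le> of_int k * x" if "0 < of_int k * y" "0 < y" "0 \<le> x" for k :: int and x y :: real
    proof -
      have "0 < k" using that by (simp add: zero_less_mult_iff)
      then show ?thesis using that mult_right_mono[of 1 "of_int k" x] by simp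
    qed
    consider "h u = 0" "u < v" | "h v = 0" "u < v" | "u = v" "h u = 0" | "0 < h u" "0 < h v"
      using nonneg[of u] nonneg[of v] u by fastforce
    then show "B u v"
    proof cases
      case 1
      then have a: "a = u" using zero[of u] u by simp
      have "\<bar>t - a\<bar> \<le> h t" if "t \<in> {u..v}" for t
        using m[of u t] m[of u v] pos[of v] grow[of m "v - u" "t - u"] 1 a that u by auto
      then show ?thesis unfolding B_def by (intro exI[of _ 1]) (auto simp: min.coboundedI1)
    next
      case 2
      then have a: "a = v" using zero[of v] u by simp
      have "\<bar>t - a\<bar> \<le> h t" if "t \<in> {u..v}" for t
        using m[of v t] m[of v u] pos[of u] grow[of "- m" "v - u" "v - t"] 2 a that u
        by (auto simp: algebra_simps)
      then show ?thesis unfolding B_def by (intro exI[of _ 1]) (auto simp: min.coboundedI1)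
    next
      case 3
      then have "u = a" using zero[of u] u by simp
      then show ?thesis using 3 unfolding B_def by (intro exI[of _ 1]) auto
    next
      case 4
      have "min (h u) (h v) \<le> h t" if t: "t \<in> {u..v}" for t
      proof (cases "0 \<le> m")
        case True
        then have "0 \<le> of_int m * (t - u)" using t by simp
        then show ?thesis using m[of u t] t u by auto
      next
        case False
        then have "0 \<le> of_int m * (t - v)" using t by (simp add: mult_nonpos_nonpos)
        then show ?thesis using m[of v t] t u by auto
      qed
      then show ?thesis using 4 unfolding B_def
        by (intro exI[of _ "min (h u) (h v)"]) (auto simp: min.coboundedI2)
    qed
  qed
  then obtain c where "0 < c" "\<And>t. t\<in>{0..T} \<Longrightarrow> min \<bar>t - a\<bar> c \<le> h t" by (auto simp: B_def)
  note c = this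
  show ?thesis
  proof (rule that[of "min c (h T)"])
    show "0 < min c (h T)" using c(1) \<open>0 < h T\<close> by simp
    fix t :: real assume "0 \<le> t"
    then show "min \<bar>t - a\<bar> (min c (h T)) \<le> h t"
      using c(2)[of t] top[of t] by (cases "t \<le> T") (auto simp: min_le_iff_disj)
  qed
qed

text \<open>The first breakpoint beyond \<open>t\<close> ends the piece that determines the germ on the right of \<open>t\<close>, and the
  first one that is at least \<open>t\<close> ends the piece that determines the germ on the left.\<close>

lemma piecewise_affine_imp_pl:
  assumes cont: "continuous_on {0..} h" and g: "\<And>t. 0 \<le> t \<Longrightarrow> g (ereal t) = ereal (h t)"
    and "piecewise_affine \<infinity> g"
  shows "pl h"
proof -
  obtain k b where b0: "b 0 = 0" and bk: "b k = \<infinity>"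
    and b: "\<And>j. j < k \<Longrightarrow> b j < b (Suc j) \<and> (\<exists>(m::int) (c::real).
        \<forall>t::real. b j \<le> ereal t \<and> ereal t \<le> b (Suc j) \<longrightarrow> g (ereal t) = ereal (of_int m * t + c))"
    using assms(3) unfolding piecewise_affine_def by blast
  have piece: "affine_germ F h"
    if j: "j < k" and ev: "\<forall>\<^sub>F t in F. b j \<le> ereal t \<and> ereal t \<le> b (Suc j) \<and> 0 \<le> t" for F j
  proof -
    obtain m :: int and c :: real
      where mc: "\<And>t::real. b j \<le> ereal t \<Longrightarrow> ereal t \<le> b (Suc j) \<Longrightarrow> g (ereal t) = ereal (of_int m * t + c)"
      using b[OF j] by blast
    from ev have "\<forall>\<^sub>F t in F. h t = of_int m * t + c"
      by eventually_elim (use mc g in force)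
    then show ?thesis by (rule affine_germI)
  qed
  show ?thesis unfolding pl_def
  proof (intro conjI allI impI cont)
    fix t :: real assume t: "0 \<le> t"
    define i where "i = (LEAST i. ereal t < b i)"
    have ex: "ereal t < b k" by (simp add: bk)
    have i: "ereal t < b i" "i \<le> k" unfolding i_def by (rule LeastI[of _ k], rule ex) (rule Least_le, rule ex)
    have "i \<noteq> 0" using i(1) b0 t by (cases i) auto
    then obtain j where j: "i = Suc j" by (cases i) auto
    have "\<not> ereal t < b j" using not_less_Least[of j "\<lambda>i. ereal t < b i"] j by (simp add: i_def)
    then have bj: "b j \<le> ereal t" by simp
    have "eventually (\<lambda>s. ereal s < b i) (at_right t)"
    proof -
      have "(ereal \<longlongrightarrow> ereal t) (at_right t)" by (intro tendsto_intros)
      from order_tendstoD(2)[OF this i(1)] show ?thesis .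
    qed
    moreover have "eventually (\<lambda>s. t < s) (at_right t)" by (rule eventually_at_right_greater)
    ultimately have "\<forall>\<^sub>F s in at_right t. b j \<le> ereal s \<and> ereal s \<le> b (Suc j) \<and> 0 \<le> s"
    proof eventually_elim
      case (elim s)
      then have "b j \<le> ereal s" using bj by (metis ereal_less_eq(3) less_imp_le order_trans)
      then show ?case using elim j t by auto
    qed
    then show "affine_germ (at_right t) h" by (rule piece[rotated]) (use i(2) j in auto)
  next
    fix t :: real assume t: "0 < t"
    define i where "i = (LEAST i. ereal t \<le> b i)"
    have ex: "ereal t \<le> b k" by (simp add: bk)
    have i: "ereal t \<le> b i" "i \<le> k" unfolding i_def by (rule LeastI[of _ k], rule ex) (rule Least_le, rule ex)
    have "i \<noteq> 0" using i(1) b0 t by (cases i) auto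
    then obtain j where j: "i = Suc j" by (cases i) auto
    have "\<not> ereal t \<le> b j" using not_less_Least[of j "\<lambda>i. ereal t \<le> b i"] j by (simp add: i_def)
    then have bj: "b j < ereal t" by simp
    have "eventually (\<lambda>s. b j < ereal s) (at_left t)"
    proof -
      have "(ereal \<longlongrightarrow> ereal t) (at_left t)" by (intro tendsto_intros)
      from order_tendstoD(1)[OF this bj] show ?thesis .
    qed
    moreover have "eventually (\<lambda>s. 0 < s \<and> s < t) (at_left t)"
      using t eventually_at_left_field by blast
    ultimately have "\<forall>\<^sub>F s in at_left t. b j \<le> ereal s \<and> ereal s \<le> b (Suc j) \<and> 0 \<le> s"
    proof eventually_elim
      case (elim s)
      then have "ereal s \<le> b i" using i(1) by (metis ereal_less_eq(3) less_imp_le order_trans)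
      then show ?case using elim j by auto
    qed
    then show "affine_germ (at_left t) h" by (rule piece[rotated]) (use i(2) j in auto)
  next
    have "k \<noteq> 0" using b0 bk by (cases k) auto
    then obtain j where j: "k = Suc j" by (cases k) auto
    then obtain T :: real where T: "b j \<le> ereal T"
      using b[of j] bk by (cases "b j") auto
    have "\<forall>\<^sub>F s in at_top. b j \<le> ereal s \<and> ereal s \<le> b (Suc j) \<and> 0 \<le> s"
      using eventually_ge_at_top[of "max T 0"]
    proof eventually_elim
      case (elim s)
      then have "b j \<le> ereal s" using T by (metis ereal_less_eq(3) max.boundedE order_trans)
      then show ?case using elim j bk by auto
    qed
    then show "affine_germ at_top h" by (rule piece[rotated]) (use j in auto)
  qed
qed

text \<open>The subdivision consists of a chain of affine pieces up to a point \<open>T\<close> beyond which the function is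
  affine, and of the final piece from \<open>T\<close> to \<open>\<infinity>\<close>.\<close>

lemma pl_imp_piecewise_affine:
  assumes h: "pl h" and g: "\<And>t. 0 \<le> t \<Longrightarrow> g (ereal t) = ereal (h t)"
  shows "piecewise_affine \<infinity> g"
proof -
  define piece where "piece u v \<longleftrightarrow> u < v \<and> (\<exists>m::int. \<forall>t\<in>{u..v}. h t = h u + of_int m * (t - u))" for u v
  obtain m :: int and T where T: "0 \<le> T" "\<And>s. T \<le> s \<Longrightarrow> h s = h T + of_int m * (s - T)"
    by (rule pl_top_slope[OF h]) (rule that)
  have "piece\<^sup>*\<^sup>* 0 T"
  proof (rule pl_interval_induct[OF h order_refl T(1)])
    fix a b c assume "piece\<^sup>*\<^sup>* a b" "piece\<^sup>*\<^sup>* b c"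
    then show "piece\<^sup>*\<^sup>* a c" by (rule rtranclp_trans)
  next
    fix a b and m :: int
    assume "a \<le> b" and m: "\<And>s t. s \<in> {a..b} \<Longrightarrow> t \<in> {a..b} \<Longrightarrow> h t - h s = of_int m * (t - s)"
    show "piece\<^sup>*\<^sup>* a b"
    proof (cases "a = b")
      case False
      have "h t = h a + of_int m * (t - a)" if "t \<in> {a..b}" for t
        using m[of a t] that \<open>a \<le> b\<close> by simp
      moreover have "a < b" using False \<open>a \<le> b\<close> by simp
      ultimately have "piece a b" unfolding piece_def by blast
      then show ?thesis by blast
    qed auto
  qed
  then obtain k where "(piece ^^ k) 0 T" using rtranclp_imp_relpowp by metis
  then obtain b where b: "b 0 = 0" "b k = T" "\<And>i. i < k \<Longrightarrow> piece (b i) (b (Suc i))"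
    unfolding relpowp_fun_conv by blast
  have bpos: "0 \<le> b i" if "i \<le> k" for i
    using that
  proof (induction i)
    case (Suc i)
    then have "piece (b i) (b (Suc i))" by (intro b(3)) simp
    then have "b i < b (Suc i)" by (simp add: piece_def)
    with Suc show ?case by simp
  qed (simp add: b(1))
  define B where "B i = (if i \<le> k then ereal (b i) else \<infinity>)" for i
  show ?thesis unfolding piecewise_affine_def
  proof (intro exI[of _ "Suc k"] exI[of _ B] conjI allI impI)
    show "B 0 = 0" "B (Suc k) = \<infinity>" by (auto simp: B_def b(1) zero_ereal_def)
    fix j assume "j < Suc k"
    then consider "j < k" | "j = k" by linarith
    then have "B j < B (Suc j) \<and> (\<exists>(m::int) (c::real). \<forall>t::real. B j \<le> ereal t \<and> ereal t \<le> B (Suc j) \<longrightarrow>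
          g (ereal t) = ereal (of_int m * t + c))"
    proof cases
      case 1
      have Bj: "B j = ereal (b j)" "B (Suc j) = ereal (b (Suc j))" using 1 by (auto simp: B_def)
      obtain m' :: int where lt: "b j < b (Suc j)"
          and m': "\<And>t. t \<in> {b j..b (Suc j)} \<Longrightarrow> h t = h (b j) + of_int m' * (t - b j)"
        using b(3)[OF 1] unfolding piece_def by blast
      have "g (ereal t) = ereal (of_int m' * t + (h (b j) - of_int m' * b j))"
        if "B j \<le> ereal t" "ereal t \<le> B (Suc j)" for t
      proof -
        have "t \<in> {b j..b (Suc j)}" using that by (simp add: Bj)
        moreover from this have "0 \<le> t" using bpos[of j] 1 by simp
        ultimately show ?thesis using m'[of t] g[of t] by (simp add: algebra_simps)
      qed
      moreover have "B j < B (Suc j)" using lt by (simp add: Bj)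
      ultimately show ?thesis by blast
    next
      case 2
      have Bj: "B j = ereal T" "B (Suc j) = \<infinity>" using 2 by (auto simp: B_def b(2))
      have "g (ereal t) = ereal (of_int m * t + (h T - of_int m * T))"
        if "B j \<le> ereal t" for t
      proof -
        have "T \<le> t" using that by (simp add: Bj)
        then show ?thesis using T(1) T(2)[of t] g[of t] by (simp add: algebra_simps)
      qed
      moreover have "B j < B (Suc j)" by (simp add: Bj)
      ultimately show ?thesis by blast
    qed
    then show "B j < B (Suc j)" "\<exists>(m::int) (c::real). \<forall>t::real. B j \<le> ereal t \<and> ereal t \<le> B (Suc j) \<longrightarrow>
          g (ereal t) = ereal (of_int m * t + c)" by blast+
  qed
qed

lemma pl_limit_at_top:
  assumes "pl h"
  obtains L where "((\<lambda>t. ereal (h t)) \<longlongrightarrow> L) at_top"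
proof -
  obtain m :: int and c where "\<forall>\<^sub>F t in at_top. h t = of_int m * t + c"
    using assms by (auto simp: pl_def affine_germ_def)
  then have ev: "\<forall>\<^sub>F t in at_top. ereal (of_int m * t + c) = ereal (h t)"
    by eventually_elim simp
  consider "m = 0" | "m > 0" | "m < 0" by linarith
  then have "\<exists>L. ((\<lambda>t. ereal (of_int m * t + c)) \<longlongrightarrow> L) at_top"
  proof cases
    case 1 then show ?thesis by (auto intro: tendsto_const)
  next
    case 2
    then have "filterlim (\<lambda>t. of_int m * t + c) at_top at_top"
      by real_asymp
    then have "((\<lambda>t. ereal (of_int m * t + c)) \<longlongrightarrow> \<infinity>) at_top" by (simp only: tendsto_PInfty_eq_at_top)
    then show ?thesis by blast
  next
    case 3
    then have "filterlim (\<lambda>t. of_int (- m) * t + (- c)) at_top at_top"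
      by real_asymp
    then have "((\<lambda>t. ereal (of_int (- m) * t + (- c))) \<longlongrightarrow> \<infinity>) at_top" by (simp only: tendsto_PInfty_eq_at_top)
    then have "((\<lambda>t. - ereal (of_int (- m) * t + (- c))) \<longlongrightarrow> - \<infinity>) at_top" by (rule tendsto_uminus_ereal)
    then show ?thesis by (auto simp: add.commute)
  qed
  then obtain L where "((\<lambda>t. ereal (of_int m * t + c)) \<longlongrightarrow> L) at_top" ..
  then have "((\<lambda>t. ereal (h t)) \<longlongrightarrow> L) at_top" using ev by (rule Lim_transform_eventually)
  then show ?thesis by (rule that)
qed

text \<open>An integer slope that is divisible by every positive integer vanishes.\<close>

lemma pl_divisible_imp_const:
  assumes h: "pl h" and div: "\<And>q::nat. 0 < q \<Longrightarrow> \<exists>g. pl g \<and> (\<forall>t\<ge>0. h t = real q * g t)"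
    and t: "0 \<le> t"
  shows "h t = h 0"
proof (rule sym, rule pl_interval_induct[OF h order_refl t, of "\<lambda>u v. h u = h v"])
  fix a b and m :: int
  assume ab: "0 \<le> a" "a \<le> b"
    and m: "\<And>s t. s \<in> {a..b} \<Longrightarrow> t \<in> {a..b} \<Longrightarrow> h t - h s = of_int m * (t - s)"
  show "h a = h b"
  proof (cases "a = b")
    case False
    \<comment> \<open>The only multiple of \<open>q\<close> that is at most \<open>\<bar>m\<bar>\<close> in absolute value is \<open>0\<close>.\<close>
    define q where "q = Suc (nat \<bar>m\<bar>)"
    obtain g where g: "pl g" "\<And>t. 0 \<le> t \<Longrightarrow> h t = real q * g t"
      using div[of q] by (auto simp: q_def)
    obtain m' :: int and d
      where d: "0 < d" "\<And>s. a \<le> s \<Longrightarrow> s < a + d \<Longrightarrow> g s = g a + of_int m' * (s - a)"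
      by (rule pl_right_slope[OF g(1) ab(1)]) (rule that)
    define e where "e = min (d / 2) (b - a)"
    have e: "0 < e" "e < d" "a + e \<le> b" using d(1) False ab by (auto simp: e_def)
    have "of_int m * e = h (a + e) - h a" using m[of a "a + e"] e by simp
    also have "\<dots> = real q * (g (a + e) - g a)" using g(2)[of a] g(2)[of "a + e"] ab e by (simp add: algebra_simps)
    also have "\<dots> = real q * of_int m' * e" using d(2)[of "a + e"] e by simp
    finally have "of_int m = real_of_int (int q * m')" using e by simp
    then have "m = int q * m'" by linarith
    then have "int q dvd m" by simp
    then have "m = 0" using dvd_imp_le_int[of m "int q"] by (auto simp: q_def)
    then show ?thesis using m[of a b] ab by simp
  qed simp
qed simp

section \<open>The star-shaped curve\<close>

definition ray :: "nat \<Rightarrow> real \<Rightarrow> (nat, nat) point" where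
  "ray i t = (if t = 0 then Vertex 0 else Inner i (ereal t))"

text \<open>Polar coordinates of finite points: the distance to the centre and the copy of \<open>[0, \<infinity>]\<close>, the
  latter being \<open>0\<close> at the centre.\<close>

fun radius :: "(nat, nat) point \<Rightarrow> real" where
  "radius (Vertex v) = 0"
| "radius (Inner i t) = real_of_ereal t"

fun leg :: "(nat, nat) point \<Rightarrow> nat" where
  "leg (Vertex v) = 0"
| "leg (Inner i t) = i"

definition star_dist :: "(nat, nat) point \<Rightarrow> (nat, nat) point \<Rightarrow> real" where
  "star_dist p q = (if leg p = leg q then \<bar>radius p - radius q\<bar> else radius p + radius q)"

lemma star_simps [simp]:
  "verts (star n) = {0..n}" "arcs (star n) = {1..n}" "tail (star n) i = 0"
  "head (star n) i = i" "len (star n) i = \<infinity>"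
  by (simp_all add: star_def)

lemma chart_star:
  "chart (star n) i t = (if t = 0 then Vertex 0 else if t = \<infinity> then Vertex i else Inner i t)"
  by (simp add: chart_def)

lemma chart_ray: "chart (star n) i (ereal t) = ray i t"
  by (simp add: chart_star ray_def zero_ereal_def)

lemma ray_0 [simp]: "ray i 0 = Vertex 0"
  by (simp add: ray_def)

lemma radius_ray [simp]: "radius (ray i t) = t"
  by (simp add: ray_def)

lemma leg_ray: "leg (ray i t) = (if t = 0 then 0 else i)"
  by (simp add: ray_def)

lemma ray_eq_iff: "ray i s = ray j t \<longleftrightarrow> s = t \<and> (s = 0 \<or> i = j)"
  by (auto simp: ray_def)

lemma star_dist_ray:
  "0 \<le> s \<Longrightarrow> 0 \<le> t \<Longrightarrow> star_dist (ray i s) (ray j t) = (if i = j then \<bar>s - t\<bar> else s + t)"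
  by (auto simp: star_dist_def leg_ray)

lemma star_dist_commute: "star_dist p q = star_dist q p"
  by (simp add: star_dist_def abs_minus_commute add.commute)

locale star_curve =
  fixes n :: nat
  assumes n_pos: "1 \<le> n"
begin

abbreviation pts where "pts \<equiv> points (star n)"
abbreviation fin where "fin \<equiv> finite_points (star n)"
abbreviation topo where "topo \<equiv> curve_topology (star n)"

lemma pts_eq: "pts = Vertex ` {0..n} \<union> {ray i t | i t. i \<in> {1..n} \<and> 0 \<le> t}"
proof (intro equalityI subsetI)
  fix p assume "p \<in> pts"
  then show "p \<in> Vertex ` {0..n} \<union> {ray i t | i t. i \<in> {1..n} \<and> 0 \<le> t}"
  proof (unfold points_def, elim UnE)
    assume "p \<in> {chart (star n) e t |e t. e \<in> arcs (star n) \<and> t \<in> {0..len (star n) e}}"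
    then obtain i t where i: "i \<in> {1..n}" "0 \<le> t" "p = chart (star n) i t" by auto
    show ?thesis
    proof (cases t)
      case (real s)
      then show ?thesis using i by (auto simp: chart_ray simp del: star_simps)
    qed (use i in \<open>auto simp: chart_star\<close>)
  qed auto
next
  fix p assume "p \<in> Vertex ` {0..n} \<union> {ray i t | i t. i \<in> {1..n} \<and> 0 \<le> t}"
  then show "p \<in> pts"
  proof (elim UnE)
    assume "p \<in> {ray i t | i t. i \<in> {1..n} \<and> 0 \<le> t}"
    then obtain i t where "i \<in> {1..n}" "0 \<le> t" "p = chart (star n) i (ereal t)"
      by (auto simp: chart_ray)
    then show ?thesis unfolding points_def by fastforce
  qed (auto simp: points_def)
qed

lemma infinite_points_eq: "infinite_points (star n) = Vertex ` {1..n}"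
  by (auto simp: infinite_points_def chart_star)

lemma fin_eq: "fin = {ray i t | i t. i \<in> {1..n} \<and> 0 \<le> t}"
proof -
  have "Vertex 0 = ray 1 0" by simp
  moreover have "1 \<in> {1..n}" using n_pos by simp
  ultimately have 0: "Vertex 0 \<in> {ray i t | i t. i \<in> {1..n} \<and> 0 \<le> t}"
    by (metis (mono_tags, lifting) mem_Collect_eq order_refl)
  have "p \<in> {ray i t | i t. i \<in> {1..n} \<and> 0 \<le> t} \<Longrightarrow> p \<notin> Vertex ` {1..n}" for p
    by (auto simp: ray_def split: if_splits)
  moreover have "{0..n} = insert 0 {1..n}" by auto
  ultimately show ?thesis
    unfolding finite_points_def pts_eq infinite_points_eq using 0 by auto
qed

lemma ray_in_fin: "i \<in> {1..n} \<Longrightarrow> 0 \<le> t \<Longrightarrow> ray i t \<in> fin"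
  by (auto simp: fin_eq)

lemma center_in_fin: "Vertex 0 \<in> fin"
  using ray_in_fin[of 1 0] n_pos by simp

lemma finE:
  assumes "p \<in> fin"
  obtains i t where "i \<in> {1..n}" "0 \<le> t" "p = ray i t"
  using assms by (auto simp: fin_eq)

lemma pts_fin: "pts = fin \<union> Vertex ` {1..n}"
proof -
  have "{0..n} = insert 0 {1..n}" by auto
  then show ?thesis using center_in_fin unfolding pts_eq fin_eq by auto
qed

lemma fin_subset_pts: "fin \<subseteq> pts"
  by (auto simp: finite_points_def)

lemma chart_in_pts: "i \<in> {1..n} \<Longrightarrow> 0 \<le> t \<Longrightarrow> chart (star n) i t \<in> pts"
  by (auto simp: points_def)

lemma star_dist_nonneg: "p \<in> fin \<Longrightarrow> q \<in> fin \<Longrightarrow> 0 \<le> star_dist p q"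
  by (elim finE) (simp add: star_dist_ray)

lemma star_dist_eq_0_iff:
  assumes "p \<in> fin" "q \<in> fin"
  shows "star_dist p q = 0 \<longleftrightarrow> p = q"
  using assms by (elim finE) (auto simp: star_dist_ray ray_eq_iff)

lemma star_dist_triangle:
  assumes "p \<in> fin" "q \<in> fin" "r \<in> fin"
  shows "star_dist p r \<le> star_dist p q + star_dist q r"
  using assms by (elim finE) (auto simp: star_dist_ray)

text \<open>Running through the centre if necessary, a route with at most two segments realises
  \<open>star_dist\<close>; the triangle inequality shows that no route is shorter.\<close>

lemma path_dist_star:
  assumes p: "p \<in> fin" and q: "q \<in> fin"
  shows "path_dist (star n) p q = star_dist p q"
proof -
  have lower: "y \<in> fin \<and> star_dist p y \<le> d" if "route (star n) x y d" "x = p" for x y d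
    using that
  proof (induction rule: route.induct)
    case (stay x)
    then show ?case using p star_dist_eq_0_iff[of p p] by auto
  next
    case (segment x e s d t)
    have e: "e \<in> {1..n}" "0 \<le> s" "0 \<le> t" using segment.hyps by auto
    have "star_dist p (ray e t) \<le> star_dist p (ray e s) + star_dist (ray e s) (ray e t)"
      using e p by (intro star_dist_triangle ray_in_fin)
    also have "\<dots> \<le> d + \<bar>s - t\<bar>"
      using segment.IH[OF segment.prems] e by (simp add: chart_ray star_dist_ray)
    finally show ?case using e by (simp add: chart_ray ray_in_fin)
  qed
  have seg: "route (star n) x (ray i t) (d + \<bar>s - t\<bar>)"
    if "route (star n) x (ray i s) d" "i \<in> {1..n}" "0 \<le> s" "0 \<le> t" for x i s t d
    using route.segment[of "star n" x i s d t] that by (simp add: chart_ray)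
  obtain i s where i: "i \<in> {1..n}" "0 \<le> s" "p = ray i s" by (rule finE[OF p]) (rule that)
  obtain j t where j: "j \<in> {1..n}" "0 \<le> t" "q = ray j t" by (rule finE[OF q]) (rule that)
  have "route (star n) p (ray i s) 0" using route.stay[of p] p i fin_subset_pts by auto
  note start = this
  have "route (star n) p q (star_dist p q)"
  proof (cases "i = j")
    case True
    then show ?thesis using seg[OF start i(1,2) j(2)] i j by (simp add: star_dist_ray)
  next
    case False
    have "route (star n) p (ray j 0) s" using seg[OF start i(1,2), of 0] i by simp
    from seg[OF this j(1) _ j(2)] show ?thesis using False i j by (simp add: star_dist_ray)
  qed
  then show ?thesis
    unfolding path_dist_def using lower by (intro cInf_eq_minimum) auto
qed

lemma topspace_star: "topspace topo = pts"
proof -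
  have "openin topo pts"
    unfolding openin_curve_topology
  proof (intro conjI ballI order_refl)
    fix e assume "e \<in> arcs (star n)"
    then have "{t \<in> {0..len (star n) e}. chart (star n) e t \<in> pts} = {0..len (star n) e}"
      using chart_in_pts by auto
    then show "openin (top_of_set {0..len (star n) e}) {t \<in> {0..len (star n) e}. chart (star n) e t \<in> pts}"
      by simp
  qed
  moreover have "U \<subseteq> pts" if "openin topo U" for U
    using that by (simp add: openin_curve_topology)
  ultimately show ?thesis
    by (metis openin_subset openin_topspace subset_antisym)
qed

text \<open>The universal property of the quotient topology.\<close>

lemma continuous_map_star_iff:
  "continuous_map topo T f \<longleftrightarrow> f \<in> pts \<rightarrow> topspace T \<and>
     (\<forall>i\<in>{1..n}. continuous_map (top_of_set {0..}) T (\<lambda>t. f (chart (star n) i t)))"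
proof -
  have I: "{0..(\<infinity>::ereal)} = {0..}" by auto
  have eq: "{t \<in> {0..}. chart (star n) i t \<in> {x \<in> pts. f x \<in> U}} = {t \<in> {0..}. f (chart (star n) i t) \<in> U}"
    if "i \<in> {1..n}" for i U
    using chart_in_pts[OF that] by auto
  show ?thesis
    unfolding continuous_map_def topspace_star openin_curve_topology
    using eq chart_in_pts by (auto simp: I Pi_iff)
qed

lemma chart_continuous: "i \<in> {1..n} \<Longrightarrow> continuous_map (top_of_set {0..}) topo (chart (star n) i)"
  using continuous_map_star_iff[of topo "\<lambda>x. x"] topspace_star by (auto simp: o_def continuous_map_id[unfolded id_def])

lemma continuous_to_ereal_iff:
  "continuous_map topo euclidean (f :: _ \<Rightarrow> ereal) \<longleftrightarrow>
     (\<forall>i\<in>{1..n}. continuous_on {0..} (\<lambda>t. f (chart (star n) i t)))"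
  by (simp add: continuous_map_star_iff)

text \<open>The finite points are dense: along the \<open>i\<close>-th copy they converge to its point at infinity.\<close>

lemma continuous_eqI:
  fixes f g :: "(nat, nat) point \<Rightarrow> ereal"
  assumes f: "continuous_map topo euclidean f" and g: "continuous_map topo euclidean g"
    and eq: "\<And>p. p \<in> fin \<Longrightarrow> f p = g p" and p: "p \<in> pts"
  shows "f p = g p"
proof (cases "p \<in> fin")
  case False
  then obtain i where i: "i \<in> {1..n}" "p = Vertex i" using p by (auto simp: pts_fin)
  have p': "p = chart (star n) i \<infinity>" by (simp add: chart_star i)
  have lim: "filterlim (\<lambda>t. h (ray i t)) (nhds (h p)) at_top"
    if "continuous_map topo euclidean h" for h :: "(nat, nat) point \<Rightarrow> ereal"
  proof -
    have "continuous_on {0..} (\<lambda>t. h (chart (star n) i t))"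
      using that i by (simp add: continuous_to_ereal_iff)
    then have "filterlim (\<lambda>t. h (chart (star n) i t)) (nhds (h p)) (at \<infinity> within {0..})"
      unfolding p' by (auto simp: continuous_on_def)
    moreover have "filterlim ereal (at \<infinity> within {0..}) at_top"
      unfolding filterlim_at
      using tendsto_PInfty_eq_at_top[of "\<lambda>t::real. t" at_top, THEN iffD2, OF filterlim_ident]
      by (auto intro: eventually_mono[OF eventually_ge_at_top[of 0]])
    ultimately have "filterlim (\<lambda>t. h (chart (star n) i (ereal t))) (nhds (h p)) at_top"
      by (rule filterlim_compose)
    then show ?thesis by (simp only: chart_ray)
  qed
  have "\<forall>\<^sub>F t in at_top. f (ray i t) = g (ray i t)"
    using eventually_ge_at_top[of 0] by eventually_elim (rule eq[OF ray_in_fin[OF i(1)]])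
  then have "filterlim (\<lambda>t. g (ray i t)) (nhds (f p)) at_top"
    using lim[OF f] by (rule Lim_transform_eventually[rotated])
  then show ?thesis using tendsto_unique[OF trivial_limit_at_top_linorder _ lim[OF g]] by auto
qed (rule eq)

end

section \<open>Rational functions on the star\<close>

lemma continuous_on_one_point_compactification:
  fixes h :: "real \<Rightarrow> real"
  assumes h: "continuous_on {0..} h" and L: "filterlim (\<lambda>t. ereal (h t)) (nhds L) at_top"
  shows "continuous_on {0..} (\<lambda>t. if t = \<infinity> then L else ereal (h (real_of_ereal t)))" (is "continuous_on _ ?f")
  unfolding continuous_on_def
proof
  fix x :: ereal assume x: "x \<in> {0..}"
  show "filterlim ?f (nhds (?f x)) (at x within {0..})"
  proof (cases "x = \<infinity>")
    case True
    have "at \<infinity> within {0..} \<le> at_left (\<infinity>::ereal)"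
      unfolding at_within_def by (intro inf_mono) auto
    moreover have "filterlim ?f (nhds L) (at_left \<infinity>)"
      unfolding at_left_PInf tendsto_compose_filtermap[symmetric] using L by (simp add: o_def)
    ultimately show ?thesis using True by (auto intro: tendsto_mono)
  next
    case False
    have "continuous_on {0..<\<infinity>} (\<lambda>t. ereal (h (real_of_ereal t)))"
      by (intro continuous_on_ereal continuous_on_compose2[OF h] continuous_on_subset[OF continuous_on_real])
        (auto simp: real_of_ereal_pos)
    then have "continuous_on {0..<\<infinity>} ?f" by (rule continuous_on_eq) auto
    then have "filterlim ?f (nhds (?f x)) (at x within {0..<\<infinity>})"
      using x False by (auto simp: continuous_on_def)
    moreover have "at x within {0..} = at x within {0..<\<infinity>}"
      by (rule at_within_nhd[of x "{..<\<infinity>}"]) (use False in auto)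
    ultimately show ?thesis by simp
  qed
qed

text \<open>The dilatation about the centre, on a star with any number of copies.\<close>

fun dil :: "real \<Rightarrow> (nat, nat) point \<Rightarrow> (nat, nat) point" where
  "dil r (Vertex v) = Vertex v"
| "dil r (Inner i t) = Inner i (ereal r * t)"

lemma dil_ray: "0 < r \<Longrightarrow> dil r (ray i t) = ray i (r * t)"
  by (simp add: ray_def)

definition leg_coord :: "nat \<Rightarrow> (nat, nat) point \<Rightarrow> real" where
  "leg_coord i p = (if leg p = i then radius p else 0)"

lemma leg_coord_ray: "leg_coord i (ray j t) = (if i = j then t else 0)"
  by (auto simp: leg_coord_def leg_ray)

context star_curve
begin

text \<open>Rational functions other than \<open>-\<infinity>\<close> are handled through their restrictions to the finite points,
  which are real-valued.\<close>

definition PL :: "((nat, nat) point \<Rightarrow> real) \<Rightarrow> bool" where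
  "PL k \<longleftrightarrow> (\<forall>i\<in>{1..n}. pl (\<lambda>t. k (ray i t)))"

lemma PL_const: "PL (\<lambda>p. c)" by (simp add: PL_def pl_const)
lemma PL_add: "PL k \<Longrightarrow> PL l \<Longrightarrow> PL (\<lambda>p. k p + l p)" by (simp add: PL_def pl_add)
lemma PL_uminus: "PL k \<Longrightarrow> PL (\<lambda>p. - k p)" by (simp add: PL_def pl_uminus)
lemma PL_max: "PL k \<Longrightarrow> PL l \<Longrightarrow> PL (\<lambda>p. max (k p) (l p))" by (simp add: PL_def pl_max)
lemma PL_diff: "PL k \<Longrightarrow> PL l \<Longrightarrow> PL (\<lambda>p. k p - l p)" by (simp add: PL_def pl_diff)
lemma PL_abs: "PL k \<Longrightarrow> PL (\<lambda>p. \<bar>k p\<bar>)" by (simp add: PL_def pl_abs)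

lemma PL_sum: "finite J \<Longrightarrow> (\<And>j. j \<in> J \<Longrightarrow> PL (k j)) \<Longrightarrow> PL (\<lambda>p. \<Sum>j\<in>J. k j p)"
  by (induction J rule: finite_induct) (simp_all add: PL_const PL_add)

lemma PL_cong:
  assumes "PL k" "\<And>p. p \<in> fin \<Longrightarrow> k p = l p"
  shows "PL l"
  unfolding PL_def
proof
  fix i assume i: "i \<in> {1..n}"
  then have "pl (\<lambda>t. k (ray i t))" using assms(1) by (simp add: PL_def)
  then show "pl (\<lambda>t. l (ray i t))" by (rule pl_cong) (rule assms(2)[OF ray_in_fin[OF i]])
qed

lemma PL_leg_coord: "PL (leg_coord i)"
proof -
  have "pl (\<lambda>t. if i = j then t else 0)" for j
    by (cases "i = j") (simp_all add: pl_ident pl_const)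
  then show ?thesis by (simp add: PL_def leg_coord_ray)
qed

lemma PL_star_dist:
  assumes "p \<in> fin"
  shows "PL (star_dist p)"
proof -
  obtain i s where i: "i \<in> {1..n}" "0 \<le> s" "p = ray i s" by (rule finE[OF assms]) (rule that)
  have "pl (\<lambda>t. star_dist p (ray j t))" for j
  proof (rule pl_cong)
    show "pl (\<lambda>t. if i = j then \<bar>s - t\<bar> else s + t)"
      by (cases "i = j") (simp_all add: pl_abs pl_diff pl_add pl_const pl_ident)
  qed (simp add: i star_dist_ray)
  then show ?thesis by (simp add: PL_def)
qed

lemma dil_in_fin: "0 < r \<Longrightarrow> p \<in> fin \<Longrightarrow> dil r p \<in> fin"
  by (elim finE) (simp add: dil_ray ray_in_fin)

lemma dil_dil: "0 < r \<Longrightarrow> 0 < s \<Longrightarrow> p \<in> fin \<Longrightarrow> dil r (dil s p) = dil (r * s) p"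
  by (elim finE) (simp add: dil_ray mult.assoc)

lemma dil_1: "p \<in> fin \<Longrightarrow> dil 1 p = p"
  by (elim finE) (simp add: dil_ray)

lemma dil_inverse: "0 < r \<Longrightarrow> p \<in> fin \<Longrightarrow> dil r (dil (1 / r) p) = p"
  "0 < r \<Longrightarrow> p \<in> fin \<Longrightarrow> dil (1 / r) (dil r p) = p"
  by (simp_all add: dil_dil dil_1)

lemma star_dist_dil:
  assumes "0 < r" "p \<in> fin" "q \<in> fin"
  shows "star_dist (dil r p) (dil r q) = r * star_dist p q"
proof -
  have "\<bar>r * s - r * t\<bar> = r * \<bar>s - t\<bar>" for s t
    using assms(1) by (simp add: abs_mult flip: right_diff_distrib)
  then show ?thesis using assms(2,3)
    by (elim finE) (use assms(1) in \<open>simp add: dil_ray star_dist_ray distrib_left\<close>)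
qed

lemma PL_dil: "0 < r \<Longrightarrow> PL k \<Longrightarrow> PL (\<lambda>p. r * k (dil (1 / r) p))"
  unfolding PL_def using pl_rescale by (auto simp: dil_ray)

lemma extend_eqI:
  assumes "f \<in> extensional pts" "continuous_map topo euclidean f" "\<And>p. p \<in> fin \<Longrightarrow> f p = h p"
  shows "extend_continuously (star n) h = f"
  unfolding extend_continuously_def
proof (rule the_equality)
  fix g assume "g \<in> extensional pts \<and> continuous_map topo euclidean g \<and> (\<forall>p\<in>fin. g p = h p)"
  then have g: "g \<in> extensional pts" "continuous_map topo euclidean g" "\<And>p. p \<in> fin \<Longrightarrow> g p = f p"
    using assms(3) by auto
  show "g = f"
    by (rule extensionalityI[OF g(1) assms(1)]) (rule continuous_eqI[OF g(2) assms(2) g(3)])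
qed (use assms in auto)

text \<open>The value at a point at infinity is the limit along its copy, which exists in \<open>[-\<infinity>, \<infinity>]\<close> because
  the function is eventually affine there.\<close>

lemma PL_extension:
  assumes "PL k"
  obtains f where "f \<in> extensional pts" "continuous_map topo euclidean f" "\<And>p. p \<in> fin \<Longrightarrow> f p = ereal (k p)"
proof -
  have "\<forall>i\<in>{1..n}. \<exists>L. filterlim (\<lambda>t. ereal (k (ray i t))) (nhds L) at_top"
  proof
    fix i assume "i \<in> {1..n}"
    then have "pl (\<lambda>t. k (ray i t))" using assms by (simp add: PL_def)
    then show "\<exists>L. filterlim (\<lambda>t. ereal (k (ray i t))) (nhds L) at_top"
      by (rule pl_limit_at_top) blast
  qed
  from bchoice[OF this]
  obtain L where L: "\<And>i. i \<in> {1..n} \<Longrightarrow> filterlim (\<lambda>t. ereal (k (ray i t))) (nhds (L i)) at_top"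
    by blast
  define f where "f = (\<lambda>p\<in>pts. if p \<in> fin then ereal (k p) else case p of Vertex i \<Rightarrow> L i | _ \<Rightarrow> 0)"
  have ffin: "f p = ereal (k p)" if "p \<in> fin" for p
    using that fin_subset_pts by (auto simp: f_def)
  have "Vertex i \<notin> fin" if "i \<in> {1..n}" for i
    using that infinite_points_eq by (auto simp: finite_points_def)
  then have finf: "f (Vertex i) = L i" if "i \<in> {1..n}" for i
    using that by (auto simp: f_def pts_fin)
  have "continuous_on {0..} (\<lambda>t. f (chart (star n) i t))" if i: "i \<in> {1..n}" for i
  proof -
    have "continuous_on {0..} (\<lambda>t. k (ray i t))" using assms i pl_continuous by (auto simp: PL_def)
    then have "continuous_on {0..} (\<lambda>t. if t = \<infinity> then L i else ereal (k (ray i (real_of_ereal t))))"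
      using L[OF i] by (rule continuous_on_one_point_compactification)
    then show ?thesis
    proof (rule continuous_on_eq)
      fix t :: ereal assume "t \<in> {0..}"
      then show "(if t = \<infinity> then L i else ereal (k (ray i (real_of_ereal t)))) = f (chart (star n) i t)"
        using finf[OF i] ffin ray_in_fin[OF i] by (cases t) (auto simp: chart_ray, simp add: chart_star)
    qed
  qed
  then have "continuous_map topo euclidean f" by (simp add: continuous_to_ereal_iff)
  then show ?thesis by (intro that[of f]) (auto simp: f_def ffin fin_subset_pts[THEN subsetD])
qed

definition rat :: "((nat, nat) point \<Rightarrow> real) \<Rightarrow> (nat, nat) point \<Rightarrow> ereal" where
  "rat k = extend_continuously (star n) (\<lambda>p. ereal (k p))"

lemma rat_extension:
  assumes "PL k"
  shows "rat k \<in> extensional pts" "continuous_map topo euclidean (rat k)" "\<And>p. p \<in> fin \<Longrightarrow> rat k p = ereal (k p)"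
proof -
  obtain f where f: "f \<in> extensional pts" "continuous_map topo euclidean f" "\<And>p. p \<in> fin \<Longrightarrow> f p = ereal (k p)"
    by (rule PL_extension[OF assms]) (rule that)
  then have "rat k = f" unfolding rat_def by (rule extend_eqI)
  with f show "rat k \<in> extensional pts" "continuous_map topo euclidean (rat k)" "\<And>p. p \<in> fin \<Longrightarrow> rat k p = ereal (k p)"
    by auto
qed

definition neg_inf :: "(nat, nat) point \<Rightarrow> ereal" where
  "neg_inf = (\<lambda>x\<in>pts. -\<infinity>)"

abbreviation R where "R \<equiv> Rat (star n)"

lemma neg_inf_continuous: "continuous_map topo euclidean neg_inf"
proof -
  have "continuous_map topo euclidean (\<lambda>x. -\<infinity> :: ereal)" by (rule continuous_map_const[THEN iffD2]) simp
  then show ?thesis by (rule continuous_map_eq) (simp add: topspace_star neg_inf_def)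
qed

lemma neg_inf_fin: "p \<in> fin \<Longrightarrow> neg_inf p = -\<infinity>"
  using fin_subset_pts by (auto simp: neg_inf_def)

lemma neg_inf_extensional: "neg_inf \<in> extensional pts"
  by (simp add: neg_inf_def)

lemma carrier_Rat: "carrier R = insert neg_inf {rat k | k. PL k}"
proof -
  have 1: "f \<in> {rat k | k. PL k}"
    if f: "f \<in> extensional pts" "continuous_map topo euclidean f" "\<And>p. p \<in> fin \<Longrightarrow> \<bar>f p\<bar> \<noteq> \<infinity>"
      "\<And>i. i \<in> {1..n} \<Longrightarrow> piecewise_affine \<infinity> (\<lambda>t. f (chart (star n) i t))" for f
  proof -
    define k where "k p = real_of_ereal (f p)" for p
    have k: "f p = ereal (k p)" if "p \<in> fin" for p using f(3)[OF that] by (auto simp: k_def ereal_real)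
    have "PL k" unfolding PL_def
    proof
      fix i assume i: "i \<in> {1..n}"
      have "continuous_on {0..} (\<lambda>t. f (chart (star n) i t))" using f(2) i by (simp add: continuous_to_ereal_iff)
      then have "continuous_on {0..} (\<lambda>t. f (chart (star n) i (ereal t)))"
        by (rule continuous_on_compose2) (auto intro!: continuous_on_ereal continuous_on_id)
      then have "continuous_on {0..} (\<lambda>t. ereal (k (ray i t)))"
        by (rule continuous_on_eq) (simp add: chart_ray k ray_in_fin[OF i])
      then have "continuous_on {0..} (\<lambda>t. real_of_ereal (ereal (k (ray i t))))"
        by (rule continuous_on_compose2[OF continuous_on_real]) auto
      then have "continuous_on {0..} (\<lambda>t. k (ray i t))" by simp
      then show "pl (\<lambda>t. k (ray i t))"
        by (rule piecewise_affine_imp_pl[OF _ _ f(4)[OF i]]) (simp add: chart_ray k ray_in_fin[OF i])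
    qed
    moreover have "f = rat k" unfolding rat_def using f(1,2) k by (intro extend_eqI[symmetric]) auto
    ultimately show ?thesis by blast
  qed
  have 2: "piecewise_affine \<infinity> (\<lambda>t. rat k (chart (star n) i t))" if "PL k" "i \<in> {1..n}" for k i
    using that by (intro pl_imp_piecewise_affine[of "\<lambda>t. k (ray i t)"])
      (simp_all add: PL_def chart_ray rat_extension ray_in_fin)
  show ?thesis
    unfolding Rat_def Rat_carrier_def
    using 1 2 rat_extension by (auto simp: neg_inf_def[symmetric])
qed

lemma Rat_cases [consumes 1, case_names neg_inf rat]:
  assumes "f \<in> carrier R"
  obtains "f = neg_inf" | k where "PL k" "f = rat k"
  using assms by (auto simp: carrier_Rat)

lemma zero_Rat: "\<zero>\<^bsub>R\<^esub> = neg_inf" by (simp add: Rat_def neg_inf_def)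

lemma neg_inf_in_Rat: "neg_inf \<in> carrier R" by (simp add: carrier_Rat)
lemma rat_in_Rat: "PL k \<Longrightarrow> rat k \<in> carrier R" by (auto simp: carrier_Rat)

lemma Rat_extensional_continuous:
  assumes "f \<in> carrier R"
  shows "f \<in> extensional pts" "continuous_map topo euclidean f"
  using assms by (cases rule: Rat_cases; simp add: rat_extension neg_inf_extensional neg_inf_continuous)+

lemma Rat_eqI:
  assumes "f \<in> carrier R" "g \<in> carrier R" "\<And>p. p \<in> fin \<Longrightarrow> f p = g p"
  shows "f = g"
proof (rule extensionalityI)
  fix p assume "p \<in> pts"
  then show "f p = g p"
    using continuous_eqI assms Rat_extensional_continuous(2) by blast
qed (use assms Rat_extensional_continuous(1) in auto)

lemma rat_eq_iff:
  assumes "PL k" "PL l"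
  shows "rat k = rat l \<longleftrightarrow> (\<forall>p\<in>fin. k p = l p)"
proof
  assume "rat k = rat l"
  then show "\<forall>p\<in>fin. k p = l p" using rat_extension(3) assms by (metis ereal.inject)
qed (use assms in \<open>auto intro!: Rat_eqI rat_in_Rat simp: rat_extension\<close>)

lemma rat_neq_neg_inf: "PL k \<Longrightarrow> rat k \<noteq> neg_inf"
  using rat_extension(3)[of k, OF _ center_in_fin] neg_inf_fin[OF center_in_fin] by auto

lemma one_Rat: "\<one>\<^bsub>R\<^esub> = rat (\<lambda>p. 0)"
proof -
  have "continuous_map topo euclidean (\<lambda>x. 0 :: ereal)" by simp
  then have c: "continuous_map topo euclidean (\<lambda>x\<in>pts. 0 :: ereal)"
    by (rule continuous_map_eq) (simp add: topspace_star)
  have "rat (\<lambda>p. 0) = (\<lambda>x\<in>pts. 0 :: ereal)"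
    unfolding rat_def by (rule extend_eqI[OF _ c]) (use fin_subset_pts in auto)
  then show ?thesis by (simp add: Rat_def)
qed

lemma mult_Rat_rat: "PL k \<Longrightarrow> PL l \<Longrightarrow> rat k \<otimes>\<^bsub>R\<^esub> rat l = rat (\<lambda>p. k p + l p)"
  unfolding Rat_def using rat_extension[OF PL_add] by (auto intro!: extend_eqI simp: rat_extension)

lemma add_Rat_rat: "PL k \<Longrightarrow> PL l \<Longrightarrow> rat k \<oplus>\<^bsub>R\<^esub> rat l = rat (\<lambda>p. max (k p) (l p))"
  unfolding Rat_def using rat_extension[OF PL_max] by (auto intro!: extend_eqI simp: rat_extension)

lemma mult_Rat:
  assumes "f \<in> carrier R" "g \<in> carrier R"
  shows "f \<otimes>\<^bsub>R\<^esub> g \<in> carrier R" "\<And>p. p \<in> fin \<Longrightarrow> (f \<otimes>\<^bsub>R\<^esub> g) p = f p + g p"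
proof -
  obtain h where h: "h \<in> carrier R" "\<And>p. p \<in> fin \<Longrightarrow> h p = f p + g p"
  proof (cases "f = neg_inf \<or> g = neg_inf")
    case True
    have "neg_inf p = f p + g p" if "p \<in> fin" for p
      using True assms that by (auto elim!: Rat_cases simp: neg_inf_fin rat_extension)
    with neg_inf_in_Rat show ?thesis by (rule that)
  next
    case False
    then obtain k l where "PL k" "f = rat k" "PL l" "g = rat l" using assms by (auto elim!: Rat_cases)
    then show ?thesis by (intro that[of "rat (\<lambda>p. k p + l p)"]) (simp_all add: rat_in_Rat PL_add rat_extension)
  qed
  have "f \<otimes>\<^bsub>R\<^esub> g = extend_continuously (star n) (\<lambda>p. f p + g p)" by (simp add: Rat_def)
  then have "f \<otimes>\<^bsub>R\<^esub> g = h" using extend_eqI[OF Rat_extensional_continuous[OF h(1)] h(2)] by simp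
  with h show "f \<otimes>\<^bsub>R\<^esub> g \<in> carrier R" "\<And>p. p \<in> fin \<Longrightarrow> (f \<otimes>\<^bsub>R\<^esub> g) p = f p + g p" by auto
qed

lemma add_Rat:
  assumes "f \<in> carrier R" "g \<in> carrier R"
  shows "f \<oplus>\<^bsub>R\<^esub> g \<in> carrier R" "\<And>p. p \<in> fin \<Longrightarrow> (f \<oplus>\<^bsub>R\<^esub> g) p = max (f p) (g p)"
proof -
  obtain h where h: "h \<in> carrier R" "\<And>p. p \<in> fin \<Longrightarrow> h p = max (f p) (g p)"
  proof -
    consider "f = neg_inf" | "g = neg_inf" | k l where "PL k" "f = rat k" "PL l" "g = rat l"
      using assms by (auto elim!: Rat_cases)
    then show ?thesis
    proof cases
      case 1
      then show ?thesis using assms(2) by (intro that[of g]) (auto simp: neg_inf_fin)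
    next
      case 2
      then show ?thesis using assms(1) by (intro that[of f]) (auto simp: neg_inf_fin)
    next
      case 3
      then show ?thesis
        by (intro that[of "rat (\<lambda>p. max (k p) (l p))"]) (simp_all add: rat_in_Rat PL_max rat_extension)
    qed
  qed
  have "f \<oplus>\<^bsub>R\<^esub> g = extend_continuously (star n) (\<lambda>p. max (f p) (g p))" by (simp add: Rat_def)
  then have "f \<oplus>\<^bsub>R\<^esub> g = h" using extend_eqI[OF Rat_extensional_continuous[OF h(1)] h(2)] by simp
  with h show "f \<oplus>\<^bsub>R\<^esub> g \<in> carrier R" "\<And>p. p \<in> fin \<Longrightarrow> (f \<oplus>\<^bsub>R\<^esub> g) p = max (f p) (g p)" by auto
qed

section \<open>Homomorphisms to the real numbers\<close>

lemma PL_scale: "PL k \<Longrightarrow> PL (\<lambda>p. real m * k p)"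
  using PL_sum[of "{..<m}" "\<lambda>_. k"] by simp

lemma PL_lipschitz:
  assumes "PL k"
  obtains N :: nat where "\<And>p q. p \<in> fin \<Longrightarrow> q \<in> fin \<Longrightarrow> \<bar>k p - k q\<bar> \<le> real N * star_dist p q"
proof -
  have "\<forall>i\<in>{1..n}. \<exists>N::nat. \<forall>s t. 0 \<le> s \<longrightarrow> 0 \<le> t \<longrightarrow> \<bar>k (ray i s) - k (ray i t)\<bar> \<le> real N * \<bar>s - t\<bar>"
  proof
    fix i assume "i \<in> {1..n}"
    then have "pl (\<lambda>t. k (ray i t))" using assms by (simp add: PL_def)
    then show "\<exists>N::nat. \<forall>s t. 0 \<le> s \<longrightarrow> 0 \<le> t \<longrightarrow> \<bar>k (ray i s) - k (ray i t)\<bar> \<le> real N * \<bar>s - t\<bar>"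
      by (rule pl_lipschitz) blast
  qed
  from bchoice[OF this] obtain N :: "nat \<Rightarrow> nat" where N: "\<And>i s t. i \<in> {1..n} \<Longrightarrow> 0 \<le> s \<Longrightarrow> 0 \<le> t \<Longrightarrow>
      \<bar>k (ray i s) - k (ray i t)\<bar> \<le> real (N i) * \<bar>s - t\<bar>"
    by blast
  define M where "M = (\<Sum>i\<in>{1..n}. N i)"
  have M: "\<bar>k (ray i s) - k (ray i t)\<bar> \<le> real M * \<bar>s - t\<bar>" if "i \<in> {1..n}" "0 \<le> s" "0 \<le> t" for i s t
  proof -
    have "N i \<le> M" unfolding M_def using that(1) by (intro member_le_sum) auto
    then have "real (N i) * \<bar>s - t\<bar> \<le> real M * \<bar>s - t\<bar>" by (intro mult_right_mono) auto
    then show ?thesis using N[OF that] by linarith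
  qed
  show ?thesis
  proof (rule that[of M])
    fix p q assume "p \<in> fin" "q \<in> fin"
    then obtain i s j t where ij: "i \<in> {1..n}" "0 \<le> s" "p = ray i s" "j \<in> {1..n}" "0 \<le> t" "q = ray j t"
      by (elim finE)
    show "\<bar>k p - k q\<bar> \<le> real M * star_dist p q"
    proof (cases "i = j")
      case True
      then show ?thesis using M[of i s t] ij by (simp add: star_dist_ray)
    next
      case False
      have "\<bar>k p - k q\<bar> \<le> \<bar>k p - k (Vertex 0)\<bar> + \<bar>k q - k (Vertex 0)\<bar>" by simp
      also have "\<dots> \<le> real M * s + real M * t"
        using M[of i s 0] M[of j t 0] ij by (intro add_mono) auto
      finally show ?thesis using False ij by (simp add: star_dist_ray distrib_left)
    qed
  qed
qed

text \<open>The heart of the matter: the value of \<open>\<eta>\<close> at the coordinates of the copies determines a point \<open>p\<close>,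
  because the minimum of two coordinates is \<open>0\<close> and hence at most one of these values is nonzero. The
  distance function of \<open>p\<close> is a combination of coordinates and is therefore sent to \<open>0\<close>, and a rational
  function deviates from its value at \<open>p\<close> by at most a multiple of that distance.\<close>

lemma real_hom_is_evaluation:
  fixes \<eta> :: "((nat, nat) point \<Rightarrow> real) \<Rightarrow> real"
  assumes add: "\<And>k l. PL k \<Longrightarrow> PL l \<Longrightarrow> \<eta> (\<lambda>p. k p + l p) = \<eta> k + \<eta> l"
    and max: "\<And>k l. PL k \<Longrightarrow> PL l \<Longrightarrow> \<eta> (\<lambda>p. max (k p) (l p)) = max (\<eta> k) (\<eta> l)"
    and const: "\<And>c. \<eta> (\<lambda>p. c) = c"
    and cong: "\<And>k l. PL k \<Longrightarrow> PL l \<Longrightarrow> (\<And>p. p \<in> fin \<Longrightarrow> k p = l p) \<Longrightarrow> \<eta> k = \<eta> l"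
  obtains p where "p \<in> fin" "\<And>k. PL k \<Longrightarrow> \<eta> k = k p"
proof -
  have uminus: "\<eta> (\<lambda>p. - k p) = - \<eta> k" if "PL k" for k
    using add[OF that PL_uminus[OF that]] const[of 0] by simp
  have diff: "\<eta> (\<lambda>p. k p - l p) = \<eta> k - \<eta> l" if "PL k" "PL l" for k l
    using add[OF that(1) PL_uminus[OF that(2)]] uminus[OF that(2)] by simp
  have abs: "\<eta> (\<lambda>p. \<bar>k p\<bar>) = \<bar>\<eta> k\<bar>" if "PL k" for k
  proof -
    have "\<eta> (\<lambda>p. \<bar>k p\<bar>) = \<eta> (\<lambda>p. max (k p) (- k p))"
      by (intro cong PL_abs PL_max PL_uminus that) auto
    also have "\<dots> = \<bar>\<eta> k\<bar>" using max[OF that PL_uminus[OF that]] uminus[OF that] by auto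
    finally show ?thesis .
  qed
  have mono: "\<eta> k \<le> \<eta> l" if "PL k" "PL l" "\<And>p. p \<in> fin \<Longrightarrow> k p \<le> l p" for k l
  proof -
    have "\<eta> l = \<eta> (\<lambda>p. max (k p) (l p))" using that by (intro cong PL_max) (auto simp: max_absorb2)
    then show ?thesis using max[OF that(1,2)] by linarith
  qed
  have sum: "\<eta> (\<lambda>p. \<Sum>j\<in>J. k j p) = (\<Sum>j\<in>J. \<eta> (k j))"
    if "finite J" "\<And>j. j \<in> J \<Longrightarrow> PL (k j)" for k and J :: "nat set"
    using that by (induction J rule: finite_induct) (simp_all add: const add PL_sum)
  have nonneg: "0 \<le> \<eta> (leg_coord i)" for i
  proof -
    have "\<eta> (\<lambda>p. 0) \<le> \<eta> (leg_coord i)"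
      by (rule mono[OF PL_const PL_leg_coord]) (auto elim!: finE simp: leg_coord_ray)
    then show ?thesis by (simp add: const)
  qed
  have disjoint: "\<eta> (leg_coord i) = 0 \<or> \<eta> (leg_coord j) = 0" if "i \<noteq> j" for i j
  proof -
    have "\<eta> (\<lambda>p. max (- leg_coord i p) (- leg_coord j p)) = \<eta> (\<lambda>p. 0)"
      by (intro cong PL_max PL_uminus PL_leg_coord PL_const) (use that in \<open>auto elim!: finE simp: leg_coord_ray\<close>)
    then have "max (- \<eta> (leg_coord i)) (- \<eta> (leg_coord j)) = 0"
      using max[OF PL_uminus PL_uminus, OF PL_leg_coord PL_leg_coord] by (simp add: uminus PL_leg_coord const)
    then show ?thesis by linarith
  qed
  \<comment> \<open>If all coordinates are sent to \<open>0\<close>, the point is the centre and any copy may be chosen.\<close>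
  obtain i where i: "i \<in> {1..n}" and others: "\<And>j. j \<in> {1..n} \<Longrightarrow> j \<noteq> i \<Longrightarrow> \<eta> (leg_coord j) = 0"
  proof (cases "\<exists>i\<in>{1..n}. \<eta> (leg_coord i) \<noteq> 0")
    case True
    then obtain i where "i \<in> {1..n}" "\<eta> (leg_coord i) \<noteq> 0" by blast
    then show ?thesis using disjoint by (intro that[of i]) auto
  next
    case False
    then show ?thesis using n_pos by (intro that[of 1]) auto
  qed
  define a where "a = \<eta> (leg_coord i)"
  have a: "0 \<le> a" using nonneg by (simp add: a_def)
  define p where "p = ray i a"
  have p: "p \<in> fin" using i a by (simp add: p_def ray_in_fin)
  define D where "D q = \<bar>leg_coord i q - a\<bar> + (\<Sum>j\<in>{1..n} - {i}. leg_coord j q)" for q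
  have D1: "PL (\<lambda>q. \<bar>leg_coord i q - a\<bar>)" by (intro PL_abs PL_diff PL_leg_coord PL_const)
  have D2: "PL (\<lambda>q. \<Sum>j\<in>{1..n} - {i}. leg_coord j q)" by (intro PL_sum PL_leg_coord) auto
  have "star_dist p q = D q" if "q \<in> fin" for q
  proof -
    obtain j t where j: "j \<in> {1..n}" "0 \<le> t" "q = ray j t" by (rule finE[OF \<open>q \<in> fin\<close>]) (rule that)
    have "(\<Sum>l\<in>{1..n} - {i}. leg_coord l q) = (\<Sum>l\<in>{1..n} - {i}. if l = j then t else 0)"
      by (simp add: j leg_coord_ray)
    also have "\<dots> = (if j = i then 0 else t)" using j by (subst sum.delta) auto
    finally show ?thesis using a j by (auto simp: D_def p_def star_dist_ray leg_coord_ray)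
  qed
  then have "\<eta> (star_dist p) = \<eta> D"
    unfolding D_def using D1 D2 by (intro cong PL_star_dist p PL_add) (auto simp: D_def)
  also have "\<dots> = \<eta> (\<lambda>q. \<bar>leg_coord i q - a\<bar>) + (\<Sum>j\<in>{1..n} - {i}. \<eta> (leg_coord j))"
    unfolding D_def using sum[of "{1..n} - {i}" leg_coord] add[OF D1 D2] by (simp add: PL_leg_coord)
  also have "\<eta> (\<lambda>q. \<bar>leg_coord i q - a\<bar>) = 0"
    by (simp add: abs diff PL_diff PL_leg_coord PL_const const a_def)
  also have "(\<Sum>j\<in>{1..n} - {i}. \<eta> (leg_coord j)) = 0" using others by (intro sum.neutral) auto
  finally have dist0: "\<eta> (star_dist p) = 0" by simp
  have "\<eta> k = k p" if k: "PL k" for k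
  proof -
    obtain N :: nat where N: "\<And>x y. x \<in> fin \<Longrightarrow> y \<in> fin \<Longrightarrow> \<bar>k x - k y\<bar> \<le> real N * star_dist x y"
      by (rule PL_lipschitz[OF k]) (rule that)
    have "\<bar>\<eta> k - k p\<bar> = \<eta> (\<lambda>q. \<bar>k q - k p\<bar>)"
      by (simp add: abs diff PL_diff k PL_const const)
    also have "\<dots> \<le> \<eta> (\<lambda>q. real N * star_dist p q)"
    proof (intro mono PL_abs PL_diff k PL_const PL_scale PL_star_dist p)
      fix q assume "q \<in> fin"
      then show "\<bar>k q - k p\<bar> \<le> real N * star_dist p q" using N[OF p, of q] by (simp add: abs_minus_commute)
    qed
    also have "\<dots> = \<eta> (\<lambda>q. \<Sum>j<N. star_dist p q)" by simp
    also have "\<dots> = 0" by (subst sum) (auto simp: PL_star_dist p dist0)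
    finally show ?thesis by simp
  qed
  with p show ?thesis by (rule that)
qed

section \<open>Bijections that respect piecewise affine functions\<close>

lemma PL_lower_bound:
  assumes g: "PL g" "\<And>q. q \<in> fin \<Longrightarrow> 0 \<le> g q" "\<And>q. q \<in> fin \<Longrightarrow> g q = 0 \<Longrightarrow> q = p" and p: "p \<in> fin"
  obtains c where "0 < c" "\<And>q. q \<in> fin \<Longrightarrow> min (star_dist p q) c \<le> g q"
proof -
  obtain i a where i: "i \<in> {1..n}" "0 \<le> a" "p = ray i a" by (rule finE[OF p]) (rule that)
  \<comment> \<open>On the other copies \<open>p\<close> looks like the point with coordinate \<open>- a\<close>.\<close>
  have dist: "star_dist p (ray j t) = \<bar>t - (if j = i then a else - a)\<bar>" if "0 \<le> t" for j t
    using i that by (auto simp: star_dist_ray)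
  have "\<forall>j\<in>{1..n}. \<exists>c>0. \<forall>t\<ge>0. min (star_dist p (ray j t)) c \<le> g (ray j t)"
  proof
    fix j assume j: "j \<in> {1..n}"
    have "pl (\<lambda>t. g (ray j t))" using g(1) j by (simp add: PL_def)
    then obtain c where "0 < c" "\<And>t. 0 \<le> t \<Longrightarrow> min \<bar>t - (if j = i then a else - a)\<bar> c \<le> g (ray j t)"
    proof (rule pl_lower_bound[where a = "if j = i then a else - a"])
      fix t :: real assume t: "0 \<le> t"
      show "0 \<le> g (ray j t)" using g(2) ray_in_fin[OF j t] .
      assume "g (ray j t) = 0"
      then have "ray j t = ray i a" using g(3)[OF ray_in_fin[OF j t]] i by simp
      then show "t = (if j = i then a else - a)" by (auto simp: ray_eq_iff)
    qed (rule that)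
    then show "\<exists>c>0. \<forall>t\<ge>0. min (star_dist p (ray j t)) c \<le> g (ray j t)" using dist by auto
  qed
  from bchoice[OF this] obtain c where c: "\<And>j. j \<in> {1..n} \<Longrightarrow> 0 < c j"
      "\<And>j t. j \<in> {1..n} \<Longrightarrow> 0 \<le> t \<Longrightarrow> min (star_dist p (ray j t)) (c j) \<le> g (ray j t)"
    by blast
  show ?thesis
  proof (rule that[of "Min (c ` {1..n})"])
    show "0 < Min (c ` {1..n})" using c(1) i(1) by (subst Min_gr_iff) auto
    fix q assume "q \<in> fin"
    then obtain j t where j: "j \<in> {1..n}" "0 \<le> t" "q = ray j t" by (elim finE)
    have "Min (c ` {1..n}) \<le> c j" using j(1) by (intro Min_le) auto
    then show "min (star_dist p q) (Min (c ` {1..n})) \<le> g q" using c(2)[OF j(1,2)] j(3) by auto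
  qed
qed

text \<open>The distance to \<open>y\<close>, transported by \<open>\<psi>\<close>, vanishes at \<open>\<psi> y\<close> only and has integer slopes, so it
  dominates the distance to \<open>\<psi> y\<close> nearby. Hence \<open>\<psi>\<close> does not increase small distances from \<open>y\<close>, and
  by subdividing segments it does not increase any distance.\<close>

lemma nonexpanding:
  assumes maps: "\<And>p. p \<in> fin \<Longrightarrow> \<psi> p \<in> fin" "\<And>p. p \<in> fin \<Longrightarrow> \<psi>' p \<in> fin"
    and inv: "\<And>p. p \<in> fin \<Longrightarrow> \<psi>' (\<psi> p) = p" "\<And>p. p \<in> fin \<Longrightarrow> \<psi> (\<psi>' p) = p"
    and PL: "\<And>y. y \<in> fin \<Longrightarrow> PL (\<lambda>p. star_dist y (\<psi>' p))"
    and xy: "x \<in> fin" "y \<in> fin"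
  shows "star_dist (\<psi> x) (\<psi> y) \<le> star_dist x y"
proof -
  have "\<exists>c>0. \<forall>z\<in>fin. star_dist y z < c \<longrightarrow> star_dist (\<psi> y) (\<psi> z) \<le> star_dist y z" if y: "y \<in> fin" for y
  proof -
    have 1: "0 \<le> star_dist y (\<psi>' q)" if "q \<in> fin" for q
      using that y maps by (simp add: star_dist_nonneg)
    have 2: "q = \<psi> y" if "q \<in> fin" "star_dist y (\<psi>' q) = 0" for q
      using that y maps inv star_dist_eq_0_iff by metis
    obtain c where c: "0 < c" "\<And>q. q \<in> fin \<Longrightarrow> min (star_dist (\<psi> y) q) c \<le> star_dist y (\<psi>' q)"
      by (rule PL_lower_bound[OF PL[OF y] 1 2 maps(1)[OF y]]) (assumption | rule that)+
    have "star_dist (\<psi> y) (\<psi> z) \<le> star_dist y z" if "z \<in> fin" "star_dist y z < c" for z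
      using c(2)[of "\<psi> z"] that maps inv by auto
    with c(1) show ?thesis by blast
  qed
  note loc = this
  have ray: "star_dist (\<psi> (ray i u)) (\<psi> (ray i v)) \<le> v - u" if i: "i \<in> {1..n}" and uv: "0 \<le> u" "u \<le> v" for i u v
  proof -
    have "0 \<le> u \<longrightarrow> star_dist (\<psi> (ray i u)) (\<psi> (ray i v)) \<le> v - u"
    proof (rule Bolzano[OF uv(2), of "\<lambda>u v. 0 \<le> u \<longrightarrow> star_dist (\<psi> (ray i u)) (\<psi> (ray i v)) \<le> v - u"])
      fix a b c :: real
      assume 1: "0 \<le> a \<longrightarrow> star_dist (\<psi> (ray i a)) (\<psi> (ray i b)) \<le> b - a"
        "0 \<le> b \<longrightarrow> star_dist (\<psi> (ray i b)) (\<psi> (ray i c)) \<le> c - b" "a \<le> b" "b \<le> c"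
      show "0 \<le> a \<longrightarrow> star_dist (\<psi> (ray i a)) (\<psi> (ray i c)) \<le> c - a"
      proof
        assume "0 \<le> a"
        with 1 have "star_dist (\<psi> (ray i a)) (\<psi> (ray i c)) \<le>
            star_dist (\<psi> (ray i a)) (\<psi> (ray i b)) + star_dist (\<psi> (ray i b)) (\<psi> (ray i c))"
          by (intro star_dist_triangle maps ray_in_fin i) auto
        with 1 \<open>0 \<le> a\<close> show "star_dist (\<psi> (ray i a)) (\<psi> (ray i c)) \<le> c - a" by auto
      qed
    next
      fix w assume "u \<le> w" "w \<le> v"
      then have w: "0 \<le> w" using uv by simp
      obtain c where c: "0 < c" "\<And>z. z \<in> fin \<Longrightarrow> star_dist (ray i w) z < c \<Longrightarrow>
          star_dist (\<psi> (ray i w)) (\<psi> z) \<le> star_dist (ray i w) z"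
        using loc[OF ray_in_fin[OF i w]] by blast
      have "star_dist (\<psi> (ray i a)) (\<psi> (ray i b)) \<le> b - a"
        if ab: "0 \<le> a" "a \<le> w" "w \<le> b" "b - a < c" for a b
      proof -
        have "star_dist (\<psi> (ray i a)) (\<psi> (ray i b)) \<le>
            star_dist (\<psi> (ray i w)) (\<psi> (ray i a)) + star_dist (\<psi> (ray i w)) (\<psi> (ray i b))"
          using star_dist_triangle[of "\<psi> (ray i a)" "\<psi> (ray i w)" "\<psi> (ray i b)"] ab w
          by (simp add: maps ray_in_fin[OF i] star_dist_commute[of "\<psi> (ray i a)"])
        also have "\<dots> \<le> (w - a) + (b - w)"
          using c(2)[of "ray i a"] c(2)[of "ray i b"] ab w
          by (intro add_mono) (auto simp: ray_in_fin[OF i] star_dist_ray)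
        finally show ?thesis by simp
      qed
      with c(1) show "\<exists>d>0. \<forall>a b. a \<le> w \<and> w \<le> b \<and> b - a < d \<longrightarrow> 0 \<le> a \<longrightarrow>
          star_dist (\<psi> (ray i a)) (\<psi> (ray i b)) \<le> b - a" by blast
    qed
    with uv show ?thesis by simp
  qed
  obtain i s where i: "i \<in> {1..n}" "0 \<le> s" "x = ray i s" by (rule finE[OF xy(1)]) (rule that)
  obtain j t where j: "j \<in> {1..n}" "0 \<le> t" "y = ray j t" by (rule finE[OF xy(2)]) (rule that)
  show ?thesis
  proof (cases "i = j")
    case True
    then show ?thesis
      using ray[OF i(1), of s t] ray[OF i(1), of t s] i j star_dist_commute[of "\<psi> x" "\<psi> y"]
      by (cases "s \<le> t") (auto simp: star_dist_ray)
  next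
    case False
    have "star_dist (\<psi> x) (\<psi> y) \<le> star_dist (\<psi> x) (\<psi> (Vertex 0)) + star_dist (\<psi> (Vertex 0)) (\<psi> y)"
      by (intro star_dist_triangle maps xy center_in_fin)
    also have "\<dots> \<le> s + t"
      using ray[OF i(1) order_refl i(2)] ray[OF j(1) order_refl j(2)] i(3) j(3)
        star_dist_commute[of "\<psi> x" "\<psi> (Vertex 0)"] by simp
    finally show ?thesis using False i j by (simp add: star_dist_ray)
  qed
qed

end

section \<open>Semiring automorphisms are similarities\<close>

text \<open>For every \<open>m\<close>, the number \<open>m x\<close> lies between two consecutive integers, on which \<open>f\<close> is multiplication by
  \<open>f 1\<close>. So \<open>f x\<close> and \<open>f 1 * x\<close> differ by at most \<open>f 1 / m\<close>.\<close>

lemma additive_mono_imp_linear: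
  fixes f :: "real \<Rightarrow> real"
  assumes add: "\<And>x y. f (x + y) = f x + f y" and mono: "\<And>x y. x \<le> y \<Longrightarrow> f x \<le> f y"
  shows "f x = f 1 * x"
proof -
  have f0: "f 0 = 0" using add[of 0 0] by simp
  have fm: "f (- x) = - f x" for x using add[of x "- x"] f0 by simp
  have nat: "f (real m * x) = real m * f x" for m x
    by (induction m) (simp_all add: f0 add distrib_right)
  have int: "f (of_int z) = of_int z * f 1" for z
    using nat[of "nat z" 1] nat[of "nat (- z)" 1] fm[of "of_int z"] by (cases "0 \<le> z") auto
  have f1: "0 \<le> f 1" using mono[of 0 1] f0 by simp
  have bound: "real m * \<bar>f x - f 1 * x\<bar> \<le> f 1" for m
  proof -
    let ?z = "\<lfloor>real m * x\<rfloor>"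
    have "of_int ?z \<le> real m * x" "real m * x \<le> of_int (?z + 1)" by linarith+
    from mono[OF this(1)] mono[OF this(2)] have 1: "of_int ?z * f 1 \<le> real m * f x" "real m * f x \<le> of_int (?z + 1) * f 1"
      using nat[of m x] int[of ?z] int[of "?z + 1"] by simp_all
    have 2: "of_int ?z * f 1 \<le> real m * x * f 1" "real m * x * f 1 \<le> of_int (?z + 1) * f 1"
      using f1 by (intro mult_right_mono; linarith)+
    have "\<bar>real m * f x - real m * x * f 1\<bar> \<le> f 1"
      using 1 2 by (simp add: distrib_right abs_le_iff)
    moreover have "real m * f x - real m * x * f 1 = real m * (f x - f 1 * x)" by (simp add: algebra_simps)
    ultimately show ?thesis by (simp add: abs_mult)
  qed
  show ?thesis
  proof (rule ccontr)
    assume "f x \<noteq> f 1 * x"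
    then have "0 < \<bar>f x - f 1 * x\<bar>" by simp
    then obtain m :: nat where "f 1 < real m * \<bar>f x - f 1 * x\<bar>" by (rule reals_Archimedean3[THEN spec, THEN exE])
    with bound[of m] show False by simp
  qed
qed

context star_curve
begin

abbreviation A where "A \<equiv> Aut_semiring (Rat (star n))"

lemma carrier_Aut_semiring:
  "carrier A = {\<Phi> \<in> ring_hom R R. \<Phi> \<in> extensional (carrier R) \<and> \<Phi> neg_inf = neg_inf \<and>
     bij_betw \<Phi> (carrier R) (carrier R)}"
  by (simp add: Aut_semiring_def composition_group_def zero_Rat)

lemma Aut_semiring_inverse:
  assumes \<Phi>: "\<Phi> \<in> carrier A"
  obtains \<Psi> where "\<Psi> \<in> carrier A" "\<And>f. f \<in> carrier R \<Longrightarrow> \<Psi> (\<Phi> f) = f" "\<And>f. f \<in> carrier R \<Longrightarrow> \<Phi> (\<Psi> f) = f"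
proof -
  have bij: "bij_betw \<Phi> (carrier R) (carrier R)" and hom: "\<Phi> \<in> ring_hom R R"
    and zero: "\<Phi> neg_inf = neg_inf" using \<Phi> by (auto simp: carrier_Aut_semiring)
  define \<Psi> where "\<Psi> = (\<lambda>f\<in>carrier R. inv_into (carrier R) \<Phi> f)"
  have \<Psi>\<Phi>: "\<Psi> (\<Phi> f) = f" if "f \<in> carrier R" for f
    using that bij bij_betw_apply[OF bij] by (auto simp: \<Psi>_def bij_betw_def inv_into_f_f)
  have \<Phi>\<Psi>: "\<Phi> (\<Psi> f) = f" if "f \<in> carrier R" for f
    using that bij by (auto simp: \<Psi>_def bij_betw_def f_inv_into_f)
  have \<Psi>in: "\<Psi> f \<in> carrier R" if "f \<in> carrier R" for f
    using that bij by (auto simp: \<Psi>_def bij_betw_def inv_into_into)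
  have one: "\<one>\<^bsub>R\<^esub> \<in> carrier R" by (simp add: one_Rat rat_in_Rat PL_const)
  have "\<Psi> \<in> ring_hom R R"
  proof (rule ring_hom_memI)
    fix f g assume fg: "f \<in> carrier R" "g \<in> carrier R"
    have "\<Phi> (\<Psi> f \<otimes>\<^bsub>R\<^esub> \<Psi> g) = f \<otimes>\<^bsub>R\<^esub> g"
      using ring_hom_mult[OF hom, of "\<Psi> f" "\<Psi> g"] fg by (simp add: \<Psi>in \<Phi>\<Psi>)
    then show "\<Psi> (f \<otimes>\<^bsub>R\<^esub> g) = \<Psi> f \<otimes>\<^bsub>R\<^esub> \<Psi> g"
      using \<Psi>\<Phi>[of "\<Psi> f \<otimes>\<^bsub>R\<^esub> \<Psi> g"] mult_Rat(1)[of "\<Psi> f" "\<Psi> g"] \<Psi>in fg by simp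
    have "\<Phi> (\<Psi> f \<oplus>\<^bsub>R\<^esub> \<Psi> g) = f \<oplus>\<^bsub>R\<^esub> g"
      using ring_hom_add[OF hom, of "\<Psi> f" "\<Psi> g"] fg by (simp add: \<Psi>in \<Phi>\<Psi>)
    then show "\<Psi> (f \<oplus>\<^bsub>R\<^esub> g) = \<Psi> f \<oplus>\<^bsub>R\<^esub> \<Psi> g"
      using \<Psi>\<Phi>[of "\<Psi> f \<oplus>\<^bsub>R\<^esub> \<Psi> g"] add_Rat(1)[of "\<Psi> f" "\<Psi> g"] \<Psi>in fg by simp
  next
    show "\<Psi> \<one>\<^bsub>R\<^esub> = \<one>\<^bsub>R\<^esub>" using \<Psi>\<Phi>[OF one] ring_hom_one[OF hom] by simp
  qed (rule \<Psi>in)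
  moreover have "\<Psi> neg_inf = neg_inf" using \<Psi>\<Phi>[OF neg_inf_in_Rat] zero by simp
  moreover have "bij_betw \<Psi> (carrier R) (carrier R)"
    by (rule bij_betw_byWitness[of _ \<Phi>]) (use \<Psi>\<Phi> \<Phi>\<Psi> \<Psi>in bij_betw_apply[OF bij] in auto)
  ultimately have "\<Psi> \<in> carrier A" by (simp add: carrier_Aut_semiring \<Psi>_def)
  then show ?thesis using \<Psi>\<Phi> \<Phi>\<Psi> by (rule that)
qed

text \<open>Constants are the infinitely divisible rational functions, since slopes are integers. An
  automorphism therefore permutes them, as a monotone additive map, that is, by a scaling. After
  rescaling, evaluation at a point is a homomorphism to the real numbers that fixes all constants.\<close>

lemma Aut_semiring_pullback:
  assumes \<Phi>: "\<Phi> \<in> carrier A"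
  obtains r \<psi> where "0 < r" "\<And>p. p \<in> fin \<Longrightarrow> \<psi> p \<in> fin"
    "\<And>k. PL k \<Longrightarrow> \<Phi> (rat k) = rat (\<lambda>p. r * k (\<psi> p)) \<and> PL (\<lambda>p. r * k (\<psi> p))"
proof -
  have inj: "inj_on \<Phi> (carrier R)" and into: "\<And>f. f \<in> carrier R \<Longrightarrow> \<Phi> f \<in> carrier R"
    and hom: "\<Phi> \<in> ring_hom R R" and zero: "\<Phi> neg_inf = neg_inf"
    using \<Phi> by (auto simp: carrier_Aut_semiring bij_betw_def)
  have "\<forall>k. \<exists>l. PL k \<longrightarrow> PL l \<and> \<Phi> (rat k) = rat l"
  proof (intro allI)
    fix k
    show "\<exists>l. PL k \<longrightarrow> PL l \<and> \<Phi> (rat k) = rat l"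
    proof (cases "PL k")
      case True
      have "\<Phi> (rat k) \<noteq> neg_inf"
        using inj_onD[OF inj, of "rat k" neg_inf] zero rat_neq_neg_inf[OF True] neg_inf_in_Rat rat_in_Rat[OF True]
        by auto
      with into[OF rat_in_Rat[OF True]] show ?thesis by (auto elim: Rat_cases)
    qed auto
  qed
  from choice[OF this] obtain \<phi> where \<phi>: "\<And>k. PL k \<Longrightarrow> PL (\<phi> k)" "\<And>k. PL k \<Longrightarrow> \<Phi> (rat k) = rat (\<phi> k)"
    by blast
  have add: "\<phi> (\<lambda>p. k p + l p) q = \<phi> k q + \<phi> l q" if "PL k" "PL l" "q \<in> fin" for k l q
  proof -
    have "rat (\<phi> (\<lambda>p. k p + l p)) = rat (\<lambda>p. \<phi> k p + \<phi> l p)"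
      using ring_hom_mult[OF hom, of "rat k" "rat l"] that
      by (simp add: rat_in_Rat mult_Rat_rat \<phi> PL_add)
    then show ?thesis using that by (simp add: rat_eq_iff \<phi> PL_add)
  qed
  have max: "\<phi> (\<lambda>p. max (k p) (l p)) q = max (\<phi> k q) (\<phi> l q)" if "PL k" "PL l" "q \<in> fin" for k l q
  proof -
    have "rat (\<phi> (\<lambda>p. max (k p) (l p))) = rat (\<lambda>p. max (\<phi> k p) (\<phi> l p))"
      using ring_hom_add[OF hom, of "rat k" "rat l"] that
      by (simp add: rat_in_Rat add_Rat_rat \<phi> PL_max)
    then show ?thesis using that by (simp add: rat_eq_iff \<phi> PL_max)
  qed
  have cong: "\<phi> k q = \<phi> l q" if "PL k" "PL l" "\<And>p. p \<in> fin \<Longrightarrow> k p = l p" "q \<in> fin" for k l q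
    using that \<phi> rat_eq_iff by metis
  have \<phi>0: "\<phi> (\<lambda>p. 0) q = 0" if "q \<in> fin" for q
    using add[of "\<lambda>p. 0" "\<lambda>p. 0" q] that by (simp add: PL_const)
  have mult: "\<phi> (\<lambda>p. real m * d) q = real m * \<phi> (\<lambda>p. d) q" if q: "q \<in> fin" for m d q
  proof (induction m)
    case (Suc m)
    have "\<phi> (\<lambda>p. real (Suc m) * d) q = \<phi> (\<lambda>p. real m * d + d) q"
      by (intro cong PL_const q) (simp add: algebra_simps)
    then show ?case using Suc add[OF PL_const PL_const q] by (simp add: algebra_simps)
  qed (simp add: \<phi>0 q)
  define \<rho> where "\<rho> c = \<phi> (\<lambda>p. c) (Vertex 0)" for c
  have \<rho>: "\<phi> (\<lambda>p. c) q = \<rho> c" if q: "q \<in> fin" for c q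
  proof -
    obtain i t where i: "i \<in> {1..n}" "0 \<le> t" "q = ray i t" by (rule finE[OF q]) (rule that)
    have "\<phi> (\<lambda>p. c) (ray i t) = \<phi> (\<lambda>p. c) (ray i 0)"
    proof (rule pl_divisible_imp_const[OF _ _ i(2)])
      show "pl (\<lambda>t. \<phi> (\<lambda>p. c) (ray i t))" using \<phi>(1)[OF PL_const] i(1) by (simp add: PL_def)
      fix m :: nat assume "0 < m"
      then have "\<phi> (\<lambda>p. c) (ray i t) = real m * \<phi> (\<lambda>p. c / real m) (ray i t)" if "0 \<le> t" for t
        using mult[OF ray_in_fin[OF i(1) that], of m "c / real m"] by simp
      moreover have "pl (\<lambda>t. \<phi> (\<lambda>p. c / real m) (ray i t))" using \<phi>(1)[OF PL_const] i(1) by (simp add: PL_def)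
      ultimately show "\<exists>g. pl g \<and> (\<forall>t\<ge>0. \<phi> (\<lambda>p. c) (ray i t) = real m * g t)" by blast
    qed
    then show ?thesis using i(3) by (simp add: \<rho>_def)
  qed
  define r where "r = \<rho> 1"
  have \<rho>lin: "\<rho> c = r * c" for c
    unfolding r_def
  proof (rule additive_mono_imp_linear)
    show "\<rho> (x + y) = \<rho> x + \<rho> y" for x y
      unfolding \<rho>_def using add[OF PL_const PL_const center_in_fin] .
    show "\<rho> x \<le> \<rho> y" if "x \<le> y" for x y
      unfolding \<rho>_def using max[OF PL_const PL_const center_in_fin, of x y] that by (simp add: max_absorb2)
  qed
  have r: "0 < r"
  proof -
    have "0 \<le> r" unfolding r_def \<rho>_def
      using max[OF PL_const PL_const center_in_fin, of 0 1] \<phi>0[OF center_in_fin] by simp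
    moreover have "r \<noteq> 0"
    proof
      assume "r = 0"
      then have "\<phi> (\<lambda>p. 1) q = \<phi> (\<lambda>p. 0) q" if "q \<in> fin" for q using \<rho> \<rho>lin that by simp
      then have "\<Phi> (rat (\<lambda>p. 1)) = \<Phi> (rat (\<lambda>p. 0))" by (simp add: \<phi> PL_const rat_eq_iff)
      then have "rat (\<lambda>p. 1) = rat (\<lambda>p. 0)" using inj_onD[OF inj] by (simp add: rat_in_Rat PL_const)
      then show False using center_in_fin by (auto simp: rat_eq_iff PL_const)
    qed
    ultimately show ?thesis by simp
  qed
  have "\<forall>q\<in>fin. \<exists>p. p \<in> fin \<and> (\<forall>k. PL k \<longrightarrow> \<phi> k q / r = k p)"
  proof
    fix q assume q: "q \<in> fin"
    show "\<exists>p. p \<in> fin \<and> (\<forall>k. PL k \<longrightarrow> \<phi> k q / r = k p)"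
    proof (rule real_hom_is_evaluation[of "\<lambda>k. \<phi> k q / r"])
      fix k l assume "PL k" "PL l"
      then show "\<phi> (\<lambda>p. k p + l p) q / r = \<phi> k q / r + \<phi> l q / r"
        using q by (simp add: add add_divide_distrib)
    next
      fix k l assume "PL k" "PL l"
      then show "\<phi> (\<lambda>p. max (k p) (l p)) q / r = max (\<phi> k q / r) (\<phi> l q / r)"
        using q r by (simp add: max max_divide_distrib_right)
    next
      fix c show "\<phi> (\<lambda>p. c) q / r = c" using \<rho>[OF q] \<rho>lin r by simp
    next
      fix k l assume "PL k" "PL l" "\<And>p. p \<in> fin \<Longrightarrow> k p = l p"
      then show "\<phi> k q / r = \<phi> l q / r" using cong q by metis
    qed blast
  qed
  from bchoice[OF this] obtain \<psi>
    where \<psi>: "\<And>q. q \<in> fin \<Longrightarrow> \<psi> q \<in> fin" "\<And>q k. q \<in> fin \<Longrightarrow> PL k \<Longrightarrow> \<phi> k q / r = k (\<psi> q)"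
    by blast
  have eq: "\<phi> k q = r * k (\<psi> q)" if "q \<in> fin" "PL k" for q k
    using \<psi>(2)[OF that] r by (simp add: field_simps)
  show ?thesis
  proof (rule that[of r \<psi>])
    fix k assume k: "PL k"
    have "PL (\<lambda>p. r * k (\<psi> p))" by (rule PL_cong[OF \<phi>(1)[OF k]]) (rule eq[OF _ k])
    then show "\<Phi> (rat k) = rat (\<lambda>p. r * k (\<psi> p)) \<and> PL (\<lambda>p. r * k (\<psi> p))"
      using k eq by (simp add: \<phi> rat_eq_iff)
  qed (use r \<psi>(1) in auto)
qed

definition fin_isometry :: "((nat, nat) point \<Rightarrow> (nat, nat) point) \<Rightarrow> bool" where
  "fin_isometry \<psi> \<longleftrightarrow> bij_betw \<psi> fin fin \<and> (\<forall>p\<in>fin. \<forall>q\<in>fin. star_dist (\<psi> p) (\<psi> q) = star_dist p q)"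

text \<open>Composed with a dilatation, the maps attached to an automorphism and to its inverse preserve
  integrality of slopes in both directions, hence do not increase distances.\<close>

lemma Aut_semiring_similarity:
  assumes \<Phi>: "\<Phi> \<in> carrier A"
  obtains r \<psi> where "0 < r" "fin_isometry \<psi>"
    "\<And>k q. PL k \<Longrightarrow> q \<in> fin \<Longrightarrow> \<Phi> (rat k) (\<psi> (dil r q)) = ereal (r * k q)"
proof -
  obtain \<Psi> where \<Psi>: "\<Psi> \<in> carrier A" "\<And>f. f \<in> carrier R \<Longrightarrow> \<Psi> (\<Phi> f) = f" "\<And>f. f \<in> carrier R \<Longrightarrow> \<Phi> (\<Psi> f) = f"
    by (rule Aut_semiring_inverse[OF \<Phi>]) (rule that)
  obtain r \<kappa>1 where r: "0 < r" "\<And>p. p \<in> fin \<Longrightarrow> \<kappa>1 p \<in> fin"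
      "\<And>k. PL k \<Longrightarrow> \<Phi> (rat k) = rat (\<lambda>p. r * k (\<kappa>1 p)) \<and> PL (\<lambda>p. r * k (\<kappa>1 p))"
    by (rule Aut_semiring_pullback[OF \<Phi>]) (rule that)
  obtain s \<kappa>2 where s: "0 < s" "\<And>p. p \<in> fin \<Longrightarrow> \<kappa>2 p \<in> fin"
      "\<And>k. PL k \<Longrightarrow> \<Psi> (rat k) = rat (\<lambda>p. s * k (\<kappa>2 p)) \<and> PL (\<lambda>p. s * k (\<kappa>2 p))"
    by (rule Aut_semiring_pullback[OF \<Psi>(1)]) (rule that)
  have 1: "s * (r * k (\<kappa>1 (\<kappa>2 p))) = k p" if "PL k" "p \<in> fin" for k p
  proof -
    have "rat k = rat (\<lambda>p. s * (r * k (\<kappa>1 (\<kappa>2 p))))"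
      using \<Psi>(2)[OF rat_in_Rat[OF that(1)]] r(3)[OF that(1)] s(3)[of "\<lambda>p. r * k (\<kappa>1 p)"] by simp
    moreover have "PL (\<lambda>p. s * (r * k (\<kappa>1 (\<kappa>2 p))))"
      using r(3)[OF that(1)] s(3)[of "\<lambda>p. r * k (\<kappa>1 p)"] by simp
    ultimately show ?thesis using that by (simp add: rat_eq_iff)
  qed
  have 2: "r * (s * k (\<kappa>2 (\<kappa>1 p))) = k p" if "PL k" "p \<in> fin" for k p
  proof -
    have "rat k = rat (\<lambda>p. r * (s * k (\<kappa>2 (\<kappa>1 p))))"
      using \<Psi>(3)[OF rat_in_Rat[OF that(1)]] s(3)[OF that(1)] r(3)[of "\<lambda>p. s * k (\<kappa>2 p)"] by simp
    moreover have "PL (\<lambda>p. r * (s * k (\<kappa>2 (\<kappa>1 p))))"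
      using s(3)[OF that(1)] r(3)[of "\<lambda>p. s * k (\<kappa>2 p)"] by simp
    ultimately show ?thesis using that by (simp add: rat_eq_iff)
  qed
  have rs: "s * r = 1" using 1[OF PL_const center_in_fin, of 1] by simp
  have s_eq: "s = 1 / r" using rs r(1) by (simp add: field_simps)
  have inv12: "\<kappa>1 (\<kappa>2 p) = p" and inv21: "\<kappa>2 (\<kappa>1 p) = p" if p: "p \<in> fin" for p
  proof -
    have "star_dist p (\<kappa>1 (\<kappa>2 p)) = star_dist p p" "star_dist p (\<kappa>2 (\<kappa>1 p)) = star_dist p p"
      using 1[OF PL_star_dist[OF p] p] 2[OF PL_star_dist[OF p] p] rs
      by (simp_all add: mult.commute mult.left_commute flip: mult.assoc)
    then show "\<kappa>1 (\<kappa>2 p) = p" "\<kappa>2 (\<kappa>1 p) = p"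
      using star_dist_eq_0_iff p r(2) s(2) by metis+
  qed
  define \<theta> where "\<theta> p = dil r (\<kappa>1 p)" for p
  define \<psi> where "\<psi> p = \<kappa>2 (dil (1 / r) p)" for p
  have \<theta>: "\<theta> p \<in> fin" and \<psi>: "\<psi> p \<in> fin" if "p \<in> fin" for p
    using that r s by (simp_all add: \<theta>_def \<psi>_def dil_in_fin)
  have inv: "\<psi> (\<theta> p) = p" "\<theta> (\<psi> p) = p" if "p \<in> fin" for p
    using that r s inv12 inv21 by (simp_all add: \<theta>_def \<psi>_def dil_inverse dil_in_fin)
  have PL1: "PL (\<lambda>p. star_dist y (\<theta> p))" if y: "y \<in> fin" for y
  proof -
    have "PL (\<lambda>p. 1 / r * star_dist y (dil r p))"
      using PL_dil[of "1 / r" "star_dist y"] PL_star_dist[OF y] r(1) by simp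
    then have "PL (\<lambda>p. r * (1 / r * star_dist y (dil r (\<kappa>1 p))))" using r(3) by blast
    then show ?thesis using r(1) by (simp add: \<theta>_def)
  qed
  have PL2: "PL (\<lambda>p. star_dist y (\<psi> p))" if y: "y \<in> fin" for y
  proof -
    have "PL (\<lambda>p. s * star_dist y (\<kappa>2 p))" using s(3) PL_star_dist[OF y] by blast
    then have "PL (\<lambda>p. r * (s * star_dist y (\<kappa>2 (dil (1 / r) p))))" by (rule PL_dil[OF r(1)])
    then show ?thesis using r(1) by (simp add: \<psi>_def s_eq)
  qed
  have le: "star_dist (\<psi> p) (\<psi> q) \<le> star_dist p q" if "p \<in> fin" "q \<in> fin" for p q
    by (rule nonexpanding[of \<psi> \<theta>]) (use \<theta> \<psi> inv PL1 that in auto)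
  have ge: "star_dist (\<theta> p) (\<theta> q) \<le> star_dist p q" if "p \<in> fin" "q \<in> fin" for p q
    by (rule nonexpanding[of \<theta> \<psi>]) (use \<theta> \<psi> inv PL2 that in auto)
  have "star_dist (\<psi> p) (\<psi> q) = star_dist p q" if "p \<in> fin" "q \<in> fin" for p q
    using le[OF that] ge[OF \<psi>[OF that(1)] \<psi>[OF that(2)]] inv that by simp
  moreover have "bij_betw \<psi> fin fin"
    by (rule bij_betw_byWitness[of _ \<theta>]) (use \<theta> \<psi> inv in auto)
  ultimately have "fin_isometry \<psi>" by (simp add: fin_isometry_def)
  moreover have "\<Phi> (rat k) (\<psi> (dil r q)) = ereal (r * k q)" if k: "PL k" and q: "q \<in> fin" for k q
  proof -
    have "\<psi> (dil r q) = \<kappa>2 q" using q r(1) by (simp add: \<psi>_def dil_inverse)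
    then show ?thesis using r(3)[OF k] q s(2) inv12 by (simp add: rat_extension)
  qed
  ultimately show ?thesis using r(1) by (intro that[of r \<psi>])
qed

end

section \<open>Automorphisms of the curve\<close>

text \<open>Coordinates extended to the points at infinity; they show that the curve is Hausdorff.\<close>

fun ereal_leg_coord :: "nat \<Rightarrow> (nat, nat) point \<Rightarrow> ereal" where
  "ereal_leg_coord i (Vertex v) = (if v = i then \<infinity> else 0)"
| "ereal_leg_coord i (Inner j t) = (if j = i then t else 0)"

fun permute_legs :: "(nat \<Rightarrow> nat) \<Rightarrow> (nat, nat) point \<Rightarrow> (nat, nat) point" where
  "permute_legs \<sigma> (Vertex v) = Vertex (\<sigma> v)"
| "permute_legs \<sigma> (Inner i t) = Inner (\<sigma> i) t"

lemma permute_legs_ray: "\<sigma> 0 = 0 \<Longrightarrow> permute_legs \<sigma> (ray i t) = ray (\<sigma> i) t"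
  by (simp add: ray_def)

lemma permute_legs_chart: "\<sigma> 0 = 0 \<Longrightarrow> permute_legs \<sigma> (chart (star n) i t) = chart (star n) (\<sigma> i) t"
  by (simp add: chart_star)

context star_curve
begin

abbreviation G where "G \<equiv> Aut_curve (star n)"

lemma fin_isometry_in: "fin_isometry \<psi> \<Longrightarrow> p \<in> fin \<Longrightarrow> \<psi> p \<in> fin"
  by (auto simp: fin_isometry_def bij_betw_def)

lemma fin_isometry_cong:
  assumes "fin_isometry \<psi>" "\<And>p. p \<in> fin \<Longrightarrow> \<psi> p = \<psi>' p"
  shows "fin_isometry \<psi>'"
  using assms bij_betw_cong[of fin \<psi> \<psi>' fin] by (simp add: fin_isometry_def)

lemma fin_isometry_compose:
  assumes "fin_isometry \<psi>" "fin_isometry \<psi>'"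
  shows "fin_isometry (\<lambda>p. \<psi> (\<psi>' p))"
  using assms bij_betw_trans[of \<psi>' fin fin \<psi> fin] fin_isometry_in[OF assms(2)]
  by (simp add: fin_isometry_def o_def)

lemma fin_isometry_inverse:
  assumes "fin_isometry \<psi>"
  obtains \<psi>' where "fin_isometry \<psi>'" "\<And>p. p \<in> fin \<Longrightarrow> \<psi> (\<psi>' p) = p" "\<And>p. p \<in> fin \<Longrightarrow> \<psi>' (\<psi> p) = p"
proof -
  have bij: "bij_betw \<psi> fin fin" using assms by (simp add: fin_isometry_def)
  let ?i = "inv_into fin \<psi>"
  have 1: "\<psi> (?i p) = p" "?i p \<in> fin" if "p \<in> fin" for p
    using bij that by (auto simp: bij_betw_def f_inv_into_f inv_into_into)
  have 2: "?i (\<psi> p) = p" if "p \<in> fin" for p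
    using bij that by (auto simp: bij_betw_def inv_into_f_f)
  have "star_dist (?i p) (?i q) = star_dist p q" if "p \<in> fin" "q \<in> fin" for p q
    using assms 1 that unfolding fin_isometry_def by metis
  then have "fin_isometry ?i" using bij_betw_inv_into[OF bij] by (simp add: fin_isometry_def)
  then show ?thesis using 1(1) 2 by (rule that)
qed

lemma carrier_Aut_curve:
  "carrier G = {a \<in> extensional pts. continuous_map topo topo a \<and> fin_isometry a}"
proof -
  have "(\<forall>x\<in>fin. \<forall>y\<in>fin. path_dist (star n) (a x) (a y) = path_dist (star n) x y) \<longleftrightarrow>
      (\<forall>x\<in>fin. \<forall>y\<in>fin. star_dist (a x) (a y) = star_dist x y)" if "bij_betw a fin fin" for a
    using bij_betw_apply[OF that] by (simp add: path_dist_star)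
  then show ?thesis
    by (auto simp: Aut_curve_def composition_group_def fin_isometry_def)
qed

lemma mult_Aut_curve: "a \<otimes>\<^bsub>G\<^esub> b = compose pts a b"
  by (simp add: Aut_curve_def composition_group_def)

lemma one_Aut_curve: "\<one>\<^bsub>G\<^esub> = (\<lambda>x\<in>pts. x)"
  by (simp add: Aut_curve_def composition_group_def)

lemma Aut_curve_in_pts: "a \<in> carrier G \<Longrightarrow> p \<in> pts \<Longrightarrow> a p \<in> pts"
  by (auto simp: carrier_Aut_curve continuous_map_def topspace_star)

lemma Aut_curve_in_fin: "a \<in> carrier G \<Longrightarrow> p \<in> fin \<Longrightarrow> a p \<in> fin"
  by (auto simp: carrier_Aut_curve intro: fin_isometry_in)

lemma mult_Aut_curve_fin: "p \<in> fin \<Longrightarrow> (a \<otimes>\<^bsub>G\<^esub> b) p = a (b p)"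
  using fin_subset_pts by (auto simp: mult_Aut_curve compose_def)

lemma continuous_ereal_leg_coord:
  assumes "i \<in> {1..n}"
  shows "continuous_map topo euclidean (ereal_leg_coord i)"
  unfolding continuous_to_ereal_iff
proof
  fix j assume j: "j \<in> {1..n}"
  have "continuous_on {0..} (\<lambda>t::ereal. if i = j then t else 0)" by (cases "i = j") (auto intro: continuous_on_id)
  then show "continuous_on {0..} (\<lambda>t. ereal_leg_coord i (chart (star n) j t))"
    by (rule continuous_on_eq) (use assms in \<open>auto simp: chart_star\<close>)
qed

lemma ereal_leg_coord_eqI:
  assumes "p \<in> pts" "q \<in> pts" and eq: "\<And>i. i \<in> {1..n} \<Longrightarrow> ereal_leg_coord i p = ereal_leg_coord i q"
  shows "p = q"
proof -
  have form: "p = Vertex 0 \<or> (\<exists>i\<in>{1..n}. \<exists>t. 0 < t \<and> ereal_leg_coord i p = t \<and>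
      p = (if t = \<infinity> then Vertex i else Inner i t))" if "p \<in> pts" for p
  proof -
    consider i where "i \<in> {1..n}" "p = Vertex i" | i t where "i \<in> {1..n}" "0 \<le> t" "p = ray i t"
      using \<open>p \<in> pts\<close> unfolding pts_fin fin_eq by blast
    then show ?thesis
    proof cases
      case (1 i)
      then show ?thesis by (intro disjI2 bexI[of _ i] exI[of _ \<infinity>]) auto
    next
      case (2 i t)
      show ?thesis
      proof (cases "t = 0")
        case False
        then show ?thesis using 2 by (intro disjI2 bexI[of _ i] exI[of _ "ereal t"]) (auto simp: ray_def)
      qed (use 2 in simp)
    qed
  qed
  have 0: "p = Vertex 0" if "p \<in> pts" "\<And>i. i \<in> {1..n} \<Longrightarrow> ereal_leg_coord i p = 0" for p
    using form[OF that(1)] that(2) by force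
  show ?thesis
  proof (cases "p = Vertex 0 \<or> q = Vertex 0")
    case True
    then have "\<And>i. i \<in> {1..n} \<Longrightarrow> ereal_leg_coord i p = 0 \<and> ereal_leg_coord i q = 0" using eq by auto
    then show ?thesis using 0 assms(1,2) by metis
  next
    case False
    then obtain i t where i: "i \<in> {1..n}" "0 < t" "ereal_leg_coord i p = t" "p = (if t = \<infinity> then Vertex i else Inner i t)"
      using form[OF assms(1)] by auto
    obtain j u where j: "0 < u" "ereal_leg_coord j q = u" "q = (if u = \<infinity> then Vertex j else Inner j u)"
      using form[OF assms(2)] False by auto
    have "ereal_leg_coord i q = t" using eq i by simp
    then have "i = j" "u = t" using i(2) j by (auto split: if_splits)
    then show ?thesis using i j by simp
  qed
qed

text \<open>Automorphisms are determined by their restrictions to the finite points, which are dense.\<close>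

lemma continuous_self_map_eqI:
  assumes a: "a \<in> extensional pts" "continuous_map topo topo a"
    and b: "b \<in> extensional pts" "continuous_map topo topo b"
    and eq: "\<And>p. p \<in> fin \<Longrightarrow> a p = b p"
  shows "a = b"
proof (rule extensionalityI[OF a(1) b(1)])
  fix p assume p: "p \<in> pts"
  show "a p = b p"
  proof (rule ereal_leg_coord_eqI)
    show "a p \<in> pts" "b p \<in> pts" using p a(2) b(2) by (auto simp: continuous_map_def topspace_star)
    fix i assume i: "i \<in> {1..n}"
    have "continuous_map topo euclidean (ereal_leg_coord i \<circ> a)" "continuous_map topo euclidean (ereal_leg_coord i \<circ> b)"
      using a(2) b(2) continuous_ereal_leg_coord[OF i] by (auto intro: continuous_map_compose)
    from continuous_eqI[OF this _ p] show "ereal_leg_coord i (a p) = ereal_leg_coord i (b p)"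
      by (simp add: eq)
  qed
qed

lemma restrict_in_Aut_curve:
  assumes "continuous_map topo topo g" "fin_isometry g"
  shows "restrict g pts \<in> carrier G"
  unfolding carrier_Aut_curve
proof (intro CollectI conjI)
  show "restrict g pts \<in> extensional pts" by simp
  show "continuous_map topo topo (restrict g pts)"
    using assms(1) by (rule continuous_map_eq) (simp add: topspace_star)
  show "fin_isometry (restrict g pts)"
    by (rule fin_isometry_cong[OF assms(2)]) (use fin_subset_pts in auto)
qed

lemma permutation_fixes_0: "\<sigma> permutes {1..n} \<Longrightarrow> \<sigma> 0 = 0"
  by (auto simp: permutes_def)

lemma permute_legs_Aut_curve:
  assumes \<sigma>: "\<sigma> permutes {1..n}"
  shows "restrict (permute_legs \<sigma>) pts \<in> carrier G"
proof (rule restrict_in_Aut_curve)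
  note \<sigma>0 = permutation_fixes_0[OF \<sigma>]
  have \<sigma>n: "\<sigma> i \<in> {1..n}" if "i \<in> {1..n}" for i using permutes_in_image[OF \<sigma>] that by blast
  have pts: "permute_legs \<sigma> p \<in> pts" if "p \<in> pts" for p
    using that unfolding pts_fin fin_eq
    by (auto simp: permute_legs_ray[of \<sigma>, OF \<sigma>0]) (use \<sigma>n in fastforce)+
  show "continuous_map topo topo (permute_legs \<sigma>)"
    unfolding continuous_map_star_iff
    using pts chart_continuous \<sigma>n by (auto simp: permute_legs_chart[of \<sigma>, OF \<sigma>0] topspace_star)
  have into: "permute_legs \<tau> p \<in> fin" if "p \<in> fin" "\<tau> permutes {1..n}" for p \<tau>
  proof -
    obtain i t where i: "i \<in> {1..n}" "0 \<le> t" "p = ray i t" by (rule finE[OF \<open>p \<in> fin\<close>]) (rule that)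
    have "\<tau> i \<in> {1..n}" using permutes_in_image[OF that(2)] i(1) by blast
    then show ?thesis
      unfolding i(3) permute_legs_ray[of \<tau>, OF permutation_fixes_0[OF that(2)]] using i(2) by (rule ray_in_fin)
  qed
  have inv: "permute_legs \<tau> (permute_legs \<tau>' p) = p" if "\<And>i. \<tau> (\<tau>' i) = i" for \<tau> \<tau>' p
    using that by (cases p) auto
  have "bij_betw (permute_legs \<sigma>) fin fin"
    by (rule bij_betw_byWitness[of _ "permute_legs (inv_into UNIV \<sigma>)"])
      (use into \<sigma> permutes_inv[OF \<sigma>] inv[of \<sigma> "inv_into UNIV \<sigma>", OF permutes_inverses(1)[OF \<sigma>]]
          inv[of "inv_into UNIV \<sigma>" \<sigma>, OF permutes_inverses(2)[OF \<sigma>]] in auto)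
  moreover have "star_dist (permute_legs \<sigma> p) (permute_legs \<sigma> q) = star_dist p q" if "p \<in> fin" "q \<in> fin" for p q
  proof -
    obtain i s j t where ij: "i \<in> {1..n}" "0 \<le> s" "p = ray i s" "j \<in> {1..n}" "0 \<le> t" "q = ray j t"
      using \<open>p \<in> fin\<close> \<open>q \<in> fin\<close> by (elim finE)
    have "\<sigma> i = \<sigma> j \<longleftrightarrow> i = j" using permutes_inj[OF \<sigma>] by (simp add: inj_eq)
    then show ?thesis using ij by (simp add: permute_legs_ray[of \<sigma>, OF \<sigma>0] star_dist_ray)
  qed
  ultimately show "fin_isometry (permute_legs \<sigma>)" by (simp add: fin_isometry_def)
qed

text \<open>A small sphere around a point other than the centre has two points, a sphere around the centre has
  \<open>n\<close> points. So an isometry fixes the centre if \<open>n \<noteq> 2\<close>.\<close>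

lemma fin_isometry_fixes_center:
  assumes \<psi>: "fin_isometry \<psi>" and n2: "n \<noteq> 2"
  shows "\<psi> (Vertex 0) = Vertex 0"
proof (rule ccontr)
  assume ne: "\<psi> (Vertex 0) \<noteq> Vertex 0"
  obtain i a where i: "i \<in> {1..n}" "0 \<le> a" "\<psi> (Vertex 0) = ray i a"
    by (rule finE[OF fin_isometry_in[OF \<psi> center_in_fin]]) (rule that)
  then have a: "0 < a" using ne by (cases "a = 0") auto
  define S where "S p = {q \<in> fin. star_dist p q = a / 2}" for p
  have "\<psi> ` S (Vertex 0) = S (\<psi> (Vertex 0))"
  proof
    show "\<psi> ` S (Vertex 0) \<subseteq> S (\<psi> (Vertex 0))"
      using \<psi> center_in_fin fin_isometry_in[OF \<psi>] by (auto simp: S_def fin_isometry_def)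
    show "S (\<psi> (Vertex 0)) \<subseteq> \<psi> ` S (Vertex 0)"
    proof
      fix q assume q: "q \<in> S (\<psi> (Vertex 0))"
      then have "q \<in> \<psi> ` fin" using \<psi> by (simp add: S_def fin_isometry_def bij_betw_def)
      then obtain p where "p \<in> fin" "q = \<psi> p" by blast
      then show "q \<in> \<psi> ` S (Vertex 0)" using q \<psi> center_in_fin by (auto simp: S_def fin_isometry_def)
    qed
  qed
  moreover have "inj_on \<psi> (S (Vertex 0))"
    using \<psi> by (auto simp: fin_isometry_def bij_betw_def S_def intro: inj_on_subset)
  ultimately have card: "card (S (\<psi> (Vertex 0))) = card (S (Vertex 0))" by (metis card_image)
  have c: "star_dist (Vertex 0) (ray j t) = t" if "0 \<le> t" for j t
    using star_dist_ray[of 0 t 1 j] that by simp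
  have "S (Vertex 0) = (\<lambda>j. ray j (a / 2)) ` {1..n}"
    using a by (auto simp: S_def c ray_in_fin elim!: finE)
  moreover have "inj_on (\<lambda>j. ray j (a / 2)) {1..n}" using a by (auto simp: inj_on_def ray_eq_iff)
  ultimately have "card (S (Vertex 0)) = n" by (simp add: card_image)
  moreover have "S (\<psi> (Vertex 0)) = {ray i (a / 2), ray i (3 * a / 2)}"
  proof
    show "S (\<psi> (Vertex 0)) \<subseteq> {ray i (a / 2), ray i (3 * a / 2)}"
    proof
      fix q assume "q \<in> S (\<psi> (Vertex 0))"
      then obtain j t where j: "0 \<le> t" "q = ray j t" "star_dist (ray i a) (ray j t) = a / 2"
        by (auto simp: S_def i elim!: finE)
      then have "i = j" "\<bar>a - t\<bar> = a / 2" using a by (auto simp: star_dist_ray split: if_splits)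
      then have "t = a / 2 \<or> t = 3 * a / 2" by (auto simp: abs_if field_simps split: if_splits)
      moreover have "q = ray i t" using j \<open>i = j\<close> by simp
      ultimately show "q \<in> {ray i (a / 2), ray i (3 * a / 2)}" by blast
    qed
    show "{ray i (a / 2), ray i (3 * a / 2)} \<subseteq> S (\<psi> (Vertex 0))"
      using a i by (auto simp: S_def star_dist_ray ray_in_fin)
  qed
  moreover have "ray i (a / 2) \<noteq> ray i (3 * a / 2)" using a by (simp add: ray_eq_iff)
  ultimately show False using card n2 by simp
qed

text \<open>The image of the point with coordinate \<open>1\<close> on a copy tells where the whole copy goes: points with
  coordinates \<open>t\<close> and \<open>1\<close> have distance \<open>\<bar>t - 1\<bar>\<close> on the same copy, but \<open>t + 1\<close> on different ones.\<close>

lemma fin_isometry_permutation: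
  assumes \<psi>: "fin_isometry \<psi>" and n2: "n \<noteq> 2"
  obtains \<sigma> where "\<sigma> permutes {1..n}" "\<And>p. p \<in> fin \<Longrightarrow> \<psi> p = permute_legs \<sigma> p"
proof -
  note center = fin_isometry_fixes_center[OF \<psi> n2]
  have dist: "star_dist (\<psi> p) (\<psi> q) = star_dist p q" if "p \<in> fin" "q \<in> fin" for p q
    using \<psi> that by (simp add: fin_isometry_def)
  have c: "star_dist (Vertex 0) (ray j t) = t" if "0 \<le> t" for j t
    using star_dist_ray[of 0 t 1 j] that by simp
  have image: "\<exists>j\<in>{1..n}. \<psi> (ray i t) = ray j t" if i: "i \<in> {1..n}" and t: "0 \<le> t" for i t
  proof -
    obtain j u where j: "j \<in> {1..n}" "0 \<le> u" "\<psi> (ray i t) = ray j u"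
      by (rule finE[OF fin_isometry_in[OF \<psi> ray_in_fin[OF i t]]]) (rule that)
    have "u = t" using dist[OF center_in_fin ray_in_fin[OF i t]] by (simp add: center j c t)
    then show ?thesis using j by auto
  qed
  have "\<forall>i\<in>{1..n}. \<exists>j. j \<in> {1..n} \<and> \<psi> (ray i 1) = ray j 1"
  proof
    fix i assume "i \<in> {1..n}"
    from image[OF this zero_le_one] show "\<exists>j. j \<in> {1..n} \<and> \<psi> (ray i 1) = ray j 1" by blast
  qed
  from bchoice[OF this] obtain \<tau> where \<tau>: "\<And>i. i \<in> {1..n} \<Longrightarrow> \<tau> i \<in> {1..n}"
      "\<And>i. i \<in> {1..n} \<Longrightarrow> \<psi> (ray i 1) = ray (\<tau> i) 1" by blast
  have inj: "inj_on \<tau> {1..n}"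
  proof (rule inj_onI)
    fix i j assume ij: "i \<in> {1..n}" "j \<in> {1..n}" "\<tau> i = \<tau> j"
    then have "\<psi> (ray i 1) = \<psi> (ray j 1)" by (simp add: \<tau>(2))
    then have "ray i 1 = ray j 1"
      using \<psi> ij ray_in_fin by (auto simp: fin_isometry_def bij_betw_def dest: inj_onD)
    then show "i = j" by (simp add: ray_eq_iff)
  qed
  define \<sigma> where "\<sigma> i = (if i \<in> {1..n} then \<tau> i else i)" for i
  have "\<tau> ` {1..n} = {1..n}" by (rule endo_inj_surj) (use \<tau>(1) inj in auto)
  with inj have "bij_betw \<tau> {1..n} {1..n}" by (rule bij_betw_imageI)
  moreover have "bij_betw \<sigma> {1..n} {1..n} \<longleftrightarrow> bij_betw \<tau> {1..n} {1..n}"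
    by (rule bij_betw_cong) (simp add: \<sigma>_def)
  ultimately have "bij_betw \<sigma> {1..n} {1..n}" by simp
  then have \<sigma>: "\<sigma> permutes {1..n}" by (rule bij_imp_permutes) (simp only: \<sigma>_def if_False)
  have "\<psi> p = permute_legs \<sigma> p" if p: "p \<in> fin" for p
  proof -
    obtain i t where i: "i \<in> {1..n}" "0 \<le> t" "p = ray i t" by (rule finE[OF p]) (rule that)
    obtain j where j: "j \<in> {1..n}" "\<psi> p = ray j t" using image[OF i(1,2)] i(3) by auto
    have "star_dist (ray j t) (ray (\<tau> i) 1) = \<bar>t - 1\<bar>"
      using dist[OF ray_in_fin[OF i(1,2)] ray_in_fin[OF i(1), of 1]] i j \<tau>(2)[OF i(1)] by (simp add: star_dist_ray)
    then have "t = 0 \<or> j = \<tau> i" using i(2) by (auto simp: star_dist_ray split: if_splits)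
    then show ?thesis using i j \<sigma> by (auto simp: permute_legs_ray[OF permutation_fixes_0] ray_eq_iff \<sigma>_def)
  qed
  with \<sigma> show ?thesis by (rule that)
qed

lemma permutation_isometry_extends:
  assumes "fin_isometry \<psi>" "n \<noteq> 2"
  shows "\<exists>a\<in>carrier G. \<forall>p\<in>fin. a p = \<psi> p"
proof -
  obtain \<sigma> where \<sigma>: "\<sigma> permutes {1..n}" "\<And>p. p \<in> fin \<Longrightarrow> \<psi> p = permute_legs \<sigma> p"
    by (rule fin_isometry_permutation[OF assms]) (rule that)
  show ?thesis
    by (rule bexI[OF _ permute_legs_Aut_curve[OF \<sigma>(1)]]) (use \<sigma>(2) fin_subset_pts in auto)
qed

lemma permutation_isometry_PL:
  assumes "fin_isometry \<psi>" "n \<noteq> 2" "PL k"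
  shows "PL (\<lambda>p. k (\<psi> p))"
proof -
  obtain \<sigma> where \<sigma>: "\<sigma> permutes {1..n}" "\<And>p. p \<in> fin \<Longrightarrow> \<psi> p = permute_legs \<sigma> p"
    by (rule fin_isometry_permutation[OF assms(1,2)]) (rule that)
  have "PL (\<lambda>p. k (permute_legs \<sigma> p))"
    unfolding PL_def permute_legs_ray[of \<sigma>, OF permutation_fixes_0[OF \<sigma>(1)]]
  proof
    fix i assume "i \<in> {1..n}"
    then have "\<sigma> i \<in> {1..n}" using permutes_in_image[OF \<sigma>(1)] by blast
    then show "pl (\<lambda>t. k (ray (\<sigma> i) t))" using assms(3) by (simp add: PL_def)
  qed
  then show ?thesis by (rule PL_cong) (simp add: \<sigma>(2))
qed

end

section \<open>The line\<close>

lemma filterlim_affine_one_sided: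
  "filterlim (\<lambda>x. x + t) (at_right (y + t)) (at_right (y::real))"
  "filterlim (\<lambda>x. x + t) (at_left (y + t)) (at_left y)"
  "filterlim (\<lambda>x. t - x) (at_left (t - y)) (at_right y)"
  "filterlim (\<lambda>x. t - x) (at_right (t - y)) (at_left y)"
proof -
  have 1: "\<forall>\<^sub>F x in at_right y. y < x" "\<forall>\<^sub>F x in at_left y. x < y" for y :: real
    by (simp_all add: eventually_at_filter)
  have c: "filterlim (\<lambda>x. x + t) (nhds (y + t)) (at y within S)" "filterlim (\<lambda>x. t - x) (nhds (t - y)) (at y within S)" for S
    by (intro tendsto_intros)+
  show "filterlim (\<lambda>x. x + t) (at_right (y + t)) (at_right (y::real))"
    "filterlim (\<lambda>x. x + t) (at_left (y + t)) (at_left y)"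
    "filterlim (\<lambda>x. t - x) (at_left (t - y)) (at_right y)"
    "filterlim (\<lambda>x. t - x) (at_right (t - y)) (at_left y)"
    unfolding filterlim_at using c by (auto intro: eventually_mono[OF 1(1)] eventually_mono[OF 1(2)])
qed

lemma affine_germ_compose_affine:
  assumes "affine_germ F h" "filterlim (\<lambda>x. of_int s * x + t) F F'"
  shows "affine_germ F' (\<lambda>x. h (of_int s * x + t))"
proof -
  obtain m c where "\<forall>\<^sub>F x in F. h x = of_int m * x + c"
    using assms(1) by (auto simp: affine_germ_def)
  then have "\<forall>\<^sub>F x in F'. h (of_int s * x + t) = of_int m * (of_int s * x + t) + c"
    using assms(2) by (auto simp: filterlim_iff)
  then have "\<forall>\<^sub>F x in F'. h (of_int s * x + t) = of_int (m * s) * x + (of_int m * t + c)"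
    by eventually_elim (simp add: algebra_simps)
  then show ?thesis by (rule affine_germI)
qed

lemmas affine_germ_shift = affine_germ_compose_affine[where s = 1, simplified]
lemma affine_germ_reflect:
  "affine_germ F h \<Longrightarrow> filterlim (\<lambda>x. t - x) F F' \<Longrightarrow> affine_germ F' (\<lambda>x. h (t - x))"
  using affine_germ_compose_affine[where s = "-1"] by simp

text \<open>Two piecewise affine functions on half-lines with the same value at \<open>0\<close> form one on the line,
  which stays piecewise affine after a translation or reflection.\<close>

lemma pl_glue:
  assumes h: "pl h" and g: "pl g" and 0: "h 0 = g 0" and L: "\<And>y. L y = (if 0 \<le> y then h y else g (- y))"
  shows "pl (\<lambda>x. L (x + t))" "pl (\<lambda>x. L (t - x))"
proof -
  have cont: "continuous_on UNIV L"
  proof -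
    have "continuous_on {..0} (\<lambda>y. g (- y))"
      by (rule continuous_on_compose2[OF pl_continuous[OF g]]) (auto intro: continuous_intros)
    then have "continuous_on ({0..} \<union> {..0}) (\<lambda>y. if 0 \<le> y then h y else g (- y))"
      using pl_continuous[OF h] 0 by (intro continuous_on_If) (auto simp: antisym)
    moreover have "{0..} \<union> {..0} = (UNIV :: real set)" by auto
    ultimately show ?thesis by (simp add: L)
  qed
  have r: "affine_germ (at_right y) L" for y
  proof (cases "0 \<le> y")
    case True
    then have "\<forall>\<^sub>F x in at_right y. h x = L x" by (intro eventually_at_right_greater) (simp add: L)
    with True h show ?thesis by (auto simp: pl_def intro: affine_germ_cong)
  next
    case False
    then have "affine_germ (at_left (0 - y)) g" using g by (simp add: pl_def)
    from affine_germ_reflect[OF this filterlim_affine_one_sided(3)] have "affine_germ (at_right y) (\<lambda>x. g (- x))" by simp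
    moreover have "\<forall>\<^sub>F x in at_right y. g (- x) = L x"
      unfolding eventually_at_right_field using False by (intro exI[of _ 0]) (simp add: L)
    ultimately show ?thesis by (rule affine_germ_cong)
  qed
  have l: "affine_germ (at_left y) L" for y
  proof (cases "0 < y")
    case True
    then have "affine_germ (at_left y) h" using h by (simp add: pl_def)
    moreover have "\<forall>\<^sub>F x in at_left y. h x = L x" using True by (rule eventually_at_left_positive) (simp add: L)
    ultimately show ?thesis by (rule affine_germ_cong)
  next
    case False
    then have "affine_germ (at_right (0 - y)) g" using g by (simp add: pl_def)
    from affine_germ_reflect[OF this filterlim_affine_one_sided(4)] have "affine_germ (at_left y) (\<lambda>x. g (- x))" by simp
    moreover have "\<forall>\<^sub>F x in at_left y. g (- x) = L x"
      unfolding eventually_at_left_field using False by (intro exI[of _ "y - 1"]) (simp add: L)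
    ultimately show ?thesis by (rule affine_germ_cong)
  qed
  have top: "affine_germ at_top L"
  proof -
    have "affine_germ at_top h" using h by (simp add: pl_def)
    moreover have "\<forall>\<^sub>F x in at_top. h x = L x"
      using eventually_ge_at_top[of "0::real"] by eventually_elim (simp add: L)
    ultimately show ?thesis by (rule affine_germ_cong)
  qed
  have bot: "affine_germ at_bot L"
  proof -
    have "affine_germ at_top g" using g by (simp add: pl_def)
    from affine_germ_reflect[OF this, of 0 at_bot] have "affine_germ at_bot (\<lambda>x. g (- x))"
      using filterlim_uminus_at_top_at_bot by simp
    moreover have "\<forall>\<^sub>F x in at_bot. g (- x) = L x"
      using eventually_gt_at_bot[of "0::real"] by eventually_elim (simp add: L)
    ultimately show ?thesis by (rule affine_germ_cong)
  qed
  have lim: "filterlim (\<lambda>x. x + t) at_top at_top" "filterlim (\<lambda>x. t - x) at_bot at_top"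
    by real_asymp+
  have "continuous_on {0..} (\<lambda>x. L (x + t))" "continuous_on {0..} (\<lambda>x. L (t - x))"
    by (rule continuous_on_compose2[OF cont]; auto intro!: continuous_intros)+
  then show "pl (\<lambda>x. L (x + t))" "pl (\<lambda>x. L (t - x))"
    using affine_germ_shift[OF r filterlim_affine_one_sided(1)] affine_germ_shift[OF l filterlim_affine_one_sided(2)]
      affine_germ_shift[OF top lim(1)]
      affine_germ_reflect[OF l filterlim_affine_one_sided(3)] affine_germ_reflect[OF r filterlim_affine_one_sided(4)]
      affine_germ_reflect[OF bot lim(2)]
    unfolding pl_def by blast+
qed

lemma continuous_on_uminus_ereal: "continuous_on S (uminus :: ereal \<Rightarrow> ereal)"
  unfolding continuous_on_def by (intro ballI tendsto_uminus_ereal tendsto_ident_at)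

interpretation line: star_curve 2
  by unfold_locales simp

lemma line_point_ereal: "line_point (ereal y) = (if 0 \<le> y then ray 1 y else ray 2 (- y))"
proof -
  have "chart (star 2) i (ereal t) = ray i t" for i t by (rule chart_ray)
  then show ?thesis unfolding line_point_def by simp
qed

lemma line_fin: "line.fin = range (\<lambda>y. line_point (ereal y))"
proof
  show "line.fin \<subseteq> range (\<lambda>y. line_point (ereal y))"
  proof
    fix p assume "p \<in> line.fin"
    then obtain i t where i: "i \<in> {1..2}" "0 \<le> t" "p = ray i t" by (rule line.finE)
    then consider "i = 1" | "i = 2" by fastforce
    then show "p \<in> range (\<lambda>y. line_point (ereal y))"
    proof cases
      case 1
      then have "p = line_point (ereal t)" using i by (simp add: line_point_ereal)
      then show ?thesis by blast
    next
      case 2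
      then have "p = line_point (ereal (- t))" using i by (cases "t = 0") (auto simp: line_point_ereal)
      then show ?thesis by blast
    qed
  qed
  show "range (\<lambda>y. line_point (ereal y)) \<subseteq> line.fin"
    by (auto simp: line_point_ereal intro!: line.ray_in_fin)
qed

lemma star_dist_line_point: "star_dist (line_point (ereal y)) (line_point (ereal z)) = \<bar>y - z\<bar>"
  by (auto simp: line_point_ereal star_dist_ray)

lemma line_point_in_pts: "line_point y \<in> line.pts"
  using bij_betw_line_point by (auto simp: bij_betw_def)

lemma line_point_inject: "line_point y = line_point z \<longleftrightarrow> y = z"
  using bij_betw_line_point by (auto simp: bij_betw_def inj_eq)

lemma line_coord_line_point: "line_coord (line_point y) = y"
  unfolding line_coord_def using bij_betw_line_point by (simp add: bij_betw_def the_inv_into_f_f)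

lemma line_pointE:
  assumes "p \<in> line.pts"
  obtains y where "p = line_point y"
  using assms bij_betw_line_point by (auto simp: bij_betw_def)

lemma on_line_line_point: "on_line g (line_point y) = line_point (g y)"
  by (simp add: on_line_def line_point_in_pts line_coord_line_point)

text \<open>The topology of the curve \<open>star 2\<close> is that of \<open>[-\<infinity>, \<infinity>]\<close>: an open set of the curve is
  given by its traces on the two halves, which agree at \<open>0\<close>.\<close>

lemma line_point_continuous: "continuous_map euclidean line.topo line_point"
  unfolding continuous_map_def
proof (intro conjI allI impI)
  show "line_point \<in> topspace euclidean \<rightarrow> topspace line.topo"
    using line_point_in_pts by (simp add: line.topspace_star)
  fix U assume "openin line.topo U"
  then have U: "openin (top_of_set {0..}) {t \<in> {0..}. chart (star 2) e t \<in> U}" if "e \<in> {1, 2}" for e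
  proof -
    have "{0..(\<infinity>::ereal)} = {0..}" by auto
    then show ?thesis using that \<open>openin line.topo U\<close> by (auto simp: openin_curve_topology)
  qed
  obtain W1 where W1: "open W1" "{t \<in> {0..}. chart (star 2) 1 t \<in> U} = {0..} \<inter> W1"
    using U[of 1] by (auto simp: openin_open)
  obtain W2 where W2: "open W2" "{t \<in> {0..}. chart (star 2) 2 t \<in> U} = {0..} \<inter> W2"
    using U[of 2] by (auto simp: openin_open)
  \<comment> \<open>The third part is a neighbourhood of \<open>0\<close> if \<open>U\<close> contains the centre.\<close>
  define V where "V = (W1 \<inter> {0<..}) \<union> (uminus -` W2 \<inter> {..<0}) \<union> (W1 \<inter> uminus -` W2)"
  have "open (uminus -` W2 :: ereal set)"
    by (rule open_vimage[OF W2(1)]) (rule continuous_on_uminus_ereal)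
  then have "open V" unfolding V_def using W1(1) by (intro open_Un open_Int open_greaterThan open_lessThan)
  moreover have "line_point y \<in> U \<longleftrightarrow> y \<in> V" for y
  proof -
    have 1: "chart (star 2) 1 t \<in> U \<longleftrightarrow> t \<in> W1" if "0 \<le> t" for t using W1(2) that by auto
    have 2: "chart (star 2) 2 t \<in> U \<longleftrightarrow> t \<in> W2" if "0 \<le> t" for t using W2(2) that by auto
    have 0: "0 \<in> W1 \<longleftrightarrow> 0 \<in> W2" using 1[of 0] 2[of 0] by (simp add: chart_star)
    consider "0 < y" | "y < 0" | "y = 0" by fastforce
    then show ?thesis
    proof cases
      case 1
      then show ?thesis using \<open>\<And>t. 0 \<le> t \<Longrightarrow> chart (star 2) 1 t \<in> U \<longleftrightarrow> t \<in> W1\<close>[of y]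
        by (auto simp: V_def line_point_def less_imp_le)
    next
      case 2
      then have "0 \<le> - y" "\<not> 0 \<le> y" by (cases y; auto)+
      then show ?thesis using 2 \<open>\<And>t. 0 \<le> t \<Longrightarrow> chart (star 2) 2 t \<in> U \<longleftrightarrow> t \<in> W2\<close>[of "- y"]
        by (auto simp: V_def line_point_def)
    next
      case 3
      then show ?thesis using 0 1[of 0] by (auto simp: V_def line_point_def)
    qed
  qed
  ultimately show "openin euclidean {x \<in> topspace euclidean. line_point x \<in> U}" by simp
qed

lemma line_coord_continuous: "continuous_map line.topo euclidean line_coord"
  unfolding line.continuous_to_ereal_iff
proof
  fix i :: nat assume "i \<in> {1..2}"
  then consider "i = 1" | "i = 2" by fastforce
  then show "continuous_on {0..} (\<lambda>t. line_coord (chart (star 2) i t))"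
  proof cases
    case 1
    have eq: "chart (star 2) 1 t = line_point t" if "0 \<le> t" for t
      using that by (simp add: line_point_def)
    have "continuous_on {0..} (\<lambda>t::ereal. t)" by (rule continuous_on_id)
    then show ?thesis
      by (rule continuous_on_eq) (use 1 eq in \<open>simp add: line_coord_line_point\<close>)
  next
    case 2
    have eq: "chart (star 2) 2 t = line_point (- t)" if "0 \<le> t" for t
      using that by (cases "t = 0") (auto simp: line_point_def chart_star)
    have "continuous_on {0..} (\<lambda>t::ereal. - t)" by (rule continuous_on_uminus_ereal)
    then show ?thesis
      by (rule continuous_on_eq) (use 2 eq in \<open>simp add: line_coord_line_point\<close>)
  qed
qed

lemma on_line_continuous:
  assumes "continuous_on UNIV g"
  shows "continuous_map line.topo line.topo (on_line g)"
proof -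
  have "continuous_map line.topo line.topo (line_point \<circ> (g \<circ> line_coord))"
    using assms by (intro continuous_map_compose[OF _ line_point_continuous] continuous_map_compose[OF line_coord_continuous]) simp
  then show ?thesis by (rule continuous_map_eq) (simp add: line.topspace_star on_line_def)
qed

text \<open>With \<open>s = 1\<close> these are the translations, with \<open>s = -1\<close> the inversions; a common form avoids
  distinguishing the four kinds of products.\<close>

definition line_map :: "real \<Rightarrow> real \<Rightarrow> (nat, nat) point \<Rightarrow> (nat, nat) point" where
  "line_map s t = on_line (\<lambda>y. ereal s * y + ereal t)"

lemma line_map_line_point: "line_map s t (line_point y) = line_point (ereal s * y + ereal t)"
  by (simp add: line_map_def on_line_line_point)

lemma line_map_Aut_curve:
  assumes s: "s = 1 \<or> s = -1"
  shows "line_map s t \<in> carrier line.G"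
  unfolding line.carrier_Aut_curve
proof (intro CollectI conjI)
  show "line_map s t \<in> extensional line.pts" by (simp add: line_map_def on_line_def)
  have "continuous_on UNIV (\<lambda>y. ereal s * y + ereal t)"
    unfolding continuous_on_def by (intro ballI tendsto_add_ereal_general tendsto_cmult_ereal tendsto_ident_at tendsto_const) auto
  then show "continuous_map line.topo line.topo (line_map s t)"
    unfolding line_map_def by (rule on_line_continuous)
  have val: "line_map u v (line_point (ereal y)) = line_point (ereal (u * y + v))" for u v y
    by (simp add: line_map_line_point)
  have "bij_betw (line_map s t) line.fin line.fin"
  proof (rule bij_betw_byWitness[of _ "line_map s (- s * t)"])
    have "s * (s * y + t) + - s * t = y" "s * (s * y + - s * t) + t = y" for y
      using s by (auto simp: algebra_simps)
    then show "\<forall>p\<in>line.fin. line_map s (- s * t) (line_map s t p) = p"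
      "\<forall>p\<in>line.fin. line_map s t (line_map s (- s * t) p) = p"
      by (auto simp: line_fin val simp del: mult_minus_left)
  qed (auto simp: line_fin val)
  moreover have "\<bar>(s * y + t) - (s * z + t)\<bar> = \<bar>y - z\<bar>" for y z using s by auto
  ultimately show "line.fin_isometry (line_map s t)"
    by (auto simp: line.fin_isometry_def line_fin val star_dist_line_point)
qed

text \<open>An isometry of the real line is determined by the images of \<open>0\<close> and \<open>1\<close>.\<close>

lemma line_isometry:
  assumes \<psi>: "line.fin_isometry \<psi>"
  obtains s t where "s = 1 \<or> s = -1" "\<And>p. p \<in> line.fin \<Longrightarrow> \<psi> p = line_map s t p"
proof -
  have "\<exists>z. \<psi> (line_point (ereal y)) = line_point (ereal z)" for y
  proof -
    have "line_point (ereal y) \<in> line.fin" by (simp add: line_fin)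
    from line.fin_isometry_in[OF \<psi> this] show ?thesis unfolding line_fin by blast
  qed
  then obtain f where f: "\<And>y. \<psi> (line_point (ereal y)) = line_point (ereal (f y))" by metis
  have dist: "\<bar>f y - f z\<bar> = \<bar>y - z\<bar>" for y z
  proof -
    have "star_dist (\<psi> (line_point (ereal y))) (\<psi> (line_point (ereal z))) =
        star_dist (line_point (ereal y)) (line_point (ereal z))"
      using \<psi> by (simp add: line.fin_isometry_def line_fin)
    then show ?thesis by (simp add: f star_dist_line_point)
  qed
  define s where "s = f 1 - f 0"
  have s: "s = 1 \<or> s = -1" using dist[of 1 0] by (auto simp: s_def)
  have linear: "f y = s * y + f 0" for y
  proof -
    have f1: "f 1 = f 0 + s" by (simp add: s_def)
    from s show ?thesis
      using dist[of y 0] dist[of y 1] by (elim disjE) (auto simp: f1 abs_if split: if_splits)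
  qed
  have "\<psi> p = line_map s (f 0) p" if "p \<in> line.fin" for p
  proof -
    obtain y where y: "p = line_point (ereal y)" using \<open>p \<in> line.fin\<close> unfolding line_fin by blast
    have "ereal (f y) = ereal s * ereal y + ereal (f 0)"
      using linear[of y] by (simp only: times_ereal.simps plus_ereal.simps)
    then show ?thesis unfolding y f line_map_line_point by (simp only:)
  qed
  with s show ?thesis by (rule that)
qed

lemma line_map_PL:
  assumes k: "line.PL k" and s: "s = 1 \<or> s = -1"
  shows "line.PL (\<lambda>p. k (line_map s t p))"
proof -
  have pl1: "pl (\<lambda>x. k (ray 1 x))" and pl2: "pl (\<lambda>x. k (ray 2 x))" using k by (auto simp: line.PL_def)
  define L where "L y = k (line_point (ereal y))" for y
  have L: "L y = (if 0 \<le> y then k (ray 1 y) else k (ray 2 (- y)))" for y by (simp add: L_def line_point_ereal)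
  note glue = pl_glue[OF pl1 pl2 _ L, simplified]
  have r1: "ray 1 x = line_point (ereal x)" and r2: "ray 2 x = line_point (ereal (- x))" if "0 \<le> x" for x
    using that by (auto simp: line_point_ereal)
  have v: "k (line_map s t (line_point (ereal y))) = L (s * y + t)" for y
    by (simp add: line_map_line_point L_def)
  have "pl (\<lambda>x. L (s * x + t))" "pl (\<lambda>x. L (s * - x + t))"
    using s glue[of t] by (auto simp: add.commute)
  note L_pl = this
  have "pl (\<lambda>x. k (line_map s t (ray 1 x)))" by (rule pl_cong[OF L_pl(1)]) (simp only: r1 v)
  moreover have "pl (\<lambda>x. k (line_map s t (ray 2 x)))" by (rule pl_cong[OF L_pl(2)]) (simp only: r2 v)
  moreover have "{1..2::nat} = {1, 2}" by auto
  ultimately show ?thesis by (auto simp: line.PL_def)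
qed

section \<open>The group of automorphisms of the curve\<close>

lemma is_iso_by_bijective_hom:
  assumes "h \<in> hom M N" "inj_on h (carrier M)" "\<And>y. y \<in> carrier N \<Longrightarrow> y \<in> h ` carrier M"
  shows "M \<cong> N"
proof -
  have "h ` carrier M = carrier N" using assms(1,3) by (auto simp: hom_def)
  then have "h \<in> iso M N" using assms by (intro isoI bij_betw_imageI)
  then show ?thesis by (rule is_isoI)
qed

context star_curve
begin

text \<open>This fact and the next one are read off from the explicit form of the isometries, which is different for
  \<open>n = 2\<close>; from here on the cases need not be separated until the groups are computed.\<close>

lemma isometry_extends:
  assumes "fin_isometry \<psi>"
  obtains a where "a \<in> carrier G" "\<And>p. p \<in> fin \<Longrightarrow> a p = \<psi> p"
proof (cases "n = 2")
  case True
  have \<psi>: "line.fin_isometry \<psi>" using assms by (simp add: True)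
  obtain s t where "s = 1 \<or> s = -1" "\<And>p. p \<in> line.fin \<Longrightarrow> \<psi> p = line_map s t p"
    by (rule line_isometry[OF \<psi>]) (rule that)
  then show ?thesis using line_map_Aut_curve by (intro that[of "line_map s t"]) (simp_all add: True)
next
  case False
  then show ?thesis using permutation_isometry_extends[OF assms] that by blast
qed

lemma PL_isometry:
  assumes "fin_isometry \<psi>" "PL k"
  shows "PL (\<lambda>p. k (\<psi> p))"
proof (cases "n = 2")
  case True
  have \<psi>: "line.fin_isometry \<psi>" and k: "line.PL k" using assms by (simp_all add: True)
  obtain s t where st: "s = 1 \<or> s = -1" "\<And>p. p \<in> line.fin \<Longrightarrow> \<psi> p = line_map s t p"
    by (rule line_isometry[OF \<psi>]) (rule that)
  from line_map_PL[OF k st(1)] have "line.PL (\<lambda>p. k (\<psi> p))"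
    by (rule line.PL_cong) (simp add: st(2))
  then show ?thesis by (simp add: True)
next
  case False
  then show ?thesis using permutation_isometry_PL assms by blast
qed

lemma Aut_curve_isometry: "a \<in> carrier G \<Longrightarrow> fin_isometry a"
  by (simp add: carrier_Aut_curve)

lemma Aut_curve_eqI: "a \<in> carrier G \<Longrightarrow> b \<in> carrier G \<Longrightarrow> (\<And>p. p \<in> fin \<Longrightarrow> a p = b p) \<Longrightarrow> a = b"
  by (rule continuous_self_map_eqI) (auto simp: carrier_Aut_curve)

lemma mult_Aut_curve_closed:
  assumes "a \<in> carrier G" "b \<in> carrier G"
  shows "a \<otimes>\<^bsub>G\<^esub> b \<in> carrier G"
proof -
  have "continuous_map topo topo (\<lambda>p. a (b p))"
    using continuous_map_compose[of topo topo b topo a] assms by (simp add: carrier_Aut_curve o_def)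
  from restrict_in_Aut_curve[OF this] show ?thesis
    using fin_isometry_compose[OF Aut_curve_isometry Aut_curve_isometry, OF assms]
    by (simp add: mult_Aut_curve compose_def)
qed

lemma one_Aut_curve_closed: "\<one>\<^bsub>G\<^esub> \<in> carrier G"
proof -
  have "fin_isometry (\<lambda>p. p)" by (auto simp: fin_isometry_def bij_betw_def)
  then show ?thesis using restrict_in_Aut_curve[of "\<lambda>p. p"] by (simp add: one_Aut_curve)
qed

lemma one_Aut_curve_fin: "p \<in> fin \<Longrightarrow> \<one>\<^bsub>G\<^esub> p = p"
  using fin_subset_pts by (auto simp: one_Aut_curve)

lemma group_Aut_curve: "group G"
proof (rule groupI)
  show "\<one>\<^bsub>G\<^esub> \<in> carrier G" by (rule one_Aut_curve_closed)
next
  fix a b assume "a \<in> carrier G" "b \<in> carrier G"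
  then show "a \<otimes>\<^bsub>G\<^esub> b \<in> carrier G" by (rule mult_Aut_curve_closed)
next
  fix a b c assume "a \<in> carrier G" "b \<in> carrier G" "c \<in> carrier G"
  then show "a \<otimes>\<^bsub>G\<^esub> b \<otimes>\<^bsub>G\<^esub> c = a \<otimes>\<^bsub>G\<^esub> (b \<otimes>\<^bsub>G\<^esub> c)"
    by (intro Aut_curve_eqI mult_Aut_curve_closed) (simp_all add: mult_Aut_curve_fin Aut_curve_in_fin)
next
  fix a assume a: "a \<in> carrier G"
  then show "\<one>\<^bsub>G\<^esub> \<otimes>\<^bsub>G\<^esub> a = a"
    by (intro Aut_curve_eqI mult_Aut_curve_closed one_Aut_curve_closed)
      (simp_all add: mult_Aut_curve_fin Aut_curve_in_fin one_Aut_curve_fin)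
  obtain \<psi> where \<psi>: "fin_isometry \<psi>" "\<And>p. p \<in> fin \<Longrightarrow> \<psi> (a p) = p"
    by (rule fin_isometry_inverse[OF Aut_curve_isometry[OF a]]) (rule that)
  obtain b where b: "b \<in> carrier G" "\<And>p. p \<in> fin \<Longrightarrow> b p = \<psi> p"
    by (rule isometry_extends[OF \<psi>(1)]) (rule that)
  have "b \<otimes>\<^bsub>G\<^esub> a = \<one>\<^bsub>G\<^esub>"
    using a b \<psi> by (intro Aut_curve_eqI mult_Aut_curve_closed one_Aut_curve_closed)
      (simp_all add: mult_Aut_curve_fin Aut_curve_in_fin one_Aut_curve_fin)
  then show "\<exists>b\<in>carrier G. b \<otimes>\<^bsub>G\<^esub> a = \<one>\<^bsub>G\<^esub>" using b by blast
qed

section \<open>The action of similarities on rational functions\<close>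

text \<open>The pair \<open>(a, r)\<close> acts by \<open>f \<mapsto> r \<cdot> f \<circ> (a \<circ> \<theta>)\<^sup>-\<^sup>1\<close>, where \<open>\<theta>\<close> is the dilatation by \<open>r\<close>;
  stated without inverses, and at finite points only, this becomes an equation that composes well.\<close>

definition acts :: "((nat, nat) point \<Rightarrow> (nat, nat) point) \<Rightarrow> real \<Rightarrow>
    (((nat, nat) point \<Rightarrow> ereal) \<Rightarrow> (nat, nat) point \<Rightarrow> ereal) \<Rightarrow> bool" where
  "acts a r \<Phi> \<longleftrightarrow> (\<forall>f\<in>carrier R. \<forall>q\<in>fin. \<Phi> f (a (dil r q)) = ereal r * f q)"

lemma similarity_surj:
  assumes "a \<in> carrier G" "0 < r" "p \<in> fin"
  obtains q where "q \<in> fin" "p = a (dil r q)"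
proof -
  have "p \<in> a ` fin" using Aut_curve_isometry[OF assms(1)] assms(3) by (simp add: fin_isometry_def bij_betw_def)
  then obtain q where "q \<in> fin" "p = a q" by blast
  then show ?thesis using assms(2) by (intro that[of "dil (1 / r) q"]) (simp_all add: dil_in_fin dil_inverse)
qed

lemma Aut_semiring_in: "\<Phi> \<in> carrier A \<Longrightarrow> f \<in> carrier R \<Longrightarrow> \<Phi> f \<in> carrier R"
  by (auto simp: carrier_Aut_semiring bij_betw_def)

lemma acts_unique:
  assumes "a \<in> carrier G" "0 < r" "\<Phi> \<in> carrier A" "\<Psi> \<in> carrier A" "acts a r \<Phi>" "acts a r \<Psi>"
  shows "\<Phi> = \<Psi>"
proof (rule extensionalityI)
  show "\<Phi> \<in> extensional (carrier R)" "\<Psi> \<in> extensional (carrier R)"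
    using assms by (auto simp: carrier_Aut_semiring)
  fix f assume f: "f \<in> carrier R"
  show "\<Phi> f = \<Psi> f"
  proof (rule Rat_eqI)
    fix p assume "p \<in> fin"
    then obtain q where "q \<in> fin" "p = a (dil r q)" by (rule similarity_surj[OF assms(1,2)])
    then show "\<Phi> f p = \<Psi> f p" using assms(5,6) f by (simp add: acts_def)
  qed (use f assms Aut_semiring_in in auto)
qed

text \<open>Constants reveal the factor, and distance functions separate points.\<close>

lemma acts_inject:
  assumes a: "a \<in> carrier G" "0 < r" and b: "b \<in> carrier G" "0 < s" and \<Phi>: "acts a r \<Phi>" "acts b s \<Phi>"
  shows "a = b \<and> r = s"
proof -
  have eq: "r * k q = s * k q'" if "q \<in> fin" "q' \<in> fin" "a (dil r q) = b (dil s q')" "PL k" for q q' k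
  proof -
    have "\<Phi> (rat k) (a (dil r q)) = ereal r * rat k q"
      using \<Phi>(1) rat_in_Rat[OF that(4)] that(1) unfolding acts_def by blast
    moreover have "\<Phi> (rat k) (b (dil s q')) = ereal s * rat k q'"
      using \<Phi>(2) rat_in_Rat[OF that(4)] that(2) unfolding acts_def by blast
    ultimately have "ereal r * rat k q = ereal s * rat k q'" using that(3) by simp
    then show ?thesis using that by (simp add: rat_extension)
  qed
  have "a (dil r (Vertex 0)) \<in> fin" using a center_in_fin by (simp add: Aut_curve_in_fin dil_in_fin)
  then obtain q where "q \<in> fin" "a (dil r (Vertex 0)) = b (dil s q)" by (rule similarity_surj[OF b])
  from eq[OF center_in_fin this PL_const, of 1] have rs: "r = s" by simp
  have "a p = b p" if p: "p \<in> fin" for p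
  proof -
    define q where "q = dil (1 / r) p"
    have q: "q \<in> fin" "p = dil r q" using p a by (simp_all add: q_def dil_in_fin dil_inverse)
    have "a p \<in> fin" using a p by (simp add: Aut_curve_in_fin)
    then obtain q' where q': "q' \<in> fin" "a p = b (dil s q')" by (rule similarity_surj[OF b])
    have "star_dist q q = star_dist q q'"
      using eq[OF q(1) q'(1) _ PL_star_dist[OF q(1)]] q(2) q'(2) rs a(2) by simp
    then have "q = q'" using star_dist_eq_0_iff q(1) q'(1) by metis
    then show ?thesis using q q' rs by simp
  qed
  then show ?thesis using Aut_curve_eqI[OF a(1) b(1)] rs by blast
qed

text \<open>The inverse of the action comes from the inverse similarity, so only compatibility with the operations
  and integrality of slopes have to be seen, the latter from \<open>PL_isometry\<close> and \<open>PL_dil\<close>.\<close>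

lemma acts_exists:
  assumes a: "a \<in> carrier G" and r: "0 < r"
  obtains \<Phi> where "\<Phi> \<in> carrier A" "acts a r \<Phi>"
proof -
  obtain \<psi> where \<psi>: "fin_isometry \<psi>" "\<And>p. p \<in> fin \<Longrightarrow> a (\<psi> p) = p" "\<And>p. p \<in> fin \<Longrightarrow> \<psi> (a p) = p"
    by (rule fin_isometry_inverse[OF Aut_curve_isometry[OF a]]) (rule that)
  note ain = Aut_curve_in_fin[OF a] and \<psi>in = fin_isometry_in[OF \<psi>(1)]
  \<comment> \<open>Multiplication by \<open>s\<close> after pulling back along \<open>\<kappa>\<close>, for any similarity \<open>\<kappa>\<close> with the right factor.\<close>
  define T where "T s \<kappa> = (\<lambda>f\<in>carrier R. extend_continuously (star n) (\<lambda>p. ereal s * f (\<kappa> p)))"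
    for s and \<kappa> :: "(nat, nat) point \<Rightarrow> (nat, nat) point"
  have T: "T s \<kappa> f \<in> carrier R \<and> (\<forall>p\<in>fin. T s \<kappa> f p = ereal s * f (\<kappa> p))"
    if f: "f \<in> carrier R" and s: "0 < s" and \<kappa>: "\<And>p. p \<in> fin \<Longrightarrow> \<kappa> p \<in> fin" "\<And>k. PL k \<Longrightarrow> PL (\<lambda>p. s * k (\<kappa> p))" for s \<kappa> f
    using f
  proof (cases rule: Rat_cases)
    case neg_inf
    have "T s \<kappa> f = neg_inf"
      unfolding T_def using f s \<kappa>(1) by (simp add: neg_inf neg_inf_fin extend_eqI neg_inf_extensional neg_inf_continuous)
    then show ?thesis using neg_inf s \<kappa>(1) neg_inf_in_Rat by (simp add: neg_inf_fin)
  next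
    case (rat k)
    note PL = \<kappa>(2)[OF rat(1)]
    have "T s \<kappa> f = rat (\<lambda>p. s * k (\<kappa> p))"
      unfolding T_def using f rat \<kappa>(1) rat_extension[OF PL] by (simp add: extend_eqI rat_extension)
    then show ?thesis using rat PL \<kappa>(1) by (simp add: rat_in_Rat rat_extension)
  qed
  define \<kappa> where "\<kappa> p = dil (1 / r) (\<psi> p)" for p
  define \<kappa>' where "\<kappa>' p = a (dil r p)" for p
  have \<kappa>: "\<kappa> p \<in> fin" "\<kappa>' p \<in> fin" "\<kappa> (\<kappa>' p) = p" "\<kappa>' (\<kappa> p) = p" if "p \<in> fin" for p
    using that r ain \<psi>in \<psi> by (simp_all add: \<kappa>_def \<kappa>'_def dil_in_fin dil_inverse)
  have PL: "PL (\<lambda>p. r * k (\<kappa> p))" if "PL k" for k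
    using PL_isometry[OF \<psi>(1) PL_dil[OF r that]] by (simp add: \<kappa>_def)
  have PL': "PL (\<lambda>p. 1 / r * k (\<kappa>' p))" if "PL k" for k
    using PL_dil[of "1 / r", OF _ PL_isometry[OF Aut_curve_isometry[OF a] that]] r by (simp add: \<kappa>'_def)
  note T1 = T[of _ r \<kappa>, OF _ r \<kappa>(1) PL]
  have r': "0 < 1 / r" using r by simp
  note T2 = T[of _ "1 / r" \<kappa>', OF _ r' \<kappa>(2) PL']
  have scale: "ereal u * (ereal v * x) = x" if "u * v = 1" for u v x
    using that by (simp flip: mult.assoc add: one_ereal_def[symmetric])
  have inv: "T (1 / r) \<kappa>' (T r \<kappa> f) = f" "T r \<kappa> (T (1 / r) \<kappa>' f) = f" if f: "f \<in> carrier R" for f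
    using r f T1[OF f] T2[OF f] T1[of "T (1 / r) \<kappa>' f"] T2[of "T r \<kappa> f"]
    by (auto intro!: Rat_eqI simp: \<kappa> scale)
  have "T r \<kappa> \<in> ring_hom R R"
  proof (rule ring_hom_memI)
    fix f g assume fg: "f \<in> carrier R" "g \<in> carrier R"
    have not_PInf: "f p \<noteq> \<infinity>" "g p \<noteq> \<infinity>" if "p \<in> fin" for p
      using that fg by (auto elim!: Rat_cases simp: neg_inf_fin rat_extension)
    have distrib: "ereal r * (x + y) = ereal r * x + ereal r * y" if "x \<noteq> \<infinity>" "y \<noteq> \<infinity>" for x y
      using that r by (cases x; cases y) (auto simp: distrib_left)
    show "T r \<kappa> (f \<otimes>\<^bsub>R\<^esub> g) = T r \<kappa> f \<otimes>\<^bsub>R\<^esub> T r \<kappa> g"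
      using fg T1 mult_Rat by (intro Rat_eqI) (simp_all add: \<kappa> distrib not_PInf)
    have max: "ereal r * max x y = max (ereal r * x) (ereal r * y)" for x y
      using r by (cases x; cases y) (auto simp: max_def)
    show "T r \<kappa> (f \<oplus>\<^bsub>R\<^esub> g) = T r \<kappa> f \<oplus>\<^bsub>R\<^esub> T r \<kappa> g"
      using fg T1 add_Rat by (intro Rat_eqI) (simp_all add: \<kappa> max)
  next
    have one: "\<one>\<^bsub>R\<^esub> \<in> carrier R" by (simp add: one_Rat rat_in_Rat PL_const)
    then show "T r \<kappa> \<one>\<^bsub>R\<^esub> = \<one>\<^bsub>R\<^esub>"
      using T1[OF one] by (intro Rat_eqI) (simp_all add: one_Rat rat_extension PL_const \<kappa>)
  qed (use T1 in blast)
  moreover have "T r \<kappa> neg_inf = neg_inf"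
    using T1[OF neg_inf_in_Rat] r by (intro Rat_eqI neg_inf_in_Rat) (simp_all add: neg_inf_fin \<kappa>)
  moreover have "bij_betw (T r \<kappa>) (carrier R) (carrier R)"
    by (rule bij_betw_byWitness[of _ "T (1 / r) \<kappa>'"]) (use inv T1 T2 in auto)
  ultimately have "T r \<kappa> \<in> carrier A" by (simp add: carrier_Aut_semiring T_def)
  moreover have "acts a r (T r \<kappa>)"
    unfolding acts_def using T1 \<kappa> by (auto simp flip: \<kappa>'_def)
  ultimately show ?thesis by (rule that)
qed

lemma acts_surj:
  assumes \<Phi>: "\<Phi> \<in> carrier A"
  obtains a r where "a \<in> carrier G" "0 < r" "acts a r \<Phi>"
proof -
  obtain r \<psi> where r: "0 < r" "fin_isometry \<psi>"
    "\<And>k q. PL k \<Longrightarrow> q \<in> fin \<Longrightarrow> \<Phi> (rat k) (\<psi> (dil r q)) = ereal (r * k q)"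
    by (rule Aut_semiring_similarity[OF \<Phi>]) (rule that)
  obtain a where a: "a \<in> carrier G" "\<And>p. p \<in> fin \<Longrightarrow> a p = \<psi> p"
    by (rule isometry_extends[OF r(2)]) (rule that)
  have "\<Phi> f (a (dil r q)) = ereal r * f q" if f: "f \<in> carrier R" and q: "q \<in> fin" for f q
    using f
  proof (cases rule: Rat_cases)
    case neg_inf
    then have "\<Phi> f = neg_inf" using \<Phi> by (simp add: carrier_Aut_semiring)
    then show ?thesis using neg_inf q r(1) a(1) by (simp add: neg_inf_fin Aut_curve_in_fin dil_in_fin)
  next
    case (rat k)
    then show ?thesis using r q a(2) by (simp add: rat_extension dil_in_fin)
  qed
  then show ?thesis using a(1) r(1) by (intro that) (auto simp: acts_def)
qed

text \<open>Conjugation of an automorphism with the dilatation by \<open>r\<close>, on any star; for \<open>n = 2\<close> this is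
  \<^const>\<open>conj_dilatation\<close>.\<close>

definition conj_dil :: "real \<Rightarrow> ((nat, nat) point \<Rightarrow> (nat, nat) point) \<Rightarrow> (nat, nat) point \<Rightarrow> (nat, nat) point" where
  "conj_dil r a = (\<lambda>p\<in>pts. dil r (a (dil (1 / r) p)))"

lemma dil_continuous:
  assumes r: "0 < r"
  shows "continuous_map topo topo (dil r)"
  unfolding continuous_map_star_iff
proof (intro conjI ballI)
  have "dil r p \<in> pts" if "p \<in> pts" for p
    using that r fin_subset_pts dil_in_fin[OF r] by (auto simp: pts_fin)
  then show "dil r \<in> pts \<rightarrow> topspace topo" by (auto simp: topspace_star)
  fix i assume i: "i \<in> {1..n}"
  have "continuous_map (top_of_set {0..}) (top_of_set {0..}) (\<lambda>t. ereal r * t)"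
    using r by (auto simp: continuous_on_def intro!: tendsto_cmult_ereal tendsto_ident_at)
  from continuous_map_compose[OF this chart_continuous[OF i]]
  have "continuous_map (top_of_set {0..}) topo (\<lambda>t. chart (star n) i (ereal r * t))" by (simp add: o_def)
  then show "continuous_map (top_of_set {0..}) topo (\<lambda>t. dil r (chart (star n) i t))"
    by (rule continuous_map_eq) (use r in \<open>auto simp: chart_star ereal_mult_eq_PInfty\<close>)
qed

lemma conj_dil_Aut_curve:
  assumes a: "a \<in> carrier G" and r: "0 < r"
  shows "conj_dil r a \<in> carrier G"
proof -
  have r': "0 < 1 / r" using r by simp
  have "continuous_map topo topo a" using a by (simp add: carrier_Aut_curve)
  then have "continuous_map topo topo (dil r \<circ> (a \<circ> dil (1 / r)))"
    by (intro continuous_map_compose[OF continuous_map_compose[OF dil_continuous[OF r']] dil_continuous[OF r]])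
  then have 1: "continuous_map topo topo (\<lambda>p. dil r (a (dil (1 / r) p)))" by (simp add: o_def)
  obtain \<psi> where \<psi>: "fin_isometry \<psi>" "\<And>p. p \<in> fin \<Longrightarrow> a (\<psi> p) = p" "\<And>p. p \<in> fin \<Longrightarrow> \<psi> (a p) = p"
    by (rule fin_isometry_inverse[OF Aut_curve_isometry[OF a]]) (rule that)
  note ain = Aut_curve_in_fin[OF a] and \<psi>in = fin_isometry_in[OF \<psi>(1)]
  have "bij_betw (\<lambda>p. dil r (a (dil (1 / r) p))) fin fin"
    by (rule bij_betw_byWitness[of _ "\<lambda>p. dil r (\<psi> (dil (1 / r) p))"])
      (use r r' ain \<psi> \<psi>in in \<open>auto simp: dil_inverse dil_in_fin\<close>)
  moreover have "star_dist (dil r (a (dil (1 / r) p))) (dil r (a (dil (1 / r) q))) = star_dist p q"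
    if "p \<in> fin" "q \<in> fin" for p q
    using that r r' ain Aut_curve_isometry[OF a] by (simp add: star_dist_dil dil_in_fin fin_isometry_def)
  ultimately have "fin_isometry (\<lambda>p. dil r (a (dil (1 / r) p)))" by (simp add: fin_isometry_def)
  from restrict_in_Aut_curve[OF 1 this] show ?thesis by (simp add: conj_dil_def)
qed

text \<open>In the product of two similarities the dilatation of the first one is moved past \<open>b\<close>, at the price of
  conjugating \<open>b\<close>.\<close>

lemma acts_mult:
  assumes a: "a \<in> carrier G" "0 < r" and b: "b \<in> carrier G" "0 < s"
    and \<Phi>: "acts a r \<Phi>" and \<Psi>: "acts b s \<Psi>" "\<Psi> \<in> carrier A"
  shows "acts (a \<otimes>\<^bsub>G\<^esub> conj_dil r b) (r * s) (compose (carrier R) \<Phi> \<Psi>)"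
  unfolding acts_def
proof (intro ballI)
  fix f q assume f: "f \<in> carrier R" and q: "q \<in> fin"
  have rs: "0 < r * s" and r': "0 < 1 / r" using a b by auto
  have "conj_dil r b (dil (r * s) q) = dil r (b (dil s q))"
    using q rs a b r' fin_subset_pts dil_in_fin[OF rs q] by (auto simp: conj_dil_def dil_dil)
  then have "(a \<otimes>\<^bsub>G\<^esub> conj_dil r b) (dil (r * s) q) = a (dil r (b (dil s q)))"
    by (simp add: mult_Aut_curve_fin dil_in_fin[OF rs q])
  moreover have "\<Phi> (\<Psi> f) (a (dil r (b (dil s q)))) = ereal r * \<Psi> f (b (dil s q))"
    using \<Phi> Aut_semiring_in[OF \<Psi>(2) f] Aut_curve_in_fin[OF b(1)] dil_in_fin[OF b(2) q] by (simp add: acts_def)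
  moreover have "\<Psi> f (b (dil s q)) = ereal s * f q" using \<Psi>(1) f q by (simp add: acts_def)
  ultimately show "compose (carrier R) \<Phi> \<Psi> f ((a \<otimes>\<^bsub>G\<^esub> conj_dil r b) (dil (r * s) q)) = ereal (r * s) * f q"
    using f by (simp add: compose_def mult.assoc flip: times_ereal.simps(1))
qed

lemma mult_Aut_semiring: "\<Phi> \<otimes>\<^bsub>A\<^esub> \<Psi> = compose (carrier R) \<Phi> \<Psi>"
  by (simp add: Aut_semiring_def composition_group_def)

lemma mult_Aut_semiring_closed:
  assumes "\<Phi> \<in> carrier A" "\<Psi> \<in> carrier A"
  shows "\<Phi> \<otimes>\<^bsub>A\<^esub> \<Psi> \<in> carrier A"
proof -
  have hom: "\<Phi> \<in> ring_hom R R" "\<Psi> \<in> ring_hom R R" using assms by (auto simp: carrier_Aut_semiring)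
  have one: "\<one>\<^bsub>R\<^esub> \<in> carrier R" by (simp add: one_Rat rat_in_Rat PL_const)
  have "compose (carrier R) \<Phi> \<Psi> \<in> ring_hom R R"
    by (rule ring_hom_memI)
      (use assms hom one in \<open>simp_all add: compose_def Aut_semiring_in mult_Rat add_Rat ring_hom_mult ring_hom_add ring_hom_one\<close>)
  moreover have "bij_betw (compose (carrier R) \<Phi> \<Psi>) (carrier R) (carrier R)"
    by (rule bij_betw_compose) (use assms in \<open>auto simp: carrier_Aut_semiring\<close>)
  ultimately show ?thesis
    using assms by (simp add: mult_Aut_semiring carrier_Aut_semiring compose_def neg_inf_in_Rat)
qed

text \<open>The pair attached to an automorphism is unique by \<open>acts_inject\<close> and exists by \<open>acts_surj\<close>; every pair
  occurs, for a single automorphism, by \<open>acts_exists\<close> and \<open>acts_unique\<close>.\<close>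

lemma Aut_semiring_semidirect:
  assumes act: "\<And>a r. a \<in> carrier G \<Longrightarrow> 0 < r \<Longrightarrow> act r a = conj_dil r a"
  shows "A \<cong> semidirect_product G pos_real_group act"
proof -
  have "\<forall>\<Phi>\<in>carrier A. \<exists>x. fst x \<in> carrier G \<and> 0 < snd x \<and> acts (fst x) (snd x) \<Phi>"
    using acts_surj by (metis fst_conv snd_conv)
  from bchoice[OF this] obtain h where h: "\<And>\<Phi>. \<Phi> \<in> carrier A \<Longrightarrow> fst (h \<Phi>) \<in> carrier G"
      "\<And>\<Phi>. \<Phi> \<in> carrier A \<Longrightarrow> 0 < snd (h \<Phi>)" "\<And>\<Phi>. \<Phi> \<in> carrier A \<Longrightarrow> acts (fst (h \<Phi>)) (snd (h \<Phi>)) \<Phi>"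
    by blast
  have carrier: "carrier (semidirect_product G pos_real_group act) = carrier G \<times> {0<..}"
    by (simp add: semidirect_product_def pos_real_group_def)
  have h_in: "h \<Phi> \<in> carrier (semidirect_product G pos_real_group act)" if "\<Phi> \<in> carrier A" for \<Phi>
    using h(1,2)[OF that] by (simp add: carrier mem_Times_iff)
  show ?thesis
  proof (rule is_iso_by_bijective_hom)
    show "h \<in> hom A (semidirect_product G pos_real_group act)"
    proof (rule homI)
      fix \<Phi> assume "\<Phi> \<in> carrier A"
      then show "h \<Phi> \<in> carrier (semidirect_product G pos_real_group act)" by (rule h_in)
    next
      fix \<Phi> \<Psi> assume \<Phi>: "\<Phi> \<in> carrier A" and \<Psi>: "\<Psi> \<in> carrier A"
      note P = mult_Aut_semiring_closed[OF \<Phi> \<Psi>]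
      obtain a r where ar: "h \<Phi> = (a, r)" by (cases "h \<Phi>")
      obtain b s where bs: "h \<Psi> = (b, s)" by (cases "h \<Psi>")
      have a: "a \<in> carrier G" "0 < r" "acts a r \<Phi>" using h[OF \<Phi>] by (auto simp: ar)
      have b: "b \<in> carrier G" "0 < s" "acts b s \<Psi>" using h[OF \<Psi>] by (auto simp: bs)
      have "acts (a \<otimes>\<^bsub>G\<^esub> conj_dil r b) (r * s) (\<Phi> \<otimes>\<^bsub>A\<^esub> \<Psi>)"
        unfolding mult_Aut_semiring by (rule acts_mult[OF a(1,2) b(1,2) a(3) b(3) \<Psi>])
      moreover have "a \<otimes>\<^bsub>G\<^esub> conj_dil r b \<in> carrier G"
        by (intro mult_Aut_curve_closed conj_dil_Aut_curve a b)
      moreover have "0 < r * s" using a(2) b(2) by simp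
      ultimately have "fst (h (\<Phi> \<otimes>\<^bsub>A\<^esub> \<Psi>)) = a \<otimes>\<^bsub>G\<^esub> conj_dil r b \<and> snd (h (\<Phi> \<otimes>\<^bsub>A\<^esub> \<Psi>)) = r * s"
        by (intro acts_inject[OF h(1,2)[OF P] _ _ h(3)[OF P]])
      then show "h (\<Phi> \<otimes>\<^bsub>A\<^esub> \<Psi>) = h \<Phi> \<otimes>\<^bsub>semidirect_product G pos_real_group act\<^esub> h \<Psi>"
        using act[OF b(1) a(2)] by (simp add: ar bs semidirect_product_def pos_real_group_def prod_eq_iff)
    qed
    show "inj_on h (carrier A)"
    proof (rule inj_onI)
      fix \<Phi> \<Psi> assume \<Phi>: "\<Phi> \<in> carrier A" and \<Psi>: "\<Psi> \<in> carrier A" and eq: "h \<Phi> = h \<Psi>"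
      show "\<Phi> = \<Psi>" by (rule acts_unique[OF h(1,2)[OF \<Phi>] \<Phi> \<Psi> h(3)[OF \<Phi>]]) (use h(3)[OF \<Psi>] eq in simp)
    qed
  next
    fix x assume "x \<in> carrier (semidirect_product G pos_real_group act)"
    then obtain a r where x: "x = (a, r)" "a \<in> carrier G" "0 < r" by (auto simp: carrier)
    obtain \<Phi> where \<Phi>: "\<Phi> \<in> carrier A" "acts a r \<Phi>" by (rule acts_exists[OF x(2,3)]) (rule that)
    have "fst (h \<Phi>) = a \<and> snd (h \<Phi>) = r"
      using acts_inject[OF h(1,2)[OF \<Phi>(1)] x(2,3) h(3)[OF \<Phi>(1)] \<Phi>(2)] .
    then have "x = h \<Phi>" using x by (simp add: prod_eq_iff)
    then show "x \<in> h ` carrier A" using \<Phi>(1) by blast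
  qed
qed

section \<open>More or fewer than two copies\<close>

lemma permute_legs_fin: "\<sigma> permutes {1..n} \<Longrightarrow> p \<in> fin \<Longrightarrow> permute_legs \<sigma> p \<in> fin"
  using Aut_curve_in_fin[OF permute_legs_Aut_curve] fin_subset_pts by (metis restrict_apply' subsetD)

lemma Aut_curve_symmetric:
  assumes n2: "n \<noteq> 2"
  shows "G \<cong> sym_group n"
proof -
  define F where "F \<sigma> = restrict (permute_legs \<sigma>) pts" for \<sigma>
  have F: "F \<sigma> p = permute_legs \<sigma> p" if "p \<in> fin" for \<sigma> p
    using that fin_subset_pts by (auto simp: F_def)
  have F_in: "F \<sigma> \<in> carrier G" if "\<sigma> permutes {1..n}" for \<sigma>
    unfolding F_def by (rule permute_legs_Aut_curve[OF that])
  have "sym_group n \<cong> G"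
  proof (rule is_iso_by_bijective_hom)
    show "F \<in> hom (sym_group n) G"
    proof (rule homI)
      fix \<sigma> \<tau> assume "\<sigma> \<in> carrier (sym_group n)" "\<tau> \<in> carrier (sym_group n)"
      then have \<sigma>: "\<sigma> permutes {1..n}" and \<tau>: "\<tau> permutes {1..n}" by (simp_all add: sym_group_carrier)
      have comp: "permute_legs (\<sigma> \<circ> \<tau>) p = permute_legs \<sigma> (permute_legs \<tau> p)" for p
        by (cases p) auto
      have "F (\<sigma> \<circ> \<tau>) = F \<sigma> \<otimes>\<^bsub>G\<^esub> F \<tau>"
        by (intro Aut_curve_eqI mult_Aut_curve_closed F_in permutes_compose \<sigma> \<tau>)
          (simp add: mult_Aut_curve_fin F permute_legs_fin[OF \<tau>] comp)
      then show "F (\<sigma> \<otimes>\<^bsub>sym_group n\<^esub> \<tau>) = F \<sigma> \<otimes>\<^bsub>G\<^esub> F \<tau>" by (simp add: sym_group_mult)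
    qed (simp add: F_in sym_group_carrier)
    show "inj_on F (carrier (sym_group n))"
    proof (rule inj_onI)
      fix \<sigma> \<tau> assume "\<sigma> \<in> carrier (sym_group n)" "\<tau> \<in> carrier (sym_group n)" and eq: "F \<sigma> = F \<tau>"
      then have \<sigma>: "\<sigma> permutes {1..n}" and \<tau>: "\<tau> permutes {1..n}" by (simp_all add: sym_group_carrier)
      have "\<sigma> i = \<tau> i" if i: "i \<in> {1..n}" for i
      proof -
        have "permute_legs \<sigma> (ray i 1) = permute_legs \<tau> (ray i 1)"
          using eq F[OF ray_in_fin[OF i zero_le_one]] by metis
        then show ?thesis
          by (simp add: permute_legs_ray[of \<sigma>, OF permutation_fixes_0[OF \<sigma>]] permute_legs_ray[of \<tau>, OF permutation_fixes_0[OF \<tau>]] ray_eq_iff)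
      qed
      moreover have "\<sigma> i = \<tau> i" if "i \<notin> {1..n}" for i
        using permutes_not_in[OF \<sigma> that] permutes_not_in[OF \<tau> that] by simp
      ultimately show "\<sigma> = \<tau>" by (intro ext) blast
    qed
  next
    fix a assume a: "a \<in> carrier G"
    obtain \<sigma> where \<sigma>: "\<sigma> permutes {1..n}" "\<And>p. p \<in> fin \<Longrightarrow> a p = permute_legs \<sigma> p"
      by (rule fin_isometry_permutation[OF Aut_curve_isometry[OF a] n2]) (rule that)
    have "a = F \<sigma>" by (rule Aut_curve_eqI[OF a F_in[OF \<sigma>(1)]]) (simp add: F \<sigma>(2))
    then show "a \<in> F ` carrier (sym_group n)" using \<sigma>(1) by (simp add: sym_group_carrier)
  qed
  then show ?thesis by (rule group.iso_sym[OF sym_group_is_group])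
qed

text \<open>Permutations of the copies commute with dilatations, so the action is trivial.\<close>

lemma Aut_semiring_direct:
  assumes n2: "n \<noteq> 2"
  shows "A \<cong> G \<times>\<times> pos_real_group"
proof -
  have "a = conj_dil r a" if a: "a \<in> carrier G" and r: "0 < r" for a r
  proof (rule Aut_curve_eqI[OF a conj_dil_Aut_curve[OF a r]])
    obtain \<sigma> where \<sigma>: "\<sigma> permutes {1..n}" "\<And>p. p \<in> fin \<Longrightarrow> a p = permute_legs \<sigma> p"
      by (rule fin_isometry_permutation[OF Aut_curve_isometry[OF a] n2]) (rule that)
    fix p assume p: "p \<in> fin"
    then obtain i t where i: "i \<in> {1..n}" "0 \<le> t" "p = ray i t" by (rule finE)
    have r': "0 < 1 / r" using r by simp
    have "conj_dil r a p = dil r (permute_legs \<sigma> (dil (1 / r) p))"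
      using p fin_subset_pts dil_in_fin[OF r' p] by (auto simp: conj_dil_def \<sigma>(2))
    also have "\<dots> = permute_legs \<sigma> p"
      using r r' by (simp add: i dil_ray permute_legs_ray[of \<sigma>, OF permutation_fixes_0[OF \<sigma>(1)]])
    finally show "a p = conj_dil r a p" using \<sigma>(2)[OF p] by simp
  qed
  then have "A \<cong> semidirect_product G pos_real_group (\<lambda>r a. a)" by (rule Aut_semiring_semidirect)
  also have "semidirect_product G pos_real_group (\<lambda>r a. a) = G \<times>\<times> pos_real_group"
    by (simp add: semidirect_product_def DirProd_def)
  finally show ?thesis .
qed

end

section \<open>Two copies\<close>

lemma line_map_fin: "line_map s t (line_point (ereal y)) = line_point (ereal (s * y + t))"
  by (simp add: line_map_line_point)

lemma line_map_inject: "line_map s t = line_map s' t' \<longleftrightarrow> s = s' \<and> t = t'"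
proof
  assume "line_map s t = line_map s' t'"
  then have "s * y + t = s' * y + t'" for y
    using line_map_fin[of s t y] line_map_fin[of s' t' y] by (simp add: line_point_inject)
  from this[of 0] this[of 1] show "s = s' \<and> t = t'" by simp
qed simp

lemma line_map_mult:
  assumes "s = 1 \<or> s = -1" "s' = 1 \<or> s' = -1"
  shows "line_map s t \<otimes>\<^bsub>line.G\<^esub> line_map s' t' = line_map (s * s') (s * t' + t)"
proof (intro line.Aut_curve_eqI line.mult_Aut_curve_closed line_map_Aut_curve assms)
  show "s * s' = 1 \<or> s * s' = - 1" using assms by auto
  fix p assume p: "p \<in> line.fin"
  then obtain y where y: "p = line_point (ereal y)" unfolding line_fin by blast
  show "(line_map s t \<otimes>\<^bsub>line.G\<^esub> line_map s' t') p = line_map (s * s') (s * t' + t) p"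
    using p unfolding y by (simp add: line.mult_Aut_curve_fin line_map_fin algebra_simps)
qed

lemma line_map_one: "line_map 1 0 = \<one>\<^bsub>line.G\<^esub>"
proof (rule line.Aut_curve_eqI[OF line_map_Aut_curve line.one_Aut_curve_closed])
  fix p assume p: "p \<in> line.fin"
  then obtain y where "p = line_point (ereal y)" unfolding line_fin by blast
  then show "line_map 1 0 p = \<one>\<^bsub>line.G\<^esub> p" using line.one_Aut_curve_fin[OF p] by (simp add: line_map_fin)
qed simp

lemma Aut_curve_lineE:
  assumes a: "a \<in> carrier line.G"
  obtains s t where "s = 1 \<or> s = -1" "a = line_map s t"
proof -
  obtain s t where st: "s = 1 \<or> s = -1" "\<And>p. p \<in> line.fin \<Longrightarrow> a p = line_map s t p"
    by (rule line_isometry[OF line.Aut_curve_isometry[OF a]]) (rule that)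
  show ?thesis
    by (rule that[OF st(1) line.Aut_curve_eqI[OF a line_map_Aut_curve[OF st(1)] st(2)]])
qed

lemma line_translation_eq: "line_translation t = line_map 1 t"
  by (simp add: line_translation_def line_map_def flip: one_ereal_def)

lemma inversion_line_point: "inversion (line_point (ereal c)) = line_map (-1) (2 * c)"
proof -
  have "2 * ereal c - y = ereal (-1) * y + ereal (2 * c)" for y
    by (cases y) auto
  then show ?thesis by (simp add: inversion_def line_map_def line_coord_line_point)
qed

lemma iota_eq: "iota = line_map (-1) 0"
  using inversion_line_point[of 0] by (simp add: iota_def zero_ereal_def)

text \<open>A translation is a product of two inversions.\<close>

lemma Aut_curve_line_generated:
  "carrier line.G = generate line.G {inversion x | x. x \<in> line.fin}"
proof
  interpret group line.G by (rule line.group_Aut_curve)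
  have inv: "line_map (-1) t \<in> {inversion x | x. x \<in> line.fin}" for t
  proof -
    have "line_map (-1) t = inversion (line_point (ereal (t / 2)))" by (simp add: inversion_line_point)
    moreover have "line_point (ereal (t / 2)) \<in> line.fin" by (simp add: line_fin)
    ultimately show ?thesis by blast
  qed
  show "carrier line.G \<subseteq> generate line.G {inversion x | x. x \<in> line.fin}"
  proof
    fix a assume "a \<in> carrier line.G"
    then obtain s t where st: "s = 1 \<or> s = -1" "a = line_map s t" by (rule Aut_curve_lineE)
    have "line_map (-1) t \<otimes>\<^bsub>line.G\<^esub> line_map (-1) 0 \<in> generate line.G {inversion x | x. x \<in> line.fin}"
      by (intro generate.eng generate.incl inv)
    then have "line_map 1 t \<in> generate line.G {inversion x | x. x \<in> line.fin}"
      by (simp add: line_map_mult)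
    then show "a \<in> generate line.G {inversion x | x. x \<in> line.fin}"
      using st generate.incl[OF inv] by auto
  qed
  have "{inversion x | x. x \<in> line.fin} \<subseteq> carrier line.G"
    using line_map_Aut_curve by (auto simp: line_fin inversion_line_point)
  then show "generate line.G {inversion x | x. x \<in> line.fin} \<subseteq> carrier line.G" by (rule generate_incl)
qed

lemma carrier_generated_iota:
  "carrier (subgroup_generated line.G {iota}) = {line_map 1 0, line_map (-1) 0}"
proof -
  interpret group line.G by (rule line.group_Aut_curve)
  have iota: "line_map (-1) 0 \<in> carrier line.G" by (rule line_map_Aut_curve) simp
  have inv: "inv\<^bsub>line.G\<^esub> line_map (-1) 0 = line_map (-1) 0"
    by (rule inv_equality) (simp_all add: line_map_mult iota flip: line_map_one)
  have "generate line.G {line_map (-1) 0} = {line_map 1 0, line_map (-1) 0}"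
  proof
    show "generate line.G {line_map (-1) 0} \<subseteq> {line_map 1 0, line_map (-1) 0}"
    proof
      fix a assume "a \<in> generate line.G {line_map (-1) 0}"
      then show "a \<in> {line_map 1 0, line_map (-1) 0}"
        by induction (auto simp: line_map_one[symmetric] inv line_map_mult)
    qed
    show "{line_map 1 0, line_map (-1) 0} \<subseteq> generate line.G {line_map (-1) 0}"
      using generate.one[of line.G] generate.incl[of "line_map (-1) 0"] by (auto simp: line_map_one)
  qed
  then show ?thesis using iota by (simp add: carrier_subgroup_generated iota_eq)
qed

lemma conj_translation_eq:
  assumes s: "s = 1 \<or> s = -1"
  shows "conj_translation (line_map s 0) t = s * t"
proof -
  interpret group line.G by (rule line.group_Aut_curve)
  have "inv\<^bsub>line.G\<^esub> line_map s 0 = line_map s 0"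
    by (rule inv_equality) (use s line_map_Aut_curve[OF s] in \<open>auto simp: line_map_mult simp flip: line_map_one\<close>)
  then have "line_map s 0 \<otimes>\<^bsub>line.G\<^esub> line_translation t \<otimes>\<^bsub>line.G\<^esub> inv\<^bsub>line.G\<^esub> line_map s 0 = line_map 1 (s * t)"
    using s by (auto simp: line_translation_eq line_map_mult)
  then show ?thesis
    unfolding conj_translation_def by (simp add: line_translation_eq line_map_inject)
qed

text \<open>The map \<open>line_map s t\<close> is \<open>line_map s 0\<close>, which is the identity or \<^const>\<open>iota\<close>, followed by the
  translation by \<open>t\<close>.\<close>

lemma Aut_curve_line_semidirect:
  "line.G \<cong> semidirect_product real_add_group (subgroup_generated line.G {iota}) conj_translation"
  (is "_ \<cong> ?S")
proof -
  have "\<forall>a\<in>carrier line.G. \<exists>x. (fst x = 1 \<or> fst x = -1) \<and> a = line_map (fst x) (snd x)"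
    using Aut_curve_lineE by (metis fst_conv snd_conv)
  from bchoice[OF this] obtain x where x: "\<And>a. a \<in> carrier line.G \<Longrightarrow> fst (x a) = 1 \<or> fst (x a) = -1"
      "\<And>a. a \<in> carrier line.G \<Longrightarrow> a = line_map (fst (x a)) (snd (x a))" by blast
  define h where "h a = (snd (x a), line_map (fst (x a)) 0)" for a
  have h: "h (line_map s t) = (t, line_map s 0)" if "s = 1 \<or> s = -1" for s t
    using x(2)[OF line_map_Aut_curve[OF that, of t]] by (simp add: h_def line_map_inject)
  have carrier: "carrier ?S = UNIV \<times> {line_map 1 0, line_map (-1) 0}"
    by (simp add: semidirect_product_def real_add_group_def carrier_generated_iota)
  have mult: "(t, line_map s 0) \<otimes>\<^bsub>?S\<^esub> (t', line_map s' 0) = (t + s * t', line_map (s * s') 0)"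
    if "s = 1 \<or> s = -1" "s' = 1 \<or> s' = -1" for s t s' t'
    using that by (simp add: semidirect_product_def real_add_group_def subgroup_generated_def
        conj_translation_eq line_map_mult)
  show ?thesis
  proof (rule is_iso_by_bijective_hom)
    show "h \<in> hom line.G ?S"
    proof (rule homI)
      fix a assume "a \<in> carrier line.G"
      then show "h a \<in> carrier ?S" using x(1)[of a] by (auto simp: h_def carrier)
    next
      fix a b assume "a \<in> carrier line.G" "b \<in> carrier line.G"
      then obtain s t s' t' where s: "s = 1 \<or> s = -1" "a = line_map s t" "s' = 1 \<or> s' = -1" "b = line_map s' t'"
        by (metis Aut_curve_lineE)
      have "s * s' = 1 \<or> s * s' = -1" using s by auto
      then show "h (a \<otimes>\<^bsub>line.G\<^esub> b) = h a \<otimes>\<^bsub>?S\<^esub> h b"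
        unfolding s(2,4) line_map_mult[OF s(1,3)] h[OF s(1)] h[OF s(3)] mult[OF s(1,3)]
        by (simp add: h add.commute)
    qed
    show "inj_on h (carrier line.G)"
    proof (rule inj_onI)
      fix a b assume a: "a \<in> carrier line.G" and b: "b \<in> carrier line.G" and "h a = h b"
      then show "a = b" using x(2)[OF a] x(2)[OF b] by (simp add: h_def line_map_inject)
    qed
  next
    fix y assume "y \<in> carrier ?S"
    then obtain s t where s: "s = 1 \<or> s = -1" "y = (t, line_map s 0)" by (auto simp: carrier)
    then show "y \<in> h ` carrier line.G"
      using h[OF s(1), of t] line_map_Aut_curve[OF s(1), of t] by (metis imageI)
  qed
qed

text \<open>The two maps agree at finite points by inspection and are continuous, so they agree at the points at
  infinity.\<close>

lemma dilatation_eq_dil: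
  assumes r: "0 < r" and p: "p \<in> line.pts"
  shows "dilatation r p = dil r p"
proof -
  have "dilatation r = restrict (dil r) line.pts"
  proof (rule line.continuous_self_map_eqI)
    show "dilatation r \<in> extensional line.pts" by (simp add: dilatation_def on_line_def)
    have "continuous_on UNIV (\<lambda>y. ereal r * y)"
      unfolding continuous_on_def by (intro ballI tendsto_cmult_ereal tendsto_ident_at) auto
    then show "continuous_map line.topo line.topo (dilatation r)"
      unfolding dilatation_def by (rule on_line_continuous)
    show "continuous_map line.topo line.topo (restrict (dil r) line.pts)"
      using line.dil_continuous[OF r] by (rule continuous_map_eq) (simp add: line.topspace_star)
    fix p assume "p \<in> line.fin"
    then obtain y where y: "p = line_point (ereal y)" unfolding line_fin by blast
    show "dilatation r p = restrict (dil r) line.pts p"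
      using r unfolding y
      by (simp add: dilatation_def on_line_line_point line_point_in_pts)
        (auto simp: line_point_ereal dil_ray zero_le_mult_iff)
  qed simp
  then show ?thesis using p by simp
qed

lemma conj_dilatation_eq:
  assumes a: "a \<in> carrier line.G" and r: "0 < r"
  shows "conj_dilatation r a = line.conj_dil r a"
proof -
  have val: "dilatation s (line_point y) = line_point (ereal s * y)" for s y
    by (simp add: dilatation_def on_line_line_point)
  have inj: "inj_on (dilatation r) line.pts"
  proof (rule inj_onI)
    fix p q assume "p \<in> line.pts" "q \<in> line.pts" and eq: "dilatation r p = dilatation r q"
    then obtain y z where yz: "p = line_point y" "q = line_point z" by (metis line_pointE)
    then have "ereal r * y = ereal r * z" using eq by (simp add: val line_point_inject)
    then show "p = q" using r yz by (cases y; cases z) (auto split: if_splits)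
  qed
  have "the_inv_into line.pts (dilatation r) p = dil (1 / r) p" if p: "p \<in> line.pts" for p
  proof -
    obtain y where y: "p = line_point y" using p by (rule line_pointE)
    have "dilatation r (dilatation (1 / r) p) = p"
      using r by (cases y) (auto simp: y val)
    moreover have "dilatation (1 / r) p \<in> line.pts" by (simp add: y val line_point_in_pts)
    ultimately have "the_inv_into line.pts (dilatation r) p = dilatation (1 / r) p"
      by (intro the_inv_into_f_eq[OF inj])
    then show ?thesis using dilatation_eq_dil[of "1 / r" p] r p by simp
  qed
  moreover have "dil (1 / r) p \<in> line.pts" if "p \<in> line.pts" for p
    using line.dil_continuous[of "1 / r"] r that by (auto simp: continuous_map_def line.topspace_star)
  ultimately show ?thesis
    unfolding conj_dilatation_def line.conj_dil_def
    using dilatation_eq_dil[OF r line.Aut_curve_in_pts[OF a]] by (auto simp: restrict_def fun_eq_iff)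
qed

theorem proposition3p13:
  fixes n :: nat
  assumes "n \<ge> 1"
  shows "(n \<noteq> 2 \<longrightarrow>
            Aut_curve (star n) \<cong> sym_group n \<and>
            Aut_semiring (Rat (star n)) \<cong> Aut_curve (star n) \<times>\<times> pos_real_group) \<and>
         (n = 2 \<longrightarrow>
            carrier (Aut_curve (star n)) =
              generate (Aut_curve (star n)) {inversion x | x. x \<in> finite_points (star n)} \<and>
            Aut_curve (star n) \<cong>
              semidirect_product real_add_group (subgroup_generated (Aut_curve (star n)) {iota})
                conj_translation \<and>
            Aut_semiring (Rat (star n)) \<cong>
              semidirect_product (Aut_curve (star n)) pos_real_group conj_dilatation)"
proof -
  interpret star_curve n by unfold_locales (rule assms)
  have "line.A \<cong> semidirect_product line.G pos_real_group conj_dilatation"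
    by (rule line.Aut_semiring_semidirect) (rule conj_dilatation_eq)
  then show ?thesis
    using Aut_curve_symmetric Aut_semiring_direct Aut_curve_line_generated Aut_curve_line_semidirect
    by auto
qed

end
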